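(* Assume the mortar condition (MC) stated in the context holds. Then there exists a constant $\beta_D>0$, independent of $h$ and $H$, such that for any $\mu^p\in\Lambda_H^p$, $$\|\mu^p\|_{\Gamma}\le \beta_D\sup_{0\ne\zeta\in Z_h}\frac{\sum_{i=1}^N\langle \zeta\cdot n_i,\mu^p\rangle_{\Gamma_i}}{\|\zeta\|_{Z_h}}.$$
   Context: Geometry. $\Omega\subset\mathbb{R}^d$, $d\in\{2,3\}$, is a simply connected domain that is a union of non-overlapping polygonal subdomains $\Omega_1,\dots,\Omega_N$. $\partial\Omega=\Gamma_D^u\cup\Gamma_N^\sigma=\Gamma_D^p\cup\Gamma_N^z$ (two decompositions of the boundary). $\Gamma_{i,j}=\partial\Omega_i\cap\partial\Omega_j$, $\Gamma=\bigcup_{i,j}\Gamma_{i,j}$, $\Gamma_i=\partial\Omega_i\cap\Gamma=\partial\Omega_i\setminus\partial\Omega$, and $n_i$ is the outward unit normal on $\partial\Omega_i$. $\mathbb{M}$ denotes $d\times d$ real matrices. $(\cdot,\cdot)_G,\|\cdot\|_G$ are the $L^2(G)$ inner product and norm; $\langle\cdot,\cdot\rangle_S,\|\cdot\|_S$ the $L^2(S)$ inner product (or duality pairing) and norm on a hypersurface $S$; the divergence of a matrix field is taken row-wise; $\|\tau\|_{\mathrm{div},G}^2=\|\tau\|_G^2+\|\mathrm{div}\,\tau\|_G^2$. Spaces. $\mathbb{X}=\{\tau\in H(\mathrm{div};\Omega,\mathbb{M}):\tau n=0\text{ on }\Gamma_N^\sigma\}$, $Z=\{q\in H(\mathrm{div};\Omega):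 q\cdot n=0\text{ on }\Gamma_N^z\}$, $W=L^2(\Omega)$; for a space $U$ on $\Omega$, $U_i=U|_{\Omega_i}$. Each $\Omega_i$ carries a shape regular simplicial or rectangular finite element partition of maximal element diameter $h$; partitions need not match across $\Gamma$. $\mathbb{X}_{h,i}\subset\mathbb{X}_i$ is the stress space of a stable mixed finite element triplet for elasticity with weakly imposed stress symmetry. $Z_{h,i}\times W_{h,i}\subset Z_i\times W_i$ is a stable mixed finite element pair for Darcy flow (such as Raviart–Thomas or Brezzi–Douglas–Marini), so that $\|w\|_{\Omega_i}\le C\sup_{0\neq q\in Z_{h,i}}(\mathrm{div}\,q,w)_{\Omega_i}/\|q\|_{\mathrm{div},\Omega_i}$ for all $w\in W_{h,i}$, with $\mathrm{div}\,Z_{h,i}=W_{h,i}$. For every $\epsilon>0$ there is a canonical mixed interpolant $\Pi_i^z:H^\epsilon(\Omega_i,\mathbb{R}^d)\cap Z_i\to Z_{h,i}$ with $(\mathrm{div}(\Pi_i^z\zeta-\zeta),w)_{\Omega_i}=0$ for all $w\in W_{h,i}$, $\langle(\Pi_i^z\zeta-\zeta)\cdot n_i,\hat\zeta\cdot n_i\rangle_{\Gamma_i}=0$ for all $\hat\zeta\in Z_{h,i}$, and $\|\Pi_i^z\zeta\|_{\mathrm{div},\Omega_i}\le C(\|\zeta\|_{H^\epsilon(\Omega_i)}+\|\mathrm{div}\,\zeta\|_{\Omega_i})$. All constants $C$ are independent of $h,H$. Globally, $Z_h=\bigoplus_{i=1}^N Z_{h,i}$ with norm $\|\zeta\|_{Z_h}^2=\|\zeta\|^2+\|\mathrm{div}_h\zeta\|^2$,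 where $(\mathrm{div}_h\zeta)|_{\Omega_i}=\mathrm{div}(\zeta|_{\Omega_i})$. Mortar spaces. Each $\Gamma_{i,j}$ carries a shape regular partition $\mathcal{T}_{H,i,j}$ (simplices or quadrilaterals in $d-1$ dimensions) with maximal element diameter $H$; $\Lambda_{H,i,j}^u\subset L^2(\Gamma_{i,j};\mathbb{R}^d)$ and $\Lambda^p_{H,i,j}\subset L^2(\Gamma_{i,j})$ consist of continuous or discontinuous piecewise polynomials on $\mathcal{T}_{H,i,j}$, and $\Lambda_H^\star=\bigoplus_{1\le i<j\le N}\Lambda_{H,i,j}^\star$, $\star\in\{u,p\}$. Mortar condition (MC). Let $\mathcal{Q}^u_{h,i}:L^2(\partial\Omega_i,\mathbb{R}^d)\to\mathbb{X}_{h,i}n_i$ and $\mathcal{Q}^p_{h,i}:L^2(\partial\Omega_i)\to Z_{h,i}\cdot n_i$ be the $L^2(\partial\Omega_i)$-orthogonal projections onto the spaces of normal traces (mortar functions are extended by zero to $\partial\Omega$). (MC) states: there is a constant $C>0$ independent of $h,H$ such that $\|\mu^\star\|_{\Gamma_{i,j}}\le C(\|\mathcal{Q}^\star_{h,i}\mu^\star\|_{\Gamma_{i,j}}+\|\mathcal{Q}^\star_{h,j}\mu^\star\|_{\Gamma_{i,j}})$ for all $\mu^\star\in\Lambda_H^\star$, $1\le i<j\le N$, $\star\in\{p,u\}$. *)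

theory Defs
  imports "HOL-Analysis.Analysis"
begin

abbreviation vol :: "(real^'n::finite) set \<Rightarrow> (real^'n) measure" where
  "vol G \<equiv> restrict_space lborel G"

text \<open>
  The \<open>(d-1)\<close>-dimensional surface measure of flat pieces. The area of a part of the hyperplane
  \<open>{x. a \<bullet> x = b}\<close>, \<open>a\<close> a unit vector, is the volume of the right prism of height 1 over it, and the
  areas of the parts in the different hyperplanes are added up (two hyperplanes meet in a set of
  area 0). The hyperplane is counted as \<open>(a, b)\<close> and as \<open>(-a, -b)\<close>, which contribute the two prisms
  of height 1/2 on its two sides. On polyhedral surfaces, the only ones that occur below, this is
  the Hausdorff measure.
\<close>

definition flat_area :: "(real^'n::finite) measure" where
  "flat_area = measure_of UNIV (sets borel)
     (\<lambda>A. \<integral>\<^sup>+ (a, b). emeasure lborel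
        {x. 0 \<le> a \<bullet> x - b \<and> a \<bullet> x - b \<le> 1/2 \<and> x - (a \<bullet> x - b) *\<^sub>R a \<in> A}
        \<partial>count_space {(a, b). norm a = 1})"

lemma space_flat_area [simp]: "space flat_area = UNIV"
  by (simp add: flat_area_def)

lemma sets_flat_area [simp, measurable_cong]: "sets flat_area = sets borel"
  by (simp add: flat_area_def sets.sigma_sets_eq[of borel, simplified])

lemma emeasure_flat_area:
  fixes A :: "(real^'n::finite) set"
  assumes "A \<in> sets borel"
  shows "emeasure flat_area A =
    (\<integral>\<^sup>+ (a, b). emeasure lborel
        {x. 0 \<le> a \<bullet> x - b \<and> a \<bullet> x - b \<le> 1/2 \<and> x - (a \<bullet> x - b) *\<^sub>R a \<in> A}
        \<partial>count_space {(a, b). norm a = 1})"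
proof -
  define P where "P = (\<lambda>(a :: real^'n, b :: real) A.
      {x. 0 \<le> a \<bullet> x - b \<and> a \<bullet> x - b \<le> 1/2 \<and> x - (a \<bullet> x - b) *\<^sub>R a \<in> A})"
  define m where "m = (\<lambda>A. \<integral>\<^sup>+ c. emeasure lborel (P c A) \<partial>count_space {(a, b). norm a = 1})"
  have meas: "P c A \<in> sets lborel" if A: "A \<in> sets borel" for c A
  proof -
    obtain a b where c: "c = (a, b)" by (cases c)
    have [measurable]: "A \<in> sets borel" by (rule A)
    have "{x \<in> space borel. 0 \<le> a \<bullet> x - b \<and> a \<bullet> x - b \<le> 1/2 \<and> x - (a \<bullet> x - b) *\<^sub>R a \<in> A} \<in> sets borel"
      by measurable
    then show ?thesis by (simp add: P_def c)
  qed
  have eq: "(\<lambda>A. \<integral>\<^sup>+ (a, b). emeasure lborel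
        {x. 0 \<le> a \<bullet> x - b \<and> a \<bullet> x - b \<le> 1/2 \<and> x - (a \<bullet> x - b) *\<^sub>R a \<in> A}
        \<partial>count_space {(a :: real^'n, b). norm a = 1}) = m"
    by (auto simp: m_def P_def case_prod_beta' fun_eq_iff)
  have "emeasure flat_area A = m A"
  proof (rule emeasure_measure_of[of flat_area UNIV "sets borel" m])
    show "flat_area = measure_of UNIV (sets borel) m"
      by (simp only: flat_area_def eq)
    show "positive (sets flat_area) m"
      by (simp add: positive_def m_def P_def split_beta)
    show "countably_additive (sets flat_area) m"
    proof (rule countably_additiveI)
      fix F :: "nat \<Rightarrow> (real^'n) set"
      assume F: "range F \<subseteq> sets flat_area" "disjoint_family F"
      have "(\<Sum>i. m (F i)) =
          (\<integral>\<^sup>+ c. (\<Sum>i. emeasure lborel (P c (F i))) \<partial>count_space {(a, b). norm a = 1})"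
        unfolding m_def by (rule nn_integral_suminf[symmetric]) simp
      also have "\<dots> = m (\<Union> (range F))"
        unfolding m_def
      proof (rule nn_integral_cong)
        fix c :: "(real^'n) \<times> real"
        have "(\<Sum>i. emeasure lborel (P c (F i))) = emeasure lborel (\<Union>i. P c (F i))"
        proof (rule suminf_emeasure)
          show "range (\<lambda>i. P c (F i)) \<subseteq> sets lborel"
            using F(1) by (intro image_subsetI meas) auto
          show "disjoint_family (\<lambda>i. P c (F i))"
            using F(2) unfolding disjoint_family_on_def P_def by (cases c) auto
        qed
        also have "(\<Union>i. P c (F i)) = P c (\<Union> (range F))"
          by (cases c) (auto simp: P_def)
        finally show "(\<Sum>i. emeasure lborel (P c (F i))) = emeasure lborel (P c (\<Union> (range F)))" .
      qed
      finally show "(\<Sum>i. m (F i)) = m (\<Union> (range F))" .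
    qed
  qed (use assms in auto)
  then show ?thesis by (simp flip: eq)
qed

abbreviation surf :: "(real^'n::finite) set \<Rightarrow> (real^'n) measure" where
  "surf S \<equiv> restrict_space flat_area S"

text \<open>
  \<open>L\<^sup>2\<close> functions are represented by total functions whose values off the set under consideration are
  irrelevant. The function spaces below are closed under a.e. modification.
\<close>

definition in_L2 :: "'a measure \<Rightarrow> ('a \<Rightarrow> 'b::euclidean_space) \<Rightarrow> bool" where
  "in_L2 M f \<longleftrightarrow> f \<in> borel_measurable M \<and> integrable M (\<lambda>x. (norm (f x))\<^sup>2)"

definition L2_inner :: "'a measure \<Rightarrow> ('a \<Rightarrow> 'b::euclidean_space) \<Rightarrow> ('a \<Rightarrow> 'b) \<Rightarrow> real" where
  "L2_inner M f g = (LINT x|M. f x \<bullet> g x)"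

definition L2_norm :: "'a measure \<Rightarrow> ('a \<Rightarrow> 'b::euclidean_space) \<Rightarrow> real" where
  "L2_norm M f = sqrt (LINT x|M. (norm (f x))\<^sup>2)"

definition nonzero :: "'a measure \<Rightarrow> ('a \<Rightarrow> 'b::euclidean_space) \<Rightarrow> bool" where
  "nonzero M f \<longleftrightarrow> \<not> (AE x in M. f x = 0)"

definition L2_proj ::
  "'a measure \<Rightarrow> ('a \<Rightarrow> 'b::euclidean_space) set \<Rightarrow> ('a \<Rightarrow> 'b) \<Rightarrow> 'a \<Rightarrow> 'b" where
  "L2_proj M V f = (SOME g. g \<in> V \<and> (\<forall>v\<in>V. L2_inner M (\<lambda>x. f x - g x) v = 0))"

definition C1 :: "(real^'n::finite \<Rightarrow> real) \<Rightarrow> (real^'n \<Rightarrow> real^'n) \<Rightarrow> bool" where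
  "C1 \<phi> D\<phi> \<longleftrightarrow> (\<forall>x. GDERIV \<phi> x :> D\<phi> x) \<and> continuous_on UNIV D\<phi>"

definition C1_compact ::
  "(real^'n::finite) set \<Rightarrow> (real^'n \<Rightarrow> real) \<Rightarrow> (real^'n \<Rightarrow> real^'n) \<Rightarrow> bool" where
  "C1_compact G \<phi> D\<phi> \<longleftrightarrow> C1 \<phi> D\<phi> \<and> compact (closure {x. \<phi> x \<noteq> 0}) \<and> closure {x. \<phi> x \<noteq> 0} \<subseteq> G"

definition weak_div ::
  "(real^'n::finite) set \<Rightarrow> (real^'n \<Rightarrow> real^'n) \<Rightarrow> (real^'n \<Rightarrow> real) \<Rightarrow> bool" where
  "weak_div G q f \<longleftrightarrow> in_L2 (vol G) q \<and> in_L2 (vol G) f \<and>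
     (\<forall>\<phi> D\<phi>. C1_compact G \<phi> D\<phi> \<longrightarrow>
        (LINT x|vol G. q x \<bullet> D\<phi> x) = - (LINT x|vol G. f x * \<phi> x))"

definition Hdiv :: "(real^'n::finite) set \<Rightarrow> (real^'n \<Rightarrow> real^'n) set" where
  "Hdiv G = {q. \<exists>f. weak_div G q f}"

definition dvg :: "(real^'n::finite) set \<Rightarrow> (real^'n \<Rightarrow> real^'n) \<Rightarrow> real^'n \<Rightarrow> real" where
  "dvg G q = (SOME f. weak_div G q f)"

definition Hdiv_norm :: "(real^'n::finite) set \<Rightarrow> (real^'n \<Rightarrow> real^'n) \<Rightarrow> real" where
  "Hdiv_norm G q = sqrt ((L2_norm (vol G) q)\<^sup>2 + (L2_norm (vol G) (dvg G q))\<^sup>2)"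

definition HdivM :: "(real^'n::finite) set \<Rightarrow> (real^'n \<Rightarrow> real^'n^'n) set" where
  "HdivM G = {\<tau>. \<forall>k. (\<lambda>x. \<tau> x $ k) \<in> Hdiv G}"

definition dvgM :: "(real^'n::finite) set \<Rightarrow> (real^'n \<Rightarrow> real^'n^'n) \<Rightarrow> real^'n \<Rightarrow> real^'n" where
  "dvgM G \<tau> = (\<lambda>x. \<chi> k. dvg G (\<lambda>y. \<tau> y $ k) x)"

definition HdivM_norm :: "(real^'n::finite) set \<Rightarrow> (real^'n \<Rightarrow> real^'n^'n) \<Rightarrow> real" where
  "HdivM_norm G \<tau> = sqrt ((L2_norm (vol G) \<tau>)\<^sup>2 + (L2_norm (vol G) (dvgM G \<tau>))\<^sup>2)"

text \<open>
  The outward normal trace of \<open>q \<in> H(div; G)\<close>, is the functional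
  \<open>\<phi> \<mapsto> \<langle>q \<cdot> n, \<phi>\<rangle> = (q, \<nabla>\<phi>) + (div q, \<phi>)\<close> on functions on \<open>G\<close>.
\<close>

definition green ::
  "(real^'n::finite) set \<Rightarrow> (real^'n \<Rightarrow> real^'n) \<Rightarrow> (real^'n \<Rightarrow> real) \<Rightarrow> (real^'n \<Rightarrow> real^'n) \<Rightarrow> real" where
  "green G q \<phi> D\<phi> = (LINT x|vol G. q x \<bullet> D\<phi> x + dvg G q x * \<phi> x)"

definition has_normal_trace ::
  "(real^'n::finite) set \<Rightarrow> (real^'n \<Rightarrow> real^'n) \<Rightarrow> (real^'n \<Rightarrow> real) \<Rightarrow> bool" where
  "has_normal_trace G q g \<longleftrightarrow> q \<in> Hdiv G \<and> in_L2 (surf (frontier G)) g \<and>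
     (\<forall>\<phi> D\<phi>. C1 \<phi> D\<phi> \<longrightarrow> green G q \<phi> D\<phi> = L2_inner (surf (frontier G)) g \<phi>)"

definition normal_trace :: "(real^'n::finite) set \<Rightarrow> (real^'n \<Rightarrow> real^'n) \<Rightarrow> real^'n \<Rightarrow> real" where
  "normal_trace G q = (SOME g. has_normal_trace G q g)"

definition has_normal_traceM ::
  "(real^'n::finite) set \<Rightarrow> (real^'n \<Rightarrow> real^'n^'n) \<Rightarrow> (real^'n \<Rightarrow> real^'n) \<Rightarrow> bool" where
  "has_normal_traceM G \<tau> g \<longleftrightarrow> (\<forall>k. has_normal_trace G (\<lambda>x. \<tau> x $ k) (\<lambda>x. g x $ k))"

definition trace_space ::
  "(real^'n::finite) set \<Rightarrow> (real^'n \<Rightarrow> real^'n) set \<Rightarrow> (real^'n \<Rightarrow> real) set" where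
  "trace_space G V = {g. \<exists>q\<in>V. has_normal_trace G q g}"

definition trace_spaceM ::
  "(real^'n::finite) set \<Rightarrow> (real^'n \<Rightarrow> real^'n^'n) set \<Rightarrow> (real^'n \<Rightarrow> real^'n) set" where
  "trace_spaceM G V = {g. \<exists>\<tau>\<in>V. has_normal_traceM G \<tau> g}"

text \<open>\<open>q \<cdot> n = 0\<close> on the part \<open>S\<close> of the boundary, in the weak sense: test functions vanish on the rest.\<close>

definition normal_zero_on ::
  "(real^'n::finite) set \<Rightarrow> (real^'n) set \<Rightarrow> (real^'n \<Rightarrow> real^'n) \<Rightarrow> bool" where
  "normal_zero_on G S q \<longleftrightarrow> q \<in> Hdiv G \<and>
     (\<forall>\<phi> D\<phi>. C1 \<phi> D\<phi> \<and> (\<forall>x\<in>frontier G - S. \<phi> x = 0) \<longrightarrow> green G q \<phi> D\<phi> = 0)"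

text \<open>
  \<open>\<langle>q \<cdot> n, g\<rangle>\<close> on \<open>\<partial>G\<close> has the value \<open>c\<close>, as an \<open>L\<^sup>2\<close> inner product or as a duality pairing.
  The second alternative is for \<open>q \<in> H\<^sup>\<epsilon> \<inter> H(div)\<close>, which is in \<open>L\<^sup>p\<close> for some \<open>p > 2\<close>, and for
  \<open>g\<close> (such as a discontinuous piecewise polynomial) that is the trace of a function \<open>v\<close> in
  \<open>W\<^bsup>1,s\<^esup>\<close> for all \<open>s < 2\<close>: then \<open>(q, \<nabla>v) + (div q, v)\<close> depends on \<open>g\<close> only. Here \<open>v\<close> and its gradient
  \<open>V\<close> are approximated by \<open>C\<^sup>1\<close> functions.
\<close>

definition normal_pairing ::
  "(real^'n::finite) set \<Rightarrow> (real^'n \<Rightarrow> real^'n) \<Rightarrow> (real^'n \<Rightarrow> real) \<Rightarrow> real \<Rightarrow> bool" where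
  "normal_pairing G q g c \<longleftrightarrow>
     (\<exists>t. has_normal_trace G q t \<and> c = L2_inner (surf (frontier G)) t g) \<or>
     (\<exists>(\<phi> :: nat \<Rightarrow> real^'n \<Rightarrow> real) D\<phi> (v :: real^'n \<Rightarrow> real) (V :: real^'n \<Rightarrow> real^'n).
        (\<forall>k. C1 (\<phi> k) (D\<phi> k)) \<and>
        v \<in> borel_measurable (vol G) \<and> V \<in> borel_measurable (vol G) \<and>
        (\<lambda>k. \<integral>\<^sup>+ x. ennreal ((\<phi> k x - v x)\<^sup>2) \<partial>vol G) \<longlonglongrightarrow> 0 \<and>
        (\<forall>s. 1 \<le> s \<and> s < 2 \<longrightarrow>
          (\<lambda>k. \<integral>\<^sup>+ x. ennreal (norm (D\<phi> k x - V x) powr s) \<partial>vol G) \<longlonglongrightarrow> 0) \<and>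
        (\<lambda>k. \<integral>\<^sup>+ x. ennreal ((\<phi> k x - g x)\<^sup>2) \<partial>surf (frontier G)) \<longlonglongrightarrow> 0 \<and>
        (\<lambda>k. green G q (\<phi> k) (D\<phi> k)) \<longlonglongrightarrow> c)"

definition weak_partial ::
  "(real^'n::finite) set \<Rightarrow> 'n \<Rightarrow> (real^'n \<Rightarrow> real^'n) \<Rightarrow> (real^'n \<Rightarrow> real^'n) \<Rightarrow> bool" where
  "weak_partial G i f g \<longleftrightarrow> in_L2 (vol G) f \<and> in_L2 (vol G) g \<and>
     (\<forall>\<phi> D\<phi>. C1_compact G \<phi> D\<phi> \<longrightarrow>
        (LINT x|vol G. (D\<phi> x $ i) *\<^sub>R f x) = - (LINT x|vol G. \<phi> x *\<^sub>R g x))"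

text \<open>
  Derivatives are indexed by lists of coordinate directions instead of multi-indices. The norm
  below therefore counts mixed derivatives several times and is equivalent to the usual one.
\<close>

primrec weak_D ::
  "(real^'n::finite) set \<Rightarrow> 'n list \<Rightarrow> (real^'n \<Rightarrow> real^'n) \<Rightarrow> real^'n \<Rightarrow> real^'n" where
  "weak_D G [] f = f"
| "weak_D G (i # \<alpha>) f = weak_D G \<alpha> (SOME g. weak_partial G i f g)"

text \<open>The square of the Slobodeckij seminorm of order \<open>\<theta> \<in> (0,1)\<close>\<close>

definition slobodeckij ::
  "(real^'n::finite) set \<Rightarrow> real \<Rightarrow> (real^'n \<Rightarrow> real^'n) \<Rightarrow> ennreal" where
  "slobodeckij G \<theta> f = (\<integral>\<^sup>+ x. \<integral>\<^sup>+ y.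
     ennreal ((norm (f x - f y))\<^sup>2 / norm (x - y) powr (real CARD('n) + 2 * \<theta>)) \<partial>vol G \<partial>vol G)"

definition Hs :: "(real^'n::finite) set \<Rightarrow> real \<Rightarrow> (real^'n \<Rightarrow> real^'n) set" where
  "Hs G s = {f. in_L2 (vol G) f \<and>
     (\<forall>\<alpha> i. length \<alpha> < nat \<lfloor>s\<rfloor> \<longrightarrow> (\<exists>g. weak_partial G i (weak_D G \<alpha> f) g)) \<and>
     (frac s \<noteq> 0 \<longrightarrow>
       (\<forall>\<alpha>. length \<alpha> = nat \<lfloor>s\<rfloor> \<longrightarrow> slobodeckij G (frac s) (weak_D G \<alpha> f) < \<infinity>))}"

definition Hs_norm :: "(real^'n::finite) set \<Rightarrow> real \<Rightarrow> (real^'n \<Rightarrow> real^'n) \<Rightarrow> real" where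
  "Hs_norm G s f = sqrt
     ((\<Sum>\<alpha> | length \<alpha> \<le> nat \<lfloor>s\<rfloor>. (L2_norm (vol G) (weak_D G \<alpha> f))\<^sup>2) +
      (if frac s = 0 then 0
       else \<Sum>\<alpha> | length \<alpha> = nat \<lfloor>s\<rfloor>. enn2real (slobodeckij G (frac s) (weak_D G \<alpha> f))))"

text \<open>\<open>interior (closure G) = G\<close> excludes slits. The boundary need not be Lipschitz.\<close>

definition polyhedral_domain :: "(real^'n::finite) set \<Rightarrow> bool" where
  "polyhedral_domain G \<longleftrightarrow> open G \<and> connected G \<and> G \<noteq> {} \<and>
     (\<exists>\<P>. finite \<P> \<and> (\<forall>P\<in>\<P>. polytope P) \<and> closure G = \<Union>\<P>) \<and> interior (closure G) = G"

text \<open>\<open>Omega_sub i\<close> for \<open>i < n_sub\<close> are the subdomains.\<close>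

record ('n::finite) geometry =
  Omega :: "(real^'n) set"
  n_sub :: nat
  Omega_sub :: "nat \<Rightarrow> (real^'n) set"
  GammaD_u :: "(real^'n) set"
  GammaN_sigma :: "(real^'n) set"
  GammaD_p :: "(real^'n) set"
  GammaN_z :: "(real^'n) set"

definition boundary_decomposition ::
  "(real^'n::finite) set \<Rightarrow> (real^'n) set \<Rightarrow> (real^'n) set \<Rightarrow> bool" where
  "boundary_decomposition B D E \<longleftrightarrow>
     D \<in> sets borel \<and> E \<in> sets borel \<and> B = D \<union> E \<and> emeasure flat_area (D \<inter> E) = 0"

definition admissible_geometry :: "('n::finite) geometry \<Rightarrow> bool" where
  "admissible_geometry \<G> \<longleftrightarrow>
     polyhedral_domain (Omega \<G>) \<and> simply_connected (Omega \<G>) \<and>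
     (\<forall>i<n_sub \<G>. polyhedral_domain (Omega_sub \<G> i)) \<and>
     (\<forall>i<n_sub \<G>. \<forall>j<n_sub \<G>. i \<noteq> j \<longrightarrow> Omega_sub \<G> i \<inter> Omega_sub \<G> j = {}) \<and>
     closure (Omega \<G>) = (\<Union>i<n_sub \<G>. closure (Omega_sub \<G> i)) \<and>
     boundary_decomposition (frontier (Omega \<G>)) (GammaD_u \<G>) (GammaN_sigma \<G>) \<and>
     boundary_decomposition (frontier (Omega \<G>)) (GammaD_p \<G>) (GammaN_z \<G>)"

definition Gamma_ij :: "('n::finite) geometry \<Rightarrow> nat \<Rightarrow> nat \<Rightarrow> (real^'n) set" where
  "Gamma_ij \<G> i j = frontier (Omega_sub \<G> i) \<inter> frontier (Omega_sub \<G> j)"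

definition Gamma_all :: "('n::finite) geometry \<Rightarrow> (real^'n) set" where
  "Gamma_all \<G> = (\<Union>j<n_sub \<G>. \<Union>i<j. Gamma_ij \<G> i j)"

text \<open>Up to a set of area 0, this is \<open>\<partial>\<Omega>\<^sub>i\<close> without \<open>\<partial>\<Omega>\<close>.\<close>

definition Gamma_i :: "('n::finite) geometry \<Rightarrow> nat \<Rightarrow> (real^'n) set" where
  "Gamma_i \<G> i = frontier (Omega_sub \<G> i) \<inter> Gamma_all \<G>"

definition X_space :: "('n::finite) geometry \<Rightarrow> (real^'n \<Rightarrow> real^'n^'n) set" where
  "X_space \<G> = {\<tau> \<in> HdivM (Omega \<G>).
     \<forall>k. normal_zero_on (Omega \<G>) (GammaN_sigma \<G>) (\<lambda>x. \<tau> x $ k)}"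

definition Z_space :: "('n::finite) geometry \<Rightarrow> (real^'n \<Rightarrow> real^'n) set" where
  "Z_space \<G> = {q \<in> Hdiv (Omega \<G>). normal_zero_on (Omega \<G>) (GammaN_z \<G>) q}"

definition restrict_to ::
  "(real^'n::finite) set \<Rightarrow> (real^'n \<Rightarrow> 'b::euclidean_space) set \<Rightarrow> (real^'n \<Rightarrow> 'b) set" where
  "restrict_to G U = {f. in_L2 (vol G) f \<and> (\<exists>u\<in>U. AE x in vol G. f x = u x)}"

definition poly_deg_le :: "nat \<Rightarrow> (real^'n::finite \<Rightarrow> real) \<Rightarrow> bool" where
  "poly_deg_le r p \<longleftrightarrow>
     (\<exists>c. \<forall>x. p x = (\<Sum>\<alpha> | (\<Sum>i\<in>UNIV. \<alpha> i) \<le> r. c \<alpha> * (\<Prod>i\<in>UNIV. (x $ i) ^ \<alpha> i)))"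

definition pw_poly_space ::
  "(real^'n::finite) measure \<Rightarrow> (real^'n) set set \<Rightarrow> nat \<Rightarrow> (real^'n \<Rightarrow> 'b::euclidean_space) set \<Rightarrow> bool" where
  "pw_poly_space M \<T> r V \<longleftrightarrow>
     (\<lambda>x. 0) \<in> V \<and>
     (\<forall>f\<in>V. \<forall>g\<in>V. \<forall>a b. (\<lambda>x. a *\<^sub>R f x + b *\<^sub>R g x) \<in> V) \<and>
     (\<forall>f\<in>V. in_L2 M f \<and>
        (\<forall>E\<in>\<T>. \<exists>p. (\<forall>b\<in>Basis. poly_deg_le r (\<lambda>x. p x \<bullet> b)) \<and> (AE x in M. x \<in> E \<longrightarrow> f x = p x))) \<and>
     (\<forall>f\<in>V. \<forall>g. in_L2 M g \<and> (AE x in M. f x = g x) \<longrightarrow> g \<in> V)"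

text \<open>For elements of lower dimension the balls are taken in the affine hull.\<close>

definition shape_regular :: "real \<Rightarrow> (real^'n::finite) set \<Rightarrow> bool" where
  "shape_regular \<kappa> E \<longleftrightarrow> (\<exists>c\<in>E. ball c (diameter E / \<kappa>) \<inter> affine hull E \<subseteq> E)"

definition rectangular :: "(real^'n::finite) set \<Rightarrow> bool" where
  "rectangular E \<longleftrightarrow> (\<exists>(f :: real^'n \<Rightarrow> real^'n) a b. orthogonal_transformation f \<and> box a b \<noteq> {} \<and> E = f ` cbox a b)"

definition fe_partition :: "real \<Rightarrow> (real^'n::finite) set \<Rightarrow> (real^'n) set set \<Rightarrow> bool" where
  "fe_partition \<kappa> G \<T> \<longleftrightarrow> finite \<T> \<and> \<Union>\<T> = closure G \<and>
     ((\<forall>E\<in>\<T>. int CARD('n) simplex E) \<or> (\<forall>E\<in>\<T>. rectangular E)) \<and>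
     (\<forall>E\<in>\<T>. \<forall>F\<in>\<T>. (E \<inter> F) face_of E \<and> (E \<inter> F) face_of F) \<and>
     (\<forall>E\<in>\<T>. shape_regular \<kappa> E)"

definition quadrilateral :: "(real^'n::finite) set \<Rightarrow> bool" where
  "quadrilateral E \<longleftrightarrow> polytope E \<and> aff_dim E = 2 \<and> card {v. v extreme_point_of E} = 4"

text \<open>
  A null set is left over because \<open>\<partial>\<Omega>\<^sub>i \<inter> \<partial>\<Omega>\<^sub>j\<close> can have parts of dimension less than \<open>d - 1\<close>,
  for instance a vertex.
\<close>

definition mortar_partition :: "real \<Rightarrow> (real^'n::finite) set \<Rightarrow> (real^'n) set set \<Rightarrow> bool" where
  "mortar_partition \<kappa> S \<T> \<longleftrightarrow> finite \<T> \<and> \<Union>\<T> \<subseteq> S \<and> emeasure flat_area (S - \<Union>\<T>) = 0 \<and>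
     (\<forall>E\<in>\<T>. (int CARD('n) - 1) simplex E \<or> (CARD('n) = 3 \<and> quadrilateral E)) \<and>
     (\<forall>E\<in>\<T>. \<forall>F\<in>\<T>. E \<noteq> F \<longrightarrow> emeasure flat_area (E \<inter> F) = 0) \<and>
     (\<forall>E\<in>\<T>. shape_regular \<kappa> E)"

text \<open>
  The Brezzi conditions for weakly symmetric elasticity on \<open>G\<close>, with \<open>X \<times> V \<times> Q\<close> the spaces of
  stress, displacement and rotation. In the first one the elasticity form is replaced by the
  \<open>L\<^sup>2\<close> inner product, to which it is equivalent. Suprema are taken in the extended reals here
  and below, so that unboundedness needs no convention.
\<close>

definition stable_elasticity_triplet ::
  "real \<Rightarrow> (real^'n::finite) set \<Rightarrow> (real^'n \<Rightarrow> real^'n^'n) set \<Rightarrow> (real^'n \<Rightarrow> real^'n) set \<Rightarrow>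
   (real^'n \<Rightarrow> real^'n^'n) set \<Rightarrow> bool" where
  "stable_elasticity_triplet C G X V Q \<longleftrightarrow>
     (\<forall>\<xi>\<in>Q. AE x in vol G. transpose (\<xi> x) = - \<xi> x) \<and>
     (\<forall>\<tau>\<in>X. (\<forall>v\<in>V. L2_inner (vol G) (dvgM G \<tau>) v = 0) \<and> (\<forall>\<xi>\<in>Q. L2_inner (vol G) \<tau> \<xi> = 0) \<longrightarrow>
        HdivM_norm G \<tau> \<le> C * L2_norm (vol G) \<tau>) \<and>
     (\<forall>v\<in>V. \<forall>\<xi>\<in>Q. ereal (L2_norm (vol G) v + L2_norm (vol G) \<xi>) \<le>
        ereal C * (SUP \<tau>\<in>{\<tau>\<in>X. nonzero (vol G) \<tau>}.
          ereal ((L2_inner (vol G) (dvgM G \<tau>) v + L2_inner (vol G) \<tau> \<xi>) / HdivM_norm G \<tau>)))"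

definition stable_darcy_pair ::
  "real \<Rightarrow> (real^'n::finite) set \<Rightarrow> (real^'n \<Rightarrow> real^'n) set \<Rightarrow> (real^'n \<Rightarrow> real) set \<Rightarrow> bool" where
  "stable_darcy_pair C G Z W \<longleftrightarrow>
     (\<forall>w\<in>W. ereal (L2_norm (vol G) w) \<le>
        ereal C * (SUP q\<in>{q\<in>Z. nonzero (vol G) q}.
          ereal (L2_inner (vol G) (dvg G q) w / Hdiv_norm G q))) \<and>
     {w. \<exists>q\<in>Z. weak_div G q w} = W"

record ('n::finite) discretization =
  mesh :: "nat \<Rightarrow> (real^'n) set set"
  X_h :: "nat \<Rightarrow> (real^'n \<Rightarrow> real^'n^'n) set"
  V_h :: "nat \<Rightarrow> (real^'n \<Rightarrow> real^'n) set"
  Q_h :: "nat \<Rightarrow> (real^'n \<Rightarrow> real^'n^'n) set"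
  Z_h :: "nat \<Rightarrow> (real^'n \<Rightarrow> real^'n) set"
  W_h :: "nat \<Rightarrow> (real^'n \<Rightarrow> real) set"
  mortar_mesh :: "nat \<Rightarrow> nat \<Rightarrow> (real^'n) set set"
  Lambda_u_ij :: "nat \<Rightarrow> nat \<Rightarrow> (real^'n \<Rightarrow> real^'n) set"
  Lambda_p_ij :: "nat \<Rightarrow> nat \<Rightarrow> (real^'n \<Rightarrow> real) set"

text \<open>
  Normal traces of finite element functions are piecewise polynomials, in particular in \<open>L\<^sup>2\<close>;
  this is recorded explicitly for \<open>X_h\<close> and \<open>Z_h\<close>. Since \<open>Z_h i\<close> is not the zero space, the
  suprema over its nonzero elements are not over the empty set.
\<close>

definition admissible_discretization ::
  "('n::finite) geometry \<Rightarrow> real \<Rightarrow> nat \<Rightarrow> real \<Rightarrow> 'n discretization \<Rightarrow> bool" where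
  "admissible_discretization \<G> \<kappa> r C D \<longleftrightarrow>
     (\<forall>i<n_sub \<G>. let G = Omega_sub \<G> i; M = vol G; \<T> = mesh D i in
        fe_partition \<kappa> G \<T> \<and>
        pw_poly_space M \<T> r (X_h D i) \<and> pw_poly_space M \<T> r (V_h D i) \<and>
        pw_poly_space M \<T> r (Q_h D i) \<and>
        pw_poly_space M \<T> r (Z_h D i) \<and> pw_poly_space M \<T> r (W_h D i) \<and>
        X_h D i \<subseteq> restrict_to G (X_space \<G>) \<and> (\<forall>\<tau>\<in>X_h D i. \<exists>g. has_normal_traceM G \<tau> g) \<and>
        Z_h D i \<subseteq> restrict_to G (Z_space \<G>) \<and> (\<forall>q\<in>Z_h D i. \<exists>g. has_normal_trace G q g) \<and>
        (\<exists>q\<in>Z_h D i. nonzero M q) \<and>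
        stable_elasticity_triplet C G (X_h D i) (V_h D i) (Q_h D i) \<and>
        stable_darcy_pair C G (Z_h D i) (W_h D i)) \<and>
     (\<forall>j<n_sub \<G>. \<forall>i<j. let S = Gamma_ij \<G> i j; \<T> = mortar_mesh D i j in
        mortar_partition \<kappa> S \<T> \<and>
        pw_poly_space (surf S) \<T> r (Lambda_u_ij D i j) \<and>
        pw_poly_space (surf S) \<T> r (Lambda_p_ij D i j))"

definition mixed_interpolant ::
  "('n::finite) geometry \<Rightarrow> 'n discretization \<Rightarrow> nat \<Rightarrow> real \<Rightarrow> real \<Rightarrow>
   ((real^'n \<Rightarrow> real^'n) \<Rightarrow> (real^'n \<Rightarrow> real^'n)) \<Rightarrow> bool" where
  "mixed_interpolant \<G> D i \<epsilon> C \<I> \<longleftrightarrow> (let G = Omega_sub \<G> i in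
     \<forall>\<zeta> \<in> Hs G \<epsilon> \<inter> restrict_to G (Z_space \<G>).
       \<I> \<zeta> \<in> Z_h D i \<and>
       (\<forall>w\<in>W_h D i. L2_inner (vol G) (dvg G (\<lambda>x. \<I> \<zeta> x - \<zeta> x)) w = 0) \<and>
       (\<forall>\<zeta>'\<in>Z_h D i. \<forall>c.
          normal_pairing G (\<lambda>x. \<I> \<zeta> x - \<zeta> x)
            (\<lambda>x. if x \<in> Gamma_i \<G> i then normal_trace G \<zeta>' x else 0) c \<longrightarrow> c = 0) \<and>
       Hdiv_norm G (\<I> \<zeta>) \<le> C * (Hs_norm G \<epsilon> \<zeta> + L2_norm (vol G) (dvg G \<zeta>)))"

text \<open>
  A family of discretizations, with arbitrary mesh sizes \<open>h\<close> and \<open>H\<close>. A constant is independent of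
  \<open>h\<close> and \<open>H\<close> if it is the same for all members of the family.
\<close>

definition admissible_family ::
  "('n::finite) geometry \<Rightarrow> 'n discretization set \<Rightarrow> bool" where
  "admissible_family \<G> \<D> \<longleftrightarrow>
     (\<exists>\<kappa>>0. \<exists>r. \<exists>C>0. \<forall>D\<in>\<D>. admissible_discretization \<G> \<kappa> r C D) \<and>
     (\<forall>\<epsilon>>0. \<exists>C>0. \<forall>D\<in>\<D>. \<forall>i<n_sub \<G>. \<exists>\<I>. mixed_interpolant \<G> D i \<epsilon> C \<I>)"

text \<open>
  Elements of \<open>\<Oplus> \<Lambda>\<^sub>i\<^sub>j\<close> as single functions on the interface, extended by zero. The \<open>\<Gamma>\<^sub>i\<^sub>j\<close> overlap
  in sets of area 0 only, and the \<open>\<Lambda>\<^sub>i\<^sub>j\<close> are closed under modification on such sets.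
\<close>

definition mortar_space ::
  "('n::finite) geometry \<Rightarrow> (nat \<Rightarrow> nat \<Rightarrow> (real^'n \<Rightarrow> 'b::euclidean_space) set) \<Rightarrow>
   (real^'n \<Rightarrow> 'b) set" where
  "mortar_space \<G> L = {\<mu>. in_L2 (surf (Gamma_all \<G>)) \<mu> \<and> (\<forall>x. x \<notin> Gamma_all \<G> \<longrightarrow> \<mu> x = 0) \<and>
     (\<forall>j<n_sub \<G>. \<forall>i<j. \<mu> \<in> L i j)}"

definition Q_u :: "('n::finite) geometry \<Rightarrow> 'n discretization \<Rightarrow> nat \<Rightarrow> (real^'n \<Rightarrow> real^'n) \<Rightarrow> real^'n \<Rightarrow> real^'n" where
  "Q_u \<G> D i = L2_proj (surf (frontier (Omega_sub \<G> i))) (trace_spaceM (Omega_sub \<G> i) (X_h D i))"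

definition Q_p :: "('n::finite) geometry \<Rightarrow> 'n discretization \<Rightarrow> nat \<Rightarrow> (real^'n \<Rightarrow> real) \<Rightarrow> real^'n \<Rightarrow> real" where
  "Q_p \<G> D i = L2_proj (surf (frontier (Omega_sub \<G> i))) (trace_space (Omega_sub \<G> i) (Z_h D i))"

definition mortar_condition ::
  "('n::finite) geometry \<Rightarrow> 'n discretization set \<Rightarrow> bool" where
  "mortar_condition \<G> \<D> \<longleftrightarrow> (\<exists>C>0. \<forall>D\<in>\<D>. \<forall>j<n_sub \<G>. \<forall>i<j. let M = surf (Gamma_ij \<G> i j) in
     (\<forall>\<mu>\<in>mortar_space \<G> (Lambda_u_ij D).
        L2_norm M \<mu> \<le> C * (L2_norm M (Q_u \<G> D i \<mu>) + L2_norm M (Q_u \<G> D j \<mu>))) \<and>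
     (\<forall>\<mu>\<in>mortar_space \<G> (Lambda_p_ij D).
        L2_norm M \<mu> \<le> C * (L2_norm M (Q_p \<G> D i \<mu>) + L2_norm M (Q_p \<G> D j \<mu>))))"

text \<open>Elements of \<open>\<Oplus> Z\<^sub>h\<^sub>,\<^sub>i\<close> as tuples of functions on the subdomains\<close>

definition Zh_sum ::
  "('n::finite) geometry \<Rightarrow> 'n discretization \<Rightarrow> (nat \<Rightarrow> real^'n \<Rightarrow> real^'n) set" where
  "Zh_sum \<G> D = {\<zeta>. \<forall>i<n_sub \<G>. \<zeta> i \<in> Z_h D i}"

definition Zh_nonzero :: "('n::finite) geometry \<Rightarrow> (nat \<Rightarrow> real^'n \<Rightarrow> real^'n) \<Rightarrow> bool" where
  "Zh_nonzero \<G> \<zeta> \<longleftrightarrow> (\<exists>i<n_sub \<G>. nonzero (vol (Omega_sub \<G> i)) (\<zeta> i))"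

definition Zh_norm :: "('n::finite) geometry \<Rightarrow> (nat \<Rightarrow> real^'n \<Rightarrow> real^'n) \<Rightarrow> real" where
  "Zh_norm \<G> \<zeta> = sqrt
     ((\<Sum>i<n_sub \<G>. (L2_norm (vol (Omega_sub \<G> i)) (\<zeta> i))\<^sup>2) +
      (\<Sum>i<n_sub \<G>. (L2_norm (vol (Omega_sub \<G> i)) (dvg (Omega_sub \<G> i) (\<zeta> i)))\<^sup>2))"

end

theory Submission
  imports Defs
begin

text \<open>
  On each subdomain let \<open>g\<close> be the projection of the mortar function onto the discrete normal traces.
  Every boundary point \<open>y\<close> sees a ball of fixed radius inside the subdomain, namely in a polytope of
  its closure that contains \<open>y\<close>. Moving a unit mass from \<open>y\<close> along segments into this ball and
  superposing the resulting fields with weight \<open>g\<close> yields a field \<open>\<psi>\<close> with normal trace \<open>g\<close> and square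
  integrable divergence. The kernel has a singularity of order \<open>d - 1\<close> and the boundary is a
  \<open>(d - 1)\<close>-dimensional measure, so Schur's test bounds \<open>\<psi>\<close> in \<open>H\<^sup>1\<^sup>/\<^sup>8\<close> by the \<open>L\<^sup>2\<close> norm of \<open>g\<close>; no elliptic
  regularity is needed. Since some discrete field also has normal trace \<open>g\<close>, \<open>\<psi>\<close> satisfies the outer
  boundary condition, and its interpolant has normal trace \<open>g\<close> on the interface. Pairing the
  interpolants with the mortar function gives the sum of the squared norms of the projections, which
  bound the mortar function by the mortar condition.
\<close>

section \<open>Test functions\<close>

text \<open>The textbook field is the gradient of a Neumann solution with data \<open>g\<close>. Its
  regularity theory asks for a Lipschitz boundary, which \<open>polyhedral_domain\<close> does not
  guarantee, and the problem requires compatible data. The transport field meets neither obstacle: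
  it follows segments inside convex polytopes only, and the surplus of \<open>g\<close> is left in
  the balls as divergence. For a domain star-shaped with respect to one ball the kernel is that of
  Bogovskii; here the ball changes with the boundary point. Since interpolants exist for every order
  of smoothness \<open>\<epsilon> > 0\<close>, the order can be as small as the singular kernel
  dictates. Schur's test between a (d - 1)-dimensional and a d-dimensional measure admits kernels of
  order below d - 1/2. The field has order d - 1, which leaves a margin of 1/2; the Hoelder exponent
  1/4 spends half of it, and the order 1/8 is half of that exponent. The mortar function vanishes
  off the interface. Hence it does not matter that the interpolant reproduces \<open>g\<close> only
  there, although \<open>g\<close> is a projection on the whole boundary of the subdomain.\<close>

lemma C1_const: "C1 (\<lambda>x. c) (\<lambda>x. 0)"
  by (simp add: C1_def GDERIV_const)

lemma C1_continuous:
  assumes "C1 \<phi> D\<phi>"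
  shows "continuous_on UNIV \<phi>" "continuous_on UNIV D\<phi>"
  using assms unfolding C1_def gderiv_def
  by (auto intro!: continuous_at_imp_continuous_on has_derivative_continuous)

lemma C1_measurable [measurable_dest]:
  assumes "C1 \<phi> D\<phi>"
  shows "\<phi> \<in> borel_measurable borel" "D\<phi> \<in> borel_measurable borel"
  using C1_continuous[OF assms] by (auto intro: borel_measurable_continuous_onI)

lemma C1_mult:
  assumes "C1 f Df" "C1 g Dg"
  shows "C1 (\<lambda>x. f x * g x) (\<lambda>x. f x *\<^sub>R Dg x + g x *\<^sub>R Df x)"
  using assms C1_continuous[OF assms(1)] C1_continuous[OF assms(2)] unfolding C1_def
  by (auto intro!: GDERIV_mult continuous_intros)

lemma C1_prod:
  assumes "finite I" "\<And>i. i \<in> I \<Longrightarrow> \<exists>D. C1 (f i) D"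
  shows "\<exists>D. C1 (\<lambda>x. \<Prod>i\<in>I. f i x) D"
  using assms
proof (induction I)
  case empty
  show ?case using C1_const[of 1] by auto
next
  case (insert i I)
  then obtain D D' where "C1 (f i) D" "C1 (\<lambda>x. \<Prod>i\<in>I. f i x) D'" by blast
  from C1_mult[OF this] show ?case using insert by auto
qed

lemma C1_coordinate:
  fixes h h' :: "real \<Rightarrow> real" and i :: "'n::finite"
  assumes "\<And>u. (h has_real_derivative h' u) (at u)" "continuous_on UNIV h'"
  shows "C1 (\<lambda>x :: real^'n. h (x $ i)) (\<lambda>x. h' (x $ i) *\<^sub>R axis i 1)"
  unfolding C1_def
proof (intro conjI allI)
  fix x :: "real^'n"
  have "GDERIV (\<lambda>x. x $ i) x :> axis i 1"
    unfolding gderiv_def by (simp add: inner_axis bounded_linear_imp_has_derivative bounded_linear_vec_nth)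
  from GDERIV_DERIV_compose[OF this assms(1)]
  show "GDERIV (\<lambda>x. h (x $ i)) x :> h' (x $ i) *\<^sub>R axis i 1" by simp
  show "continuous_on UNIV (\<lambda>x :: real^'n. h' (x $ i) *\<^sub>R (axis i 1 :: real^'n))"
    by (intro continuous_intros continuous_on_compose2[OF assms(2)]) auto
qed

text \<open>The square of a positive part is C^1, so this is a C^1 function; it tends to the
  indicator of the open interval as \<open>k\<close> grows. The form
  \<open>1 - inverse (1 + k * s)\<close> keeps it between 0 and 1.\<close>

definition bump :: "nat \<Rightarrow> real \<Rightarrow> real \<Rightarrow> real \<Rightarrow> real" where
  "bump k a b u = 1 - inverse (1 + real k * (max 0 ((u - a) * (b - u)))\<^sup>2)"

definition bump' :: "nat \<Rightarrow> real \<Rightarrow> real \<Rightarrow> real \<Rightarrow> real" where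
  "bump' k a b u = real k * (2 * max 0 ((u - a) * (b - u)) * (a + b - 2 * u)) *
     (inverse (1 + real k * (max 0 ((u - a) * (b - u)))\<^sup>2))\<^sup>2"

lemma DERIV_max_0_power2: "((\<lambda>u::real. (max 0 u)\<^sup>2) has_real_derivative 2 * max 0 u) (at u)"
proof -
  consider "u > 0" | "u < 0" | "u = 0" by linarith
  then show ?thesis
  proof cases
    case 1
    have "((\<lambda>u::real. u\<^sup>2) has_real_derivative 2 * u) (at u)" by (auto intro!: derivative_eq_intros)
    then have "((\<lambda>u::real. (max 0 u)\<^sup>2) has_real_derivative 2 * u) (at u)"
      by (rule has_field_derivative_transform_within_open[where S="{0<..}"]) (use 1 in auto)
    with 1 show ?thesis by simp
  next
    case 2
    have "((\<lambda>u::real. 0) has_real_derivative 0) (at u)" by simp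
    then have "((\<lambda>u::real. (max 0 u)\<^sup>2) has_real_derivative 0) (at u)"
      by (rule has_field_derivative_transform_within_open[where S="{..<0}"]) (use 2 in auto)
    with 2 show ?thesis by simp
  next
    case 3
    \<comment> \<open>At the kink the difference quotient is dominated by
      \<open>\<bar>h\<bar>\<close>.\<close>
    have "(\<lambda>h. (max 0 h)\<^sup>2 / h) \<midarrow>0\<rightarrow> (0::real)"
    proof (rule Lim_null_comparison)
      show "\<forall>\<^sub>F h in at 0. norm ((max 0 h)\<^sup>2 / h) \<le> \<bar>h::real\<bar>"
        by (intro always_eventually) (auto simp: max_def power2_eq_square)
      show "((\<lambda>h::real. \<bar>h\<bar>) \<longlongrightarrow> 0) (at 0)" by (auto intro!: tendsto_eq_intros)
    qed
    then show ?thesis using 3 by (simp add: DERIV_def)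
  qed
qed

lemma bump_has_derivative: "(bump k a b has_real_derivative bump' k a b u) (at u)"
proof -
  have pos: "1 + real k * (max 0 ((u - a) * (b - u)))\<^sup>2 > 0"
    by (intro add_pos_nonneg) auto
  have *: "((\<lambda>u. (max 0 ((u - a) * (b - u)))\<^sup>2) has_real_derivative
      2 * max 0 ((u - a) * (b - u)) * (a + b - 2 * u)) (at u)"
    by (rule DERIV_chain2[OF DERIV_max_0_power2]) (auto intro!: derivative_eq_intros)
  have "((\<lambda>u. 1 - inverse (1 + real k * S u)) has_real_derivative
      real k * S' * (inverse (1 + real k * S u))\<^sup>2) (at u)"
    if "(S has_real_derivative S') (at u)" "1 + real k * S u > 0" for S S'
    using that by (auto intro!: derivative_eq_intros simp: power2_eq_square)
  from this[OF * pos] show ?thesis unfolding bump_def bump'_def .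
qed

lemma continuous_bump': "continuous_on UNIV (bump' k a b)"
proof -
  have "1 + real k * (max 0 ((u - a) * (b - u)))\<^sup>2 > 0" for u
    by (intro add_pos_nonneg) auto
  then show ?thesis unfolding bump'_def
    by (intro continuous_intros) (metis less_irrefl)
qed

lemma bump_bounds: "0 \<le> bump k a b u" "bump k a b u \<le> 1"
proof -
  have "1 + real k * (max 0 ((u - a) * (b - u)))\<^sup>2 \<ge> 1"
    by auto
  then show "0 \<le> bump k a b u" "bump k a b u \<le> 1" unfolding bump_def
    by (auto simp: inverse_le_1_iff)
qed

lemma bump_eq_0: "u \<notin> {a<..<b} \<Longrightarrow> a \<le> b \<Longrightarrow> bump k a b u = 0"
proof -
  assume "u \<notin> {a<..<b}" "a \<le> b"
  then have "(u - a) * (b - u) \<le> 0" by (auto simp: mult_le_0_iff)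
  then show ?thesis by (simp add: bump_def)
qed

lemma bump_LIMSEQ: "u \<in> {a<..<b} \<Longrightarrow> (\<lambda>k. bump k a b u) \<longlonglongrightarrow> 1"
proof -
  assume u: "u \<in> {a<..<b}"
  define s where "s = (max 0 ((u - a) * (b - u)))\<^sup>2"
  have s: "s > 0" using u by (auto simp: s_def max_def mult_less_0_iff zero_less_mult_iff not_le)
  have "filterlim (\<lambda>k. 1 + real k * s) at_top sequentially"
    using s by (intro filterlim_tendsto_add_at_top[OF tendsto_const] filterlim_at_top_mult_tendsto_pos[OF tendsto_const] filterlim_real_sequentially)
  then have "(\<lambda>k. 1 - inverse (1 + real k * s)) \<longlonglongrightarrow> 1 - 0"
    by (intro tendsto_intros tendsto_inverse_0_at_top)
  then show ?thesis by (simp add: bump_def s_def)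
qed

text \<open>Products of one-dimensional bumps. The limit is the indicator of the open box while the
  supports stay in the closed one, so indicators of boxes with closure in \<open>U\<close> are
  bounded pointwise limits of admissible test functions.\<close>

lemma box_approximation:
  fixes a b :: "real^'n::finite"
  assumes "cbox a b \<subseteq> U" "box a b \<noteq> {}"
  obtains \<phi> :: "nat \<Rightarrow> real^'n \<Rightarrow> real" and D\<phi> where
    "\<And>k. C1_compact U (\<phi> k) (D\<phi> k)" "\<And>k x. \<bar>\<phi> k x\<bar> \<le> 1"
    "\<And>x. (\<lambda>k. \<phi> k x) \<longlonglongrightarrow> indicator (box a b) x"
proof -
  define \<phi> where "\<phi> = (\<lambda>k x. \<Prod>i\<in>UNIV. bump k (a $ i) (b $ i) (x $ i))"
  have ab: "a $ i < b $ i" for i using assms(2) by (metis interval_ne_empty_cart(2))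
  have "\<exists>D. C1 (\<lambda>x :: real^'n. bump k (a $ i) (b $ i) (x $ i)) D" for k i
    using C1_coordinate[OF bump_has_derivative continuous_bump'] by blast
  then have "\<exists>D. C1 (\<phi> k) D" for k unfolding \<phi>_def by (intro C1_prod) auto
  then obtain D where D: "\<And>k. C1 (\<phi> k) (D k)" by metis
  have zero: "\<phi> k x = 0" if "x \<notin> box a b" for k x
  proof -
    from that obtain i where "x $ i \<notin> {a $ i<..<b $ i}" by (auto simp: mem_box_cart)
    then have "bump k (a $ i) (b $ i) (x $ i) = 0" using ab[of i] by (intro bump_eq_0) auto
    then show ?thesis unfolding \<phi>_def by (subst prod_zero_iff) auto
  qed
  have sub: "closure {x. \<phi> k x \<noteq> 0} \<subseteq> cbox a b" for k
    using zero box_subset_cbox by (intro closure_minimal) (auto, blast)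
  show ?thesis
  proof
    show "C1_compact U (\<phi> k) (D k)" for k
      unfolding C1_compact_def using D sub assms(1)
      by (meson bounded_cbox bounded_subset closed_closure compact_eq_bounded_closed dual_order.trans)
    show "\<bar>\<phi> k x\<bar> \<le> 1" for k x
      unfolding \<phi>_def abs_prod using bump_bounds by (intro prod_le_1) (simp add: abs_of_nonneg)
    show "(\<lambda>k. \<phi> k x) \<longlonglongrightarrow> indicator (box a b) x" for x
    proof (cases "x \<in> box a b")
      case True
      then have "(\<lambda>k. \<phi> k x) \<longlonglongrightarrow> (\<Prod>i\<in>(UNIV::'n set). 1)" unfolding \<phi>_def
        by (intro tendsto_prod bump_LIMSEQ) (auto simp: mem_box_cart)
      then show ?thesis using True by simp
    qed (simp add: zero)
  qed
qed

text \<open>Boxes are an intersection stable generator of the Borel sets, so \<open>f\<close>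
  integrates to zero over every Borel set. The measure is arbitrary because the lemma serves both
  Lebesgue measure and \<open>flat_area\<close>, which is not sigma-finite; the integrability of
  \<open>f\<close> supplies the finiteness that such a uniqueness argument requires.\<close>

lemma AE_zero_if_integral_boxes_zero:
  fixes f :: "real^'n::finite \<Rightarrow> real"
  assumes sets: "sets M = sets borel" and f: "integrable M f"
    and zero: "\<And>a b. (LINT x:box a b|M. f x) = 0"
  shows "AE x in M. f x = 0"
proof -
  have space: "space M = UNIV" using sets_eq_imp_space_eq[OF sets] by simp
  have fS: "set_integrable M A f" if "A \<in> sets M" for A
    using that f by (rule integrable_mult_indicator[folded set_integrable_def])
  have stable: "Int_stable (range (\<lambda>(a, b). box a b :: (real^'n) set))"
    unfolding Int_stable_def by (auto simp: box_Int_box)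
  have sM: "A \<in> sets M" if "A \<in> sigma_sets UNIV (range (\<lambda>(a, b). box a b :: (real^'n) set))" for A
    using that sets by (simp add: borel_eq_box)
  \<comment> \<open>Needed for complements: the whole space is not a box, but an increasing union of
    boxes.\<close>
  have UNIV0: "(LINT x:UNIV|M. f x) = 0"
  proof -
    have "(LINT x:(\<Union>k. box (\<chi> i. - real k) (\<chi> i. real k))|M. f x) = 0"
    proof (rule LIMSEQ_unique[OF set_integral_cont_up])
      let ?A = "\<lambda>k. box (\<chi> i. - real k) (\<chi> i. real k) :: (real^'n) set"
      show "?A k \<in> sets M" for k by (simp add: sets)
      show "incseq ?A"
        by (intro incseq_SucI subset_box_imp) (auto simp: Basis_vec_def inner_axis)
      show "set_integrable M (\<Union>k. ?A k) f" by (intro fS) (auto simp: sets)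
      show "(\<lambda>k. LINT x:?A k|M. f x) \<longlonglongrightarrow> 0" by (simp add: zero)
    qed
    moreover have "(\<Union>k. box (\<chi> i. - real k) (\<chi> i. real k)) = (UNIV :: (real^'n) set)"
    proof (intro equalityI subsetI UNIV_I)
      fix x :: "real^'n"
      obtain k where "norm x < real k" using reals_Archimedean2 by blast
      then have "\<bar>x $ i\<bar> < real k" for i using component_le_norm_cart[of x i] by linarith
      then have "x \<in> box (\<chi> i. - real k) (\<chi> i. real k)"
        by (simp add: mem_box_cart abs_less_iff minus_less_iff)
      then show "x \<in> (\<Union>k. box (\<chi> i. - real k) (\<chi> i. real k))" by blast
    qed
    ultimately show ?thesis by simp
  qed
  have "(LINT x:A|M. f x) = 0" if "A \<in> sigma_sets UNIV (range (\<lambda>(a, b). box a b :: (real^'n) set))" for A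
    using stable subset_UNIV[of "range (\<lambda>(a, b). box a b :: (real^'n) set)", folded Pow_UNIV] that
  proof (induction rule: sigma_sets_induct_disjoint)
    case (basic A)
    then show ?case using zero by auto
  next
    case empty
    show ?case by (simp add: set_lebesgue_integral_def)
  next
    case (compl A)
    have "(LINT x:A \<union> (UNIV - A)|M. f x) = (LINT x:A|M. f x) + (LINT x:UNIV - A|M. f x)"
      using sM[OF compl(1)] sets by (intro set_integral_Un fS) auto
    then show ?case using UNIV0 compl by simp
  next
    case (union A)
    have AM: "A i \<in> sets M" for i using union(2) by (intro sM) auto
    then have "(LINT x:(\<Union>i. A i)|M. f x) = (\<Sum>i. LINT x:A i|M. f x)"
      using union(1)
      by (intro lebesgue_integral_countable_add fS sets.countable_UN) (auto simp: disjoint_family_on_def)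
    then show ?case using union by simp
  qed
  then have zeroA: "set_lebesgue_integral M A f = 0" if "A \<in> sets M" for A
    using that sets by (simp add: borel_eq_box)
  have [measurable]: "f \<in> borel_measurable M" using f by simp
  \<comment> \<open>Integrating over the set where \<open>h > 0\<close> forces it to be null; this
    is applied to \<open>f\<close> and to \<open>- f\<close>.\<close>
  have pos: "AE x in M. \<not> h x > 0"
    if h: "integrable M h" "\<And>A. A \<in> sets M \<Longrightarrow> set_lebesgue_integral M A h = 0" for h :: "real^'n \<Rightarrow> real"
  proof -
    have [measurable]: "h \<in> borel_measurable M" using h by simp
    define A where "A = {x \<in> space M. h x > 0}"
    have A [measurable]: "A \<in> sets M" unfolding A_def by measurable
    have "integrable M (\<lambda>x. indicator A x *\<^sub>R h x)" using h(1) A by (intro integrable_mult_indicator)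
    moreover have "AE x in M. 0 \<le> indicator A x *\<^sub>R h x" by (auto simp: A_def indicator_def)
    ultimately have "AE x in M. indicator A x *\<^sub>R h x = 0"
      using h(2)[OF A] by (subst integral_nonneg_eq_0_iff_AE[symmetric]) (auto simp: set_lebesgue_integral_def)
    then show ?thesis by (elim AE_mp) (auto intro!: AE_I2 simp: A_def indicator_def)
  qed
  have "AE x in M. \<not> f x > 0" by (intro pos f zeroA)
  moreover have "AE x in M. \<not> - f x > 0"
    using f zeroA by (intro pos) (auto simp: set_lebesgue_integral_def)
  ultimately show ?thesis by eventually_elim auto
qed

text \<open>The fundamental lemma of the calculus of variations for a general Borel measure.
  Dominated convergence passes from test functions to boxes inside \<open>U\<close>, and countably
  many such boxes cover \<open>U\<close>.\<close>

lemma AE_zero_if_C1_tests_zero: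
  fixes f :: "real^'n::finite \<Rightarrow> real"
  assumes sets: "sets M = sets borel" and f: "integrable M f" and U: "open U"
    and zero: "\<And>\<phi> D\<phi>. C1_compact U \<phi> D\<phi> \<Longrightarrow> (LINT x|M. f x * \<phi> x) = 0"
  shows "AE x in M. x \<in> U \<longrightarrow> f x = 0"
proof -
  note [measurable_cong] = sets
  have [measurable]: "f \<in> borel_measurable M" using f by simp
  have *: "(LINT x:box a b|M. f x) = 0" if ab: "cbox a b \<subseteq> U" for a b
  proof (cases "box a b = {}")
    case False
    from box_approximation[OF ab this] obtain \<phi> and D\<phi> where \<phi>:
      "\<And>k. C1_compact U (\<phi> k) (D\<phi> k)" "\<And>k x. \<bar>\<phi> k x\<bar> \<le> 1"
      "\<And>x. (\<lambda>k. \<phi> k x) \<longlonglongrightarrow> indicator (box a b) x" by metis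
    have [measurable]: "\<phi> k \<in> borel_measurable borel" for k
      using \<phi>(1) C1_measurable(1) by (auto simp: C1_compact_def)
    have "(\<lambda>k. LINT x|M. f x * \<phi> k x) \<longlonglongrightarrow> (LINT x|M. f x * indicator (box a b) x)"
    proof (rule integral_dominated_convergence[where w="\<lambda>x. \<bar>f x\<bar>"])
      show "AE x in M. (\<lambda>k. f x * \<phi> k x) \<longlonglongrightarrow> f x * indicator (box a b) x"
        using \<phi>(3) by (auto intro!: tendsto_intros)
      show "AE x in M. norm (f x * \<phi> k x) \<le> \<bar>f x\<bar>" for k
        using \<phi>(2)[of k] by (auto simp: abs_mult intro!: mult_left_le)
    qed (use f in auto)
    then have "(LINT x|M. f x * indicator (box a b) x) = 0"
      using zero[OF \<phi>(1)] by (simp add: LIMSEQ_const_iff)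
    then show ?thesis by (simp add: set_lebesgue_integral_def mult.commute)
  qed (simp add: set_lebesgue_integral_def)
  \<comment> \<open>Cut \<open>f\<close> off by the box and test with all boxes: an intersection of
    boxes is a box, whose closed version still lies in \<open>U\<close>.\<close>
  have box0: "AE x in M. x \<in> box a b \<longrightarrow> f x = 0" if ab: "cbox a b \<subseteq> U" for a b
  proof -
    have "AE x in M. indicator (box a b) x * f x = 0"
    proof (rule AE_zero_if_integral_boxes_zero[OF sets])
      show "integrable M (\<lambda>x. indicator (box a b) x * f x)"
        using integrable_mult_indicator[OF _ f, of "box a b"] sets by simp
      fix c d
      obtain a' b' where ab': "box a b \<inter> box c d = box a' b'" "cbox a b \<inter> cbox c d = cbox a' b'"
        using box_Int_box[of a b c d] Int_interval[of a b c d] by blast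
      have "(LINT x:box c d|M. indicator (box a b) x * f x) = (LINT x:box a' b'|M. f x)"
        unfolding ab'(1)[symmetric] set_lebesgue_integral_def
        by (auto intro!: Bochner_Integration.integral_cong simp: indicator_def)
      also have "\<dots> = 0" using * ab ab'(2) by blast
      finally show "(LINT x:box c d|M. indicator (box a b) x * f x) = 0" .
    qed
    then show ?thesis by eventually_elim auto
  qed
  define \<B> where "\<B> = {(a :: real^'n, b :: real^'n). (\<forall>i. a $ i \<in> \<rat>) \<and> (\<forall>i. b $ i \<in> \<rat>) \<and> cbox a b \<subseteq> U}"
  have cover: "\<exists>p\<in>\<B>. x \<in> box (fst p) (snd p)" if "x \<in> U" for x
  proof -
    \<comment> \<open>A closed ball, since the closure of the rational box found in the open ball
      may touch the sphere.\<close>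
    obtain e where e: "e > 0" "cball x e \<subseteq> U"
      using U \<open>x \<in> U\<close> by (auto simp: open_contains_cball)
    obtain a b where ab: "\<forall>i\<in>Basis. a \<bullet> i \<in> \<rat> \<and> b \<bullet> i \<in> \<rat>" "x \<in> box a b" "box a b \<subseteq> ball x e"
      using rational_boxes[OF e(1)] by blast
    have "cbox a b = closure (box a b)" using closure_box[of a b] ab(2) by blast
    also have "\<dots> \<subseteq> cball x e" using ab(3) by (intro closure_minimal) auto
    finally have "cbox a b \<subseteq> U" using e(2) by blast
    moreover have "a $ i \<in> \<rat>" "b $ i \<in> \<rat>" for i
      using ab(1)[rule_format, of "axis i 1"] by (auto simp: inner_axis axis_in_Basis_iff)
    ultimately show ?thesis using ab(2) by (auto simp: \<B>_def)
  qed
  have "countable \<B>"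
  proof -
    have "countable {a :: real^'n. \<forall>i. a $ i \<in> \<rat>}"
      using countable_vector[of "\<lambda>_. \<rat>"] countable_rat by simp
    then have "countable ({a :: real^'n. \<forall>i. a $ i \<in> \<rat>} \<times> {a :: real^'n. \<forall>i. a $ i \<in> \<rat>})"
      by (intro countable_SIGMA)
    then show ?thesis by (rule countable_subset[rotated]) (auto simp: \<B>_def)
  qed
  then have "AE x in M. \<forall>p\<in>\<B>. x \<in> box (fst p) (snd p) \<longrightarrow> f x = 0"
    using box0 by (intro AE_ball_countable[THEN iffD2]) (auto simp: \<B>_def)
  then show ?thesis
  proof eventually_elim
    case (elim x)
    show ?case
    proof
      assume "x \<in> U"
      from cover[OF this] obtain p where "p \<in> \<B>" "x \<in> box (fst p) (snd p)" by blast
      then show "f x = 0" using elim by auto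
    qed
  qed
qed

section \<open>Weak divergences and normal traces\<close>

lemma in_L2_add:
  assumes "in_L2 M f" "in_L2 M g"
  shows "in_L2 M (\<lambda>x. f x + g x)"
  unfolding in_L2_def
proof
  have [measurable]: "f \<in> borel_measurable M" "g \<in> borel_measurable M"
    using assms by (auto simp: in_L2_def)
  show "(\<lambda>x. f x + g x) \<in> borel_measurable M" by measurable
  have "integrable M (\<lambda>x. 2 * (norm (f x))\<^sup>2 + 2 * (norm (g x))\<^sup>2)"
    using assms by (auto simp: in_L2_def)
  then show "integrable M (\<lambda>x. (norm (f x + g x))\<^sup>2)"
  proof (rule Bochner_Integration.integrable_bound)
    have "(norm (f x + g x))\<^sup>2 \<le> 2 * (norm (f x))\<^sup>2 + 2 * (norm (g x))\<^sup>2" for x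
    proof -
      have "(norm (f x + g x))\<^sup>2 \<le> (norm (f x) + norm (g x))\<^sup>2"
        by (intro power_mono norm_triangle_ineq) auto
      also have "\<dots> \<le> 2 * (norm (f x))\<^sup>2 + 2 * (norm (g x))\<^sup>2"
        using sum_squares_bound[of "norm (f x)" "norm (g x)"] by (simp add: power2_sum)
      finally show ?thesis .
    qed
    then show "AE x in M. norm ((norm (f x + g x))\<^sup>2) \<le> norm (2 * (norm (f x))\<^sup>2 + 2 * (norm (g x))\<^sup>2)"
      by auto
  qed simp
qed

lemma in_L2_scaleR: "in_L2 M f \<Longrightarrow> in_L2 M (\<lambda>x. c *\<^sub>R f x)"
  by (auto simp: in_L2_def power_mult_distrib)

lemma in_L2_zero: "in_L2 M (\<lambda>x. 0)"
  by (simp add: in_L2_def)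

lemma in_L2_diff: "in_L2 M f \<Longrightarrow> in_L2 M g \<Longrightarrow> in_L2 M (\<lambda>x. f x - g x)"
  using in_L2_add[of M f "\<lambda>x. (-1) *\<^sub>R g x"] in_L2_scaleR[of M g "-1"] by simp

lemma in_L2_mult_real: "in_L2 M f \<Longrightarrow> in_L2 M (\<lambda>x. c * f x)" for f :: "_ \<Rightarrow> real"
  using in_L2_scaleR[of M f c] by simp

lemma in_L2_measurable: "in_L2 M f \<Longrightarrow> f \<in> borel_measurable M"
  by (simp add: in_L2_def)

lemma L2_inner_integrable:
  assumes "in_L2 M f" "in_L2 M g"
  shows "integrable M (\<lambda>x. f x \<bullet> g x)"
proof (rule Bochner_Integration.integrable_bound)
  have [measurable]: "f \<in> borel_measurable M" "g \<in> borel_measurable M"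
    using assms by (auto simp: in_L2_def)
  show "integrable M (\<lambda>x. (norm (f x))\<^sup>2 + (norm (g x))\<^sup>2)"
    using assms by (auto simp: in_L2_def)
  have "\<bar>f x \<bullet> g x\<bar> \<le> (norm (f x))\<^sup>2 + (norm (g x))\<^sup>2" for x
  proof -
    have "\<bar>f x \<bullet> g x\<bar> \<le> norm (f x) * norm (g x)" by (rule Cauchy_Schwarz_ineq2)
    moreover have "2 * (norm (f x) * norm (g x)) \<le> (norm (f x))\<^sup>2 + (norm (g x))\<^sup>2"
      using sum_squares_bound[of "norm (f x)" "norm (g x)"] by simp
    moreover have "0 \<le> norm (f x) * norm (g x)" by simp
    ultimately show ?thesis by linarith
  qed
  then show "AE x in M. norm (f x \<bullet> g x) \<le> norm ((norm (f x))\<^sup>2 + (norm (g x))\<^sup>2)" by auto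
qed (use assms in \<open>auto simp: in_L2_def\<close>)

lemma L2_mult_integrable:
  fixes f g :: "_ \<Rightarrow> real"
  shows "in_L2 M f \<Longrightarrow> in_L2 M g \<Longrightarrow> integrable M (\<lambda>x. f x * g x)"
  using L2_inner_integrable[of M f g] by simp

lemma L2_inner_diff_left:
  "in_L2 M f \<Longrightarrow> in_L2 M g \<Longrightarrow> in_L2 M h \<Longrightarrow>
    L2_inner M (\<lambda>x. f x - g x) h = L2_inner M f h - L2_inner M g h"
  by (simp add: L2_inner_def inner_diff_left L2_inner_integrable)

lemma L2_inner_scaleR_left: "L2_inner M (\<lambda>x. c *\<^sub>R f x) h = c * L2_inner M f h"
  by (simp add: L2_inner_def)

lemma L2_inner_commute: "L2_inner M f g = L2_inner M g f"
  by (simp add: L2_inner_def inner_commute)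

lemma L2_inner_sum_left:
  "(\<And>i. i \<in> I \<Longrightarrow> in_L2 M (f i)) \<Longrightarrow> in_L2 M h \<Longrightarrow>
    L2_inner M (\<lambda>x. \<Sum>i\<in>I. f i x) h = (\<Sum>i\<in>I. L2_inner M (f i) h)"
  by (simp add: L2_inner_def inner_sum_left L2_inner_integrable)

lemma L2_inner_cong_AE:
  "AE x in M. f x = g x \<Longrightarrow> f \<in> borel_measurable M \<Longrightarrow> g \<in> borel_measurable M \<Longrightarrow>
    h \<in> borel_measurable M \<Longrightarrow> L2_inner M f h = L2_inner M g h"
  unfolding L2_inner_def by (rule integral_cong_AE) (auto elim: AE_mp)

lemma L2_norm_nonneg: "0 \<le> L2_norm M f"
  by (simp add: L2_norm_def)

lemma L2_norm_power2: "(L2_norm M f)\<^sup>2 = (LINT x|M. (norm (f x))\<^sup>2)"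
  by (simp add: L2_norm_def)

lemma L2_norm_power2_eq_inner: "(L2_norm M f)\<^sup>2 = L2_inner M f f"
  by (simp add: L2_norm_power2 L2_inner_def power2_norm_eq_inner)

lemma L2_norm_cong_AE:
  "AE x in M. f x = g x \<Longrightarrow> f \<in> borel_measurable M \<Longrightarrow> g \<in> borel_measurable M \<Longrightarrow>
    L2_norm M f = L2_norm M g"
  unfolding L2_norm_def by (intro arg_cong[where f=sqrt] integral_cong_AE) (auto elim: AE_mp)

lemma L2_norm_eq_0_iff:
  assumes "in_L2 M f"
  shows "L2_norm M f = 0 \<longleftrightarrow> (AE x in M. f x = 0)"
  using assms by (simp add: L2_norm_def in_L2_def integral_nonneg_eq_0_iff_AE)

lemma in_L2_integrable:
  assumes "finite_measure M" "in_L2 M f"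
  shows "integrable M f"
proof (rule Bochner_Integration.integrable_bound)
  show "integrable M (\<lambda>x. 1 + (norm (f x))\<^sup>2)"
    using assms finite_measure.integrable_const[of M "1 :: real"] by (auto simp: in_L2_def)
  have "norm (f x) \<le> 1 + (norm (f x))\<^sup>2" for x
    using sum_squares_bound[of 1 "norm (f x)"] by simp (smt (verit) norm_ge_zero)
  then show "AE x in M. norm (f x) \<le> norm (1 + (norm (f x))\<^sup>2)" by auto
qed (use assms in \<open>auto simp: in_L2_def\<close>)

lemma finite_measure_vol: "bounded G \<Longrightarrow> G \<in> sets borel \<Longrightarrow> finite_measure (vol G)"
  using emeasure_bounded_finite[of G]
  by (intro finite_measureI) (auto simp: emeasure_restrict_space space_restrict_space)

lemma in_L2_continuous:
  assumes "bounded G" "open G" "continuous_on UNIV f"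
  shows "in_L2 (vol G) f"
proof -
  interpret finite_measure "vol G" using assms by (intro finite_measure_vol) auto
  have [measurable]: "f \<in> borel_measurable borel"
    using assms(3) by (rule borel_measurable_continuous_onI)
  have "compact (closure G)" using assms(1) by simp
  then have "bounded (f ` closure G)"
    by (intro compact_imp_bounded compact_continuous_image continuous_on_subset[OF assms(3)]) auto
  then obtain B where B: "\<And>x. x \<in> closure G \<Longrightarrow> norm (f x) \<le> B" by (auto simp: bounded_iff)
  have "integrable (vol G) (\<lambda>x. (norm (f x))\<^sup>2)"
  proof (rule integrable_const_bound[where B="B\<^sup>2"])
    show "AE x in vol G. norm ((norm (f x))\<^sup>2) \<le> B\<^sup>2"
      using B closure_subset by (intro AE_I2) (auto simp: space_restrict_space intro!: power_mono)
    show "(\<lambda>x. (norm (f x))\<^sup>2) \<in> borel_measurable (vol G)"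
      by (intro measurable_restrict_space1) measurable
  qed
  then show ?thesis by (auto simp: in_L2_def intro!: measurable_restrict_space1)
qed

text \<open>The difference of two weak divergences is annihilated by every test function supported
  in \<open>G\<close>. This is what makes the choice in \<open>dvg\<close> harmless.\<close>

lemma weak_div_unique:
  assumes G: "open G" "bounded G" and f: "weak_div G q f" "weak_div G q f'"
  shows "AE x in vol G. f x = f' x"
proof -
  have L2: "in_L2 (vol G) f" "in_L2 (vol G) f'" using f by (auto simp: weak_div_def)
  have fin: "finite_measure (vol G)" using G by (intro finite_measure_vol) auto
  have int: "integrable lborel (\<lambda>x. indicator G x *\<^sub>R (f x - f' x))"
    using in_L2_integrable[OF fin in_L2_diff[OF L2]] G by (subst (asm) integrable_restrict_space) auto
  have "AE x in lborel. x \<in> G \<longrightarrow> indicator G x *\<^sub>R (f x - f' x) = 0"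
  proof (rule AE_zero_if_C1_tests_zero[OF _ int G(1)])
    fix \<phi> D\<phi> assume \<phi>: "C1_compact G \<phi> D\<phi>"
    then have \<phi>2: "in_L2 (vol G) \<phi>"
      using G C1_continuous by (intro in_L2_continuous) (auto simp: C1_compact_def)
    have "(LINT x|vol G. f x * \<phi> x) = (LINT x|vol G. f' x * \<phi> x)"
      using f \<phi> unfolding weak_div_def by fastforce
    then have "(LINT x|vol G. (f x - f' x) * \<phi> x) = 0"
      using L2_mult_integrable[OF L2(1) \<phi>2] L2_mult_integrable[OF L2(2) \<phi>2]
      by (simp add: left_diff_distrib)
    then show "(LINT x|lborel. indicator G x *\<^sub>R (f x - f' x) * \<phi> x) = 0"
      using G by (subst (asm) integral_restrict_space) (auto simp: mult.assoc)
  qed simp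
  then show ?thesis
    using G by (subst AE_restrict_space_iff) (auto elim!: AE_mp)
qed

lemma weak_div_dvg: "q \<in> Hdiv G \<Longrightarrow> weak_div G q (dvg G q)"
  unfolding Hdiv_def dvg_def using someI_ex[of "weak_div G q"] by simp

lemma dvg_AE_eq:
  "open G \<Longrightarrow> bounded G \<Longrightarrow> weak_div G q f \<Longrightarrow> AE x in vol G. dvg G q x = f x"
  by (rule weak_div_unique[OF _ _ weak_div_dvg]) (auto simp: Hdiv_def)

lemma weak_div_lincomb:
  assumes G: "open G" "bounded G" and f: "weak_div G p f" "weak_div G q g"
  shows "weak_div G (\<lambda>x. a *\<^sub>R p x + b *\<^sub>R q x) (\<lambda>x. a * f x + b * g x)"
  unfolding weak_div_def
proof (intro conjI allI impI)
  have L2: "in_L2 (vol G) p" "in_L2 (vol G) q" "in_L2 (vol G) f" "in_L2 (vol G) g"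
    using f by (auto simp: weak_div_def)
  then show "in_L2 (vol G) (\<lambda>x. a *\<^sub>R p x + b *\<^sub>R q x)" "in_L2 (vol G) (\<lambda>x. a * f x + b * g x)"
    by (auto intro!: in_L2_add in_L2_scaleR in_L2_mult_real)
  fix \<phi> D\<phi> assume \<phi>: "C1_compact G \<phi> D\<phi>"
  then have \<phi>2: "in_L2 (vol G) \<phi>" "in_L2 (vol G) D\<phi>"
    using G C1_continuous by (auto intro!: in_L2_continuous simp: C1_compact_def)
  have "(LINT x|vol G. (a *\<^sub>R p x + b *\<^sub>R q x) \<bullet> D\<phi> x) =
      a * (LINT x|vol G. p x \<bullet> D\<phi> x) + b * (LINT x|vol G. q x \<bullet> D\<phi> x)"
    using L2_inner_integrable[OF L2(1) \<phi>2(2)] L2_inner_integrable[OF L2(2) \<phi>2(2)]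
    by (simp add: inner_add_left)
  also have "\<dots> = - (LINT x|vol G. (a * f x + b * g x) * \<phi> x)"
    using f \<phi> L2_mult_integrable[OF L2(3) \<phi>2(1)] L2_mult_integrable[OF L2(4) \<phi>2(1)]
    by (simp add: weak_div_def distrib_right mult.assoc)
  finally show "(LINT x|vol G. (a *\<^sub>R p x + b *\<^sub>R q x) \<bullet> D\<phi> x) =
    - (LINT x|vol G. (a * f x + b * g x) * \<phi> x)" .
qed

text \<open>Replaces the chosen divergence in \<open>green\<close> by any weak divergence at hand,
  so that explicit fields can be tested with their explicit divergence.\<close>

lemma green_eq:
  assumes G: "open G" "bounded G" and f: "weak_div G q f" and \<phi>: "C1 \<phi> D\<phi>"
  shows "green G q \<phi> D\<phi> = (LINT x|vol G. q x \<bullet> D\<phi> x) + (LINT x|vol G. f x * \<phi> x)"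
proof -
  have L2: "in_L2 (vol G) q" "in_L2 (vol G) f" "in_L2 (vol G) (dvg G q)"
    using f weak_div_dvg[of q G] by (auto simp: weak_div_def Hdiv_def)
  have \<phi>2: "in_L2 (vol G) \<phi>" "in_L2 (vol G) D\<phi>"
    using G C1_continuous[OF \<phi>] by (auto intro!: in_L2_continuous)
  have "(LINT x|vol G. dvg G q x * \<phi> x) = (LINT x|vol G. f x * \<phi> x)"
    using dvg_AE_eq[OF G f] L2_mult_integrable[OF L2(2) \<phi>2(1)] L2_mult_integrable[OF L2(3) \<phi>2(1)]
    by (intro integral_cong_AE) auto
  then show ?thesis
    using L2_inner_integrable[OF L2(1) \<phi>2(2)] L2_mult_integrable[OF L2(3) \<phi>2(1)]
    by (simp add: green_def)
qed

lemma green_lincomb: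
  assumes G: "open G" "bounded G" and "p \<in> Hdiv G" "q \<in> Hdiv G" and \<phi>: "C1 \<phi> D\<phi>"
  shows "green G (\<lambda>x. a *\<^sub>R p x + b *\<^sub>R q x) \<phi> D\<phi> = a * green G p \<phi> D\<phi> + b * green G q \<phi> D\<phi>"
proof -
  obtain f g where f: "weak_div G p f" "weak_div G q g" using assms by (auto simp: Hdiv_def)
  have L2: "in_L2 (vol G) p" "in_L2 (vol G) q" "in_L2 (vol G) f" "in_L2 (vol G) g"
    using f by (auto simp: weak_div_def)
  have \<phi>2: "in_L2 (vol G) \<phi>" "in_L2 (vol G) D\<phi>"
    using G C1_continuous[OF \<phi>] by (auto intro!: in_L2_continuous)
  show ?thesis
    using L2_inner_integrable[OF L2(1) \<phi>2(2)] L2_inner_integrable[OF L2(2) \<phi>2(2)]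
      L2_mult_integrable[OF L2(3) \<phi>2(1)] L2_mult_integrable[OF L2(4) \<phi>2(1)]
    by (simp add: green_eq[OF G weak_div_lincomb[OF G f] \<phi>] green_eq[OF G f(1) \<phi>] green_eq[OF G f(2) \<phi>]
      inner_add_left distrib_right mult.assoc distrib_left)
qed

text \<open>\<open>dvg G p\<close> and \<open>dvg G q\<close> are separate choices. A weak
  divergence of \<open>q\<close> is also one of \<open>p\<close>, so both functionals can be
  computed with the same representative.\<close>

lemma green_cong_AE:
  assumes G: "open G" "bounded G" and "p \<in> Hdiv G" "q \<in> Hdiv G" and \<phi>: "C1 \<phi> D\<phi>"
    and eq: "AE x in vol G. p x = q x"
  shows "green G p \<phi> D\<phi> = green G q \<phi> D\<phi>"
proof -
  obtain f g where f: "weak_div G p f" "weak_div G q g" using assms by (auto simp: Hdiv_def)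
  have L2: "in_L2 (vol G) p" "in_L2 (vol G) q" "in_L2 (vol G) f" "in_L2 (vol G) g"
    using f by (auto simp: weak_div_def)
  have eq': "(LINT x|vol G. p x \<bullet> D\<psi> x) = (LINT x|vol G. q x \<bullet> D\<psi> x)" if "C1 \<psi> D\<psi>" for \<psi> D\<psi>
    using eq L2 in_L2_continuous[OF G(2,1) C1_continuous(2)[OF that]]
    by (intro integral_cong_AE borel_measurable_inner) (auto dest: in_L2_measurable)
  have "weak_div G p g"
    unfolding weak_div_def
  proof (intro conjI L2 allI impI)
    fix \<psi> D\<psi> assume \<psi>: "C1_compact G \<psi> D\<psi>"
    then have "C1 \<psi> D\<psi>" by (simp add: C1_compact_def)
    then have "(LINT x|vol G. p x \<bullet> D\<psi> x) = (LINT x|vol G. q x \<bullet> D\<psi> x)" by (rule eq')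
    also have "\<dots> = - (LINT x|vol G. g x * \<psi> x)" using f(2) \<psi> by (auto simp: weak_div_def)
    finally show "(LINT x|vol G. p x \<bullet> D\<psi> x) = - (LINT x|vol G. g x * \<psi> x)" .
  qed
  from green_eq[OF G this \<phi>] green_eq[OF G f(2) \<phi>] eq'[OF \<phi>] show ?thesis by simp
qed

lemma finite_measure_surf:
  "S \<in> sets borel \<Longrightarrow> emeasure flat_area S < \<infinity> \<Longrightarrow> finite_measure (surf S)"
  by (intro finite_measureI) (auto simp: emeasure_restrict_space space_restrict_space)

lemma in_L2_continuous_surf:
  assumes S: "compact S" "emeasure flat_area S < \<infinity>" and f: "continuous_on UNIV f"
  shows "in_L2 (surf S) f"
proof -
  have Sb: "S \<in> sets borel" by (intro borel_closed compact_imp_closed S)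
  interpret finite_measure "surf S" using Sb S by (intro finite_measure_surf)
  have [measurable]: "f \<in> borel_measurable flat_area"
    using borel_measurable_continuous_onI[OF f] by (simp add: measurable_def)
  obtain B where B: "\<And>x. x \<in> S \<Longrightarrow> norm (f x) \<le> B"
    using compact_imp_bounded[OF compact_continuous_image[OF continuous_on_subset[OF f] S(1)]]
    by (auto simp: bounded_iff)
  have "integrable (surf S) (\<lambda>x. (norm (f x))\<^sup>2)"
  proof (rule integrable_const_bound[where B="B\<^sup>2"])
    show "AE x in surf S. norm ((norm (f x))\<^sup>2) \<le> B\<^sup>2"
      using B by (intro AE_I2) (auto simp: space_restrict_space intro!: power_mono)
    show "(\<lambda>x. (norm (f x))\<^sup>2) \<in> borel_measurable (surf S)"
      by (intro measurable_restrict_space1) measurable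
  qed
  then show ?thesis by (auto simp: in_L2_def intro!: measurable_restrict_space1)
qed

lemma Hdiv_lincomb:
  "open G \<Longrightarrow> bounded G \<Longrightarrow> p \<in> Hdiv G \<Longrightarrow> q \<in> Hdiv G \<Longrightarrow> (\<lambda>x. a *\<^sub>R p x + b *\<^sub>R q x) \<in> Hdiv G"
  unfolding Hdiv_def using weak_div_lincomb by blast

lemma has_normal_trace_lincomb:
  fixes G :: "(real^'n::finite) set"
  assumes G: "open G" "bounded G" and fin: "emeasure flat_area (frontier G) < \<infinity>"
    and "has_normal_trace G p s" "has_normal_trace G q t"
  shows "has_normal_trace G (\<lambda>x. a *\<^sub>R p x + b *\<^sub>R q x) (\<lambda>x. a * s x + b * t x)"
  unfolding has_normal_trace_def
proof (intro conjI allI impI)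
  have pq: "p \<in> Hdiv G" "q \<in> Hdiv G" and st: "in_L2 (surf (frontier G)) s" "in_L2 (surf (frontier G)) t"
    using assms by (auto simp: has_normal_trace_def)
  then show "(\<lambda>x. a *\<^sub>R p x + b *\<^sub>R q x) \<in> Hdiv G" using Hdiv_lincomb G by blast
  show "in_L2 (surf (frontier G)) (\<lambda>x. a * s x + b * t x)"
    using st by (intro in_L2_add in_L2_mult_real)
  fix \<phi> :: "real^'n \<Rightarrow> real" and D\<phi> assume \<phi>: "C1 \<phi> D\<phi>"
  have \<phi>2: "in_L2 (surf (frontier G)) \<phi>"
    using G fin C1_continuous[OF \<phi>] by (intro in_L2_continuous_surf compact_frontier_bounded)
  show "green G (\<lambda>x. a *\<^sub>R p x + b *\<^sub>R q x) \<phi> D\<phi> =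
    L2_inner (surf (frontier G)) (\<lambda>x. a * s x + b * t x) \<phi>"
    using assms(4,5) \<phi> L2_mult_integrable[OF st(1) \<phi>2] L2_mult_integrable[OF st(2) \<phi>2]
    by (simp add: green_lincomb[OF G pq \<phi>] has_normal_trace_def L2_inner_def distrib_right mult.assoc)
qed

text \<open>Tests need not vanish on the boundary, so the difference of the densities, extended by
  zero to the whole space, is annihilated by every compactly supported C^1 function; finite area
  makes it integrable. Agreement of the fields almost everywhere is assumed instead of equality so
  that linear relations between discrete fields pass to their traces.\<close>

lemma normal_trace_unique:
  fixes G :: "(real^'n::finite) set"
  assumes G: "open G" "bounded G" and fin: "emeasure flat_area (frontier G) < \<infinity>"
    and tr: "has_normal_trace G p s" "has_normal_trace G q t" and eq: "AE x in vol G. p x = q x"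
  shows "AE x in surf (frontier G). s x = t x"
proof -
  let ?S = "frontier G"
  have pq: "p \<in> Hdiv G" "q \<in> Hdiv G" and st: "in_L2 (surf ?S) s" "in_L2 (surf ?S) t"
    using assms by (auto simp: has_normal_trace_def)
  have S [measurable]: "?S \<in> sets flat_area" "?S \<in> sets borel" by auto
  have int: "integrable flat_area (\<lambda>x. indicator ?S x *\<^sub>R (s x - t x))"
    using in_L2_integrable[OF finite_measure_surf[OF S(2) fin] in_L2_diff[OF st]]
    by (subst (asm) integrable_restrict_space) auto
  have "AE x in flat_area. x \<in> UNIV \<longrightarrow> indicator ?S x *\<^sub>R (s x - t x) = 0"
  proof (rule AE_zero_if_C1_tests_zero[OF _ int])
    fix \<phi> :: "real^'n \<Rightarrow> real" and D\<phi> assume "C1_compact UNIV \<phi> D\<phi>"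
    then have \<phi>: "C1 \<phi> D\<phi>" by (simp add: C1_compact_def)
    have \<phi>2: "in_L2 (surf ?S) \<phi>"
      using G fin C1_continuous[OF \<phi>] by (intro in_L2_continuous_surf compact_frontier_bounded)
    have "L2_inner (surf ?S) s \<phi> = L2_inner (surf ?S) t \<phi>"
      using tr \<phi> green_cong_AE[OF G pq \<phi> eq] by (auto simp: has_normal_trace_def)
    then have "(LINT x|surf ?S. (s x - t x) * \<phi> x) = 0"
      using L2_mult_integrable[OF st(1) \<phi>2] L2_mult_integrable[OF st(2) \<phi>2]
      by (simp add: left_diff_distrib L2_inner_def)
    then show "(LINT x|flat_area. indicator ?S x *\<^sub>R (s x - t x) * \<phi> x) = 0"
      by (subst (asm) integral_restrict_space) (auto simp: mult.assoc)
  qed auto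
  then show ?thesis
    by (subst AE_restrict_space_iff) (auto elim!: AE_mp)
qed

section \<open>Riesz potentials\<close>

text \<open>The truncated Riesz kernel. Because \<open>0 powr x = 0\<close>, its value at the origin
  is 0 and not infinite, so the diagonal needs no exception.\<close>

definition riesz :: "real \<Rightarrow> real \<Rightarrow> 'a::real_normed_vector \<Rightarrow> real" where
  "riesz p R u = (if norm u \<le> R then norm u powr (- p) else 0)"

lemma riesz_nonneg [simp]: "0 \<le> riesz p R u"
  by (simp add: riesz_def)

lemma riesz_commute: "riesz p R (x - y) = riesz p R (y - x)"
  by (simp add: riesz_def norm_minus_commute)

lemma borel_measurable_riesz [measurable]: "riesz p R \<in> borel_measurable borel"
  unfolding riesz_def by measurable

text \<open>Upper Ahlfors regularity of dimension \<open>s\<close>, required for all radii and not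
  only for small ones. All bounds of Riesz potentials are derived from it.\<close>

definition upper_regular :: "'a::euclidean_space measure \<Rightarrow> real \<Rightarrow> real \<Rightarrow> bool" where
  "upper_regular M A s \<longleftrightarrow> sets M = sets borel \<and> 0 \<le> A \<and>
     (\<forall>x r. 0 < r \<longrightarrow> emeasure M (cball x r) \<le> ennreal (A * r powr s))"

text \<open>A point at distance between R/2^(k+1) and R/2^k from \<open>x\<close> lies in the k-th
  ball, and there the kernel is at most its value at the smaller radius. Whole balls replace annuli
  because regularity speaks of balls.\<close>

lemma riesz_le_dyadic:
  assumes p: "0 \<le> p" and R: "0 < R"
  shows "ennreal (riesz p R (x - y)) \<le>
    (\<Sum>k. ennreal ((R / 2 ^ Suc k) powr (- p)) * indicator (cball x (R / 2 ^ k)) y)"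
proof (cases "0 < norm (x - y) \<and> norm (x - y) \<le> R")
  case True
  define d where "d = norm (x - y)"
  have d: "0 < d" "d \<le> R" using True by (auto simp: d_def)
  have "(\<lambda>n. R / 2 ^ n) \<longlonglongrightarrow> 0"
    using LIMSEQ_divide_realpow_zero[of 2 R] by simp
  then have ex: "\<exists>n. R / 2 ^ n < d"
    using d(1) by (metis (mono_tags, lifting) eventually_sequentially order_refl order_tendstoD(2))
  \<comment> \<open>The first radius below the distance; its predecessor \<open>k\<close> is the
    index of the annulus. It is not 0 because the distance is at most \<open>R\<close>.\<close>
  define n where "n = (LEAST n. R / 2 ^ n < d)"
  have n: "R / 2 ^ n < d" using LeastI_ex[OF ex] by (simp add: n_def)
  have "n \<noteq> 0" using n d by (intro notI) simp
  then obtain k where k: "n = Suc k" by (cases n) auto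
  have "\<not> R / 2 ^ k < d" using not_less_Least[of k "\<lambda>n. R / 2 ^ n < d"] by (simp add: n_def[symmetric] k)
  then have k2: "y \<in> cball x (R / 2 ^ k)" by (simp add: d_def dist_norm)
  have "riesz p R (x - y) = d powr (- p)" using d by (simp add: riesz_def d_def)
  also have "\<dots> \<le> (R / 2 ^ Suc k) powr (- p)"
    using n R p by (intro powr_mono2') (auto simp: k)
  finally have "ennreal (riesz p R (x - y)) \<le>
      ennreal ((R / 2 ^ Suc k) powr (- p)) * indicator (cball x (R / 2 ^ k)) y"
    using k2 by (simp add: ennreal_leI)
  also have "\<dots> \<le> (\<Sum>k. ennreal ((R / 2 ^ Suc k) powr (- p)) * indicator (cball x (R / 2 ^ k)) y)"
  proof -
    have "F k \<le> suminf F" for F :: "nat \<Rightarrow> ennreal"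
      using sum_le_suminf[OF summableI, of "{k}" F] by simp
    then show ?thesis .
  qed
  finally show ?thesis .
next
  case False
  then have "riesz p R (x - y) = 0" by (auto simp: riesz_def)
  then show ?thesis by simp
qed

text \<open>Below the critical order the dyadic bound is a geometric series of ratio 2^(p - s) < 1,
  uniformly in the centre \<open>x\<close>.\<close>

lemma nn_integral_riesz_bounded:
  assumes M: "upper_regular M A s" and p: "0 \<le> p" "p < s" and R: "0 < R"
  obtains C where "0 \<le> C" "\<And>x. (\<integral>\<^sup>+ y. ennreal (riesz p R (x - y)) \<partial>M) \<le> ennreal C"
proof -
  have [measurable_cong]: "sets M = sets borel" and A: "0 \<le> A"
    and g: "\<And>x r. 0 < r \<Longrightarrow> emeasure M (cball x r) \<le> ennreal (A * r powr s)"
    using M by (auto simp: upper_regular_def)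
  have ballM: "cball x r \<in> sets M" for x r using M by (simp add: upper_regular_def)
  define q where "q = 2 powr (p - s)"
  have q: "0 < q" "q < 1" using p by (auto simp: q_def powr_less_one)
  define K where "K = A * R powr (s - p) * 2 powr p"
  have K: "0 \<le> K" using A by (simp add: K_def)
  have term_eq: "(R / 2 ^ Suc k) powr (- p) * (A * (R / 2 ^ k) powr s) = K * q ^ k" for k
  proof -
    have pow: "2 ^ m = (2::real) powr real m" for m by (simp add: powr_realpow)
    have "(R / 2 ^ Suc k) powr (- p) = R powr (- p) * 2 powr (p * real (Suc k))"
      using R unfolding pow by (simp add: powr_divide powr_powr powr_minus field_simps)
    moreover have "(R / 2 ^ k) powr s = R powr s * 2 powr (- (s * real k))"
      using R unfolding pow by (simp add: powr_divide powr_powr powr_minus field_simps)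
    moreover have "q ^ k = 2 powr (p * real k) * 2 powr (- (s * real k))"
      by (simp add: q_def powr_power powr_add[symmetric] algebra_simps)
    moreover have "R powr (s - p) = R powr (- p) * R powr s"
      by (simp add: powr_add[symmetric])
    moreover have "2 powr (p * real (Suc k)) = 2 powr p * (2::real) powr (p * real k)"
      by (simp add: powr_add[symmetric] algebra_simps)
    ultimately show ?thesis by (simp add: K_def)
  qed
  have "(\<integral>\<^sup>+ y. ennreal (riesz p R (x - y)) \<partial>M) \<le> ennreal (K * (1 / (1 - q)))" for x
  proof -
    define a where "a = (\<lambda>k. ennreal ((R / 2 ^ Suc k) powr (- p)))"
    define F where "F = (\<lambda>k y. a k * indicator (cball x (R / 2 ^ k)) y)"
    have [measurable]: "F k \<in> borel_measurable M" for k unfolding F_def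
      by (intro borel_measurable_times_ennreal borel_measurable_const borel_measurable_indicator ballM)
    have "(\<integral>\<^sup>+ y. ennreal (riesz p R (x - y)) \<partial>M) \<le> (\<integral>\<^sup>+ y. (\<Sum>k. F k y) \<partial>M)"
      unfolding F_def a_def by (intro nn_integral_mono riesz_le_dyadic p R)
    also have "\<dots> = (\<Sum>k. \<integral>\<^sup>+ y. F k y \<partial>M)"
      by (rule nn_integral_suminf) measurable
    also have "\<dots> = (\<Sum>k. a k * emeasure M (cball x (R / 2 ^ k)))"
      unfolding F_def by (intro suminf_cong nn_integral_cmult_indicator ballM)
    also have "\<dots> \<le> (\<Sum>k. a k * ennreal (A * (R / 2 ^ k) powr s))"
      using R by (intro suminf_le mult_left_mono g summableI) auto
    also have "\<dots> = (\<Sum>k. ennreal (K * q ^ k))"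
      using A R unfolding a_def by (simp add: ennreal_mult[symmetric] term_eq del: power_Suc)
    also have "\<dots> = ennreal (K * (1 / (1 - q)))"
      using K q by (intro suminf_ennreal_eq sums_mult geometric_sums) auto
    finally show ?thesis .
  qed
  then show ?thesis using K q by (intro that[of "K * (1 / (1 - q))"]) auto
qed

lemma upper_regular_lborel:
  "upper_regular (lborel :: 'a::euclidean_space measure) (2 ^ DIM('a)) (real DIM('a))"
  unfolding upper_regular_def
proof (intro conjI allI impI)
  fix x :: 'a and r :: real assume r: "0 < r"
  have "cball x r \<subseteq> cbox (x - r *\<^sub>R One) (x + r *\<^sub>R One)"
  proof
    fix y assume y: "y \<in> cball x r"
    have "\<bar>(x - y) \<bullet> b\<bar> \<le> r" if "b \<in> Basis" for b
      using y Basis_le_norm[OF that, of "x - y"] by (simp add: dist_norm)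
    then show "y \<in> cbox (x - r *\<^sub>R One) (x + r *\<^sub>R One)"
      by (auto simp: mem_box inner_simps abs_le_iff) (smt (verit))+
  qed
  then have "emeasure lborel (cball x r) \<le> emeasure lborel (cbox (x - r *\<^sub>R One) (x + r *\<^sub>R One))"
    by (intro emeasure_mono) auto
  also have "\<dots> = ennreal ((2 * r) ^ DIM('a))"
    using r by (simp add: emeasure_lborel_cbox_eq inner_simps)
  also have "\<dots> = ennreal (2 ^ DIM('a) * r powr real DIM('a))"
    using r by (simp add: power_mult_distrib powr_realpow)
  finally show "emeasure lborel (cball x r) \<le> ennreal (2 ^ DIM('a) * r powr real DIM('a))" .
qed auto

text \<open>Schur's test, with the singularity \<open>q\<close> split between the two measures as \<open>2 * q = p1 + p2\<close>.\<close>

lemma riesz_potential_bounded: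
  fixes \<sigma> :: "'a::euclidean_space measure"
  assumes \<sigma>: "upper_regular \<sigma> A s" "finite_measure \<sigma>"
    and q: "2 * q < s + real DIM('a)" "s < real DIM('a)" "real DIM('a) - s \<le> 2 * q" "0 < R"
  obtains C where "0 \<le> C" "\<And>g :: 'a \<Rightarrow> real. g \<in> borel_measurable borel \<Longrightarrow>
    (\<integral>\<^sup>+ x. (\<integral>\<^sup>+ y. ennreal \<bar>g y\<bar> * ennreal (riesz q R (x - y)) \<partial>\<sigma>)\<^sup>2 \<partial>lborel) \<le>
      ennreal C * (\<integral>\<^sup>+ y. ennreal ((g y)\<^sup>2) \<partial>\<sigma>)"
proof -
  interpret \<sigma>: finite_measure \<sigma> by fact
  interpret P: pair_sigma_finite lborel \<sigma> ..
  have sets [measurable_cong]: "sets \<sigma> = sets borel" using \<sigma> by (auto simp: upper_regular_def)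
  \<comment> \<open>The gap between \<open>q\<close> and its limit (s + d)/2, where d is the
    dimension. It is shared evenly: \<open>p1\<close> and \<open>p2\<close> both stay
    \<open>\<eta>\<close> below the critical orders, \<open>s\<close> for the surface and d for the
    volume.\<close>
  define \<eta> where "\<eta> = (s + real DIM('a)) / 2 - q"
  define p1 p2 where "p1 = s - \<eta>" and "p2 = real DIM('a) - \<eta>"
  have p: "p1 < s" "p2 < real DIM('a)" "p1 + p2 = 2 * q" "0 \<le> p1" "0 \<le> p2"
    using q by (auto simp: p1_def p2_def \<eta>_def field_simps)
  obtain C1 where C1: "0 \<le> C1" "\<And>x. (\<integral>\<^sup>+ y. ennreal (riesz p1 R (x - y)) \<partial>\<sigma>) \<le> ennreal C1"
    using nn_integral_riesz_bounded[OF \<sigma>(1) p(4,1) q(4)] by blast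
  obtain C2 where C2: "0 \<le> C2" "\<And>x :: 'a. (\<integral>\<^sup>+ y. ennreal (riesz p2 R (x - y)) \<partial>lborel) \<le> ennreal C2"
    using nn_integral_riesz_bounded[OF upper_regular_lborel p(5,2) q(4)] by blast
  show ?thesis
  proof
    show "0 \<le> C1 * C2" using C1 C2 by simp
    fix g :: "'a \<Rightarrow> real" assume g [measurable]: "g \<in> borel_measurable borel"
    have split: "riesz q R u = riesz (p1 / 2) R u * riesz (p2 / 2) R u" for u :: 'a
    proof -
      have "- q = - (p1 / 2) + - (p2 / 2)" using p(3) by (simp add: field_simps)
      then show ?thesis unfolding riesz_def by (simp only: powr_add) simp
    qed
    have sq: "(riesz (p' / 2) R u)\<^sup>2 = riesz p' R u" for p' and u :: 'a
      by (simp add: riesz_def power2_eq_square powr_add[symmetric])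
    \<comment> \<open>The factor of order \<open>p1\<close> is integrated over the surface,
      uniformly in \<open>x\<close>; the factor of order \<open>p2\<close> stays with
      \<open>g\<close> and is integrated in \<open>x\<close> after Fubini.\<close>
    have "(\<integral>\<^sup>+ y. ennreal \<bar>g y\<bar> * ennreal (riesz q R (x - y)) \<partial>\<sigma>)\<^sup>2 \<le>
        ennreal C1 * (\<integral>\<^sup>+ y. ennreal ((g y)\<^sup>2) * ennreal (riesz p2 R (x - y)) \<partial>\<sigma>)" for x
    proof -
      have "(\<integral>\<^sup>+ y. ennreal \<bar>g y\<bar> * ennreal (riesz q R (x - y)) \<partial>\<sigma>)\<^sup>2 =
          (\<integral>\<^sup>+ y. ennreal (riesz (p1 / 2) R (x - y)) * ennreal (\<bar>g y\<bar> * riesz (p2 / 2) R (x - y)) \<partial>\<sigma>)\<^sup>2"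
        by (simp add: split ennreal_mult mult_ac)
      also have "\<dots> \<le> (\<integral>\<^sup>+ y. (ennreal (riesz (p1 / 2) R (x - y)))\<^sup>2 \<partial>\<sigma>) *
          (\<integral>\<^sup>+ y. (ennreal (\<bar>g y\<bar> * riesz (p2 / 2) R (x - y)))\<^sup>2 \<partial>\<sigma>)"
        by (rule Cauchy_Schwarz_nn_integral) measurable
      also have "\<dots> = (\<integral>\<^sup>+ y. ennreal (riesz p1 R (x - y)) \<partial>\<sigma>) *
          (\<integral>\<^sup>+ y. ennreal ((g y)\<^sup>2) * ennreal (riesz p2 R (x - y)) \<partial>\<sigma>)"
        by (simp add: ennreal_power sq power_mult_distrib ennreal_mult)
      also have "\<dots> \<le> ennreal C1 * (\<integral>\<^sup>+ y. ennreal ((g y)\<^sup>2) * ennreal (riesz p2 R (x - y)) \<partial>\<sigma>)"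
        by (intro mult_right_mono C1) auto
      finally show ?thesis .
    qed
    then have "(\<integral>\<^sup>+ x. (\<integral>\<^sup>+ y. ennreal \<bar>g y\<bar> * ennreal (riesz q R (x - y)) \<partial>\<sigma>)\<^sup>2 \<partial>lborel) \<le>
        (\<integral>\<^sup>+ x. ennreal C1 * (\<integral>\<^sup>+ y. ennreal ((g y)\<^sup>2) * ennreal (riesz p2 R (x - y)) \<partial>\<sigma>) \<partial>lborel)"
      by (intro nn_integral_mono)
    also have "\<dots> = ennreal C1 * (\<integral>\<^sup>+ x. (\<integral>\<^sup>+ y. ennreal ((g y)\<^sup>2) * ennreal (riesz p2 R (x - y)) \<partial>\<sigma>) \<partial>lborel)"
      by (intro nn_integral_cmult) measurable
    also have "\<dots> = ennreal C1 * (\<integral>\<^sup>+ y. (\<integral>\<^sup>+ x. ennreal ((g y)\<^sup>2) * ennreal (riesz p2 R (x - y)) \<partial>lborel) \<partial>\<sigma>)"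
      by (subst P.Fubini') measurable
    also have "\<dots> = ennreal C1 * (\<integral>\<^sup>+ y. ennreal ((g y)\<^sup>2) * (\<integral>\<^sup>+ x. ennreal (riesz p2 R (y - x)) \<partial>lborel) \<partial>\<sigma>)"
      by (subst riesz_commute) (simp add: nn_integral_cmult)
    also have "\<dots> \<le> ennreal C1 * (\<integral>\<^sup>+ y. ennreal ((g y)\<^sup>2) * ennreal C2 \<partial>\<sigma>)"
      by (intro mult_left_mono nn_integral_mono C2) auto
    also have "\<dots> = ennreal (C1 * C2) * (\<integral>\<^sup>+ y. ennreal ((g y)\<^sup>2) \<partial>\<sigma>)"
      using C1 C2 by (subst nn_integral_multc) (simp_all add: ennreal_mult mult_ac)
    finally show "(\<integral>\<^sup>+ x. (\<integral>\<^sup>+ y. ennreal \<bar>g y\<bar> * ennreal (riesz q R (x - y)) \<partial>\<sigma>)\<^sup>2 \<partial>lborel) \<le>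
      ennreal (C1 * C2) * (\<integral>\<^sup>+ y. ennreal ((g y)\<^sup>2) \<partial>\<sigma>)" .
  qed
qed

section \<open>Dilations and translations of Lebesgue measure\<close>

lemma lborel_scale:
  fixes f :: "'a::euclidean_space \<Rightarrow> real"
  assumes [measurable]: "f \<in> borel_measurable borel" and t: "0 < t"
  shows "(LINT u|lborel. f u) = (LINT v|lborel. t ^ DIM('a) * f (t *\<^sub>R v))"
proof -
  have "(LINT u|lborel. f u) = (LINT u|density (distr lborel borel (\<lambda>x. 0 + t *\<^sub>R x)) (\<lambda>_. ennreal (\<bar>t\<bar> ^ DIM('a))). f u)"
    using t lborel_affine[of t "0 :: 'a"] by simp
  also have "\<dots> = (LINT v|lborel. t ^ DIM('a) * f (t *\<^sub>R v))"
    using t by (subst integral_density) (auto simp: integral_distr)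
  finally show ?thesis .
qed

lemma lborel_scale_nn:
  fixes f :: "'a::euclidean_space \<Rightarrow> ennreal"
  assumes [measurable]: "f \<in> borel_measurable borel" and t: "0 < t"
  shows "(\<integral>\<^sup>+ u. f u \<partial>lborel) = (\<integral>\<^sup>+ v. ennreal (t ^ DIM('a)) * f (t *\<^sub>R v) \<partial>lborel)"
proof -
  have "(\<integral>\<^sup>+ u. f u \<partial>lborel) = (\<integral>\<^sup>+ u. f u \<partial>density (distr lborel borel (\<lambda>x. 0 + t *\<^sub>R x)) (\<lambda>_. ennreal (\<bar>t\<bar> ^ DIM('a))))"
    using t lborel_affine[of t "0 :: 'a"] by simp
  also have "\<dots> = (\<integral>\<^sup>+ v. ennreal (t ^ DIM('a)) * f (t *\<^sub>R v) \<partial>lborel)"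
    using t by (subst nn_integral_density) (auto simp: nn_integral_distr)
  finally show ?thesis .
qed

lemma lborel_translate:
  fixes f :: "'a::euclidean_space \<Rightarrow> 'b::{banach, second_countable_topology}"
  assumes [measurable]: "f \<in> borel_measurable borel"
  shows "(LINT x|lborel. f x) = (LINT u|lborel. f (a + u))"
proof -
  have "(LINT x|lborel. f x) = (LINT x|distr lborel borel ((+) a). f x)"
    by (simp add: lborel_distr_plus)
  then show ?thesis by (simp add: integral_distr)
qed

lemma lborel_translate_nn:
  fixes f :: "'a::euclidean_space \<Rightarrow> ennreal"
  assumes [measurable]: "f \<in> borel_measurable borel"
  shows "(\<integral>\<^sup>+ x. f x \<partial>lborel) = (\<integral>\<^sup>+ u. f (a + u) \<partial>lborel)"
proof -
  have "(\<integral>\<^sup>+ x. f x \<partial>lborel) = (\<integral>\<^sup>+ x. f x \<partial>distr lborel borel ((+) a))"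
    by (simp add: lborel_distr_plus)
  then show ?thesis by (simp add: nn_integral_distr)
qed

lemma nn_integral_inverse_power_le:
  assumes c: "0 < c" and m: "0 < m"
  shows "(\<integral>\<^sup>+ t. ennreal (indicator {c..1} t / t ^ Suc m) \<partial>lborel) \<le> ennreal (1 / c ^ m)"
proof (cases "c \<le> 1")
  case True
  have "(\<integral>\<^sup>+ t. ennreal (indicator {c..1} t / t ^ Suc m) \<partial>lborel) =
      (\<integral>\<^sup>+ t. ennreal (1 / t ^ Suc m) * indicator {c..1} t \<partial>lborel)"
    by (intro nn_integral_cong) (auto simp: indicator_def)
  also have "\<dots> = ennreal (- (1 / (real m * 1 ^ m)) - - (1 / (real m * c ^ m)))"
  proof (rule nn_integral_FTC_Icc[where F="\<lambda>t. - (1 / (real m * t ^ m))"])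
    fix t :: real assume "t \<in> {c..1}"
    then have t: "c \<le> t" "t \<le> 1" by auto
    then have "t \<noteq> 0" using c by auto
    obtain k where k: "m = Suc k" using m by (cases m) auto
    show "((\<lambda>t. - (1 / (real m * t ^ m))) has_real_derivative 1 / t ^ Suc m) (at t)"
    proof -
      have 1: "((\<lambda>t. real (Suc k) * t ^ Suc k) has_real_derivative real (Suc k) * (real (Suc k) * t ^ k)) (at t)"
        using DERIV_cmult[OF DERIV_pow[of "Suc k" t UNIV], of "real (Suc k)"] by simp
      have "((\<lambda>t. - inverse (real (Suc k) * t ^ Suc k)) has_real_derivative
          - (- (inverse (real (Suc k) * t ^ Suc k) * (real (Suc k) * (real (Suc k) * t ^ k)) *
          inverse (real (Suc k) * t ^ Suc k)))) (at t)"
        using \<open>t \<noteq> 0\<close> by (intro DERIV_minus DERIV_inverse' 1) auto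
      also have "- (- (inverse (real (Suc k) * t ^ Suc k) * (real (Suc k) * (real (Suc k) * t ^ k)) *
          inverse (real (Suc k) * t ^ Suc k))) = 1 / t ^ Suc (Suc k)"
        using \<open>t \<noteq> 0\<close> by (simp add: field_simps del: of_nat_Suc)
      finally show ?thesis unfolding k by (simp add: inverse_eq_divide)
    qed
    show "0 \<le> 1 / t ^ Suc m" using t c by auto
  qed (use True in auto)
  also have "\<dots> \<le> ennreal (1 / c ^ m)"
  proof (rule ennreal_leI)
    have "1 / (real m * c ^ m) \<le> 1 / c ^ m"
      using c m by (intro divide_left_mono) (auto simp: mult_le_cancel_right1)
    moreover have "0 \<le> 1 / (real m * 1 ^ m)" by simp
    ultimately show "- (1 / (real m * 1 ^ m)) - - (1 / (real m * c ^ m)) \<le> 1 / c ^ m"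
      by linarith
  qed
  finally show ?thesis .
next
  case False
  then have *: "indicator {c..1} t / t ^ Suc m = 0" for t :: real by (auto simp: indicator_def)
  show ?thesis unfolding * by simp
qed

section \<open>A field moving mass from a point into a ball\<close>

text \<open>Lipschitz instead of smooth, since the kernel built from it is needed only up to Hoelder
  continuity. Integral 1 makes the mass placed in the ball equal to the mass taken from the boundary
  point.\<close>

locale mollifier =
  fixes \<theta> :: "real^'n::finite \<Rightarrow> real" and \<rho> B L :: real
  assumes \<rho>: "0 < \<rho>" and nonneg: "0 \<le> \<theta> v" and le: "\<theta> v \<le> B"
    and support: "\<rho> \<le> norm v \<Longrightarrow> \<theta> v = 0"
    and lipschitz: "\<bar>\<theta> u - \<theta> v\<bar> \<le> L * norm (u - v)"
    and integrable: "integrable lborel \<theta>" and integral: "(LINT v|lborel. \<theta> v) = 1"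
begin

lemma B_nonneg: "0 \<le> B"
  using nonneg[of 0] le[of 0] by linarith

lemma L_nonneg: "0 \<le> L"
  using lipschitz[of "axis undefined 1" 0] by (simp add: abs_le_iff)

lemma continuous: "continuous_on UNIV \<theta>"
proof -
  have "L-lipschitz_on UNIV \<theta>"
    using lipschitz L_nonneg by (auto intro!: lipschitz_onI simp: dist_norm)
  then show ?thesis by (rule lipschitz_on_continuous_on)
qed

lemma measurable [measurable]: "\<theta> \<in> borel_measurable borel"
  using continuous by (rule borel_measurable_continuous_onI)

lemma nn_integral: "(\<integral>\<^sup>+ v. ennreal (\<theta> (v - w)) \<partial>lborel) = 1"
proof -
  have "(\<integral>\<^sup>+ v. ennreal (\<theta> (v - w)) \<partial>lborel) = (\<integral>\<^sup>+ v. ennreal (\<theta> v) \<partial>lborel)"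
    by (subst lborel_translate_nn[where a=w]) auto
  also have "\<dots> = ennreal 1"
    using integral nn_integral_eq_integral[OF integrable] nonneg by simp
  finally show ?thesis by simp
qed

lemma integrable_translate: "integrable lborel (\<lambda>v. \<theta> (v - w))"
  by (rule integrableI_nonneg) (auto simp: nonneg nn_integral)

lemma integral_translate: "(LINT v|lborel. \<theta> (v - w)) = 1"
  using integral by (subst lborel_translate[where a=w]) auto

text \<open>The density at \<open>y + u\<close> of the segments from \<open>y\<close> to the points \<open>y + v\<close>, weighted by \<open>\<theta> (v - w)\<close>.\<close>

definition density :: "real^'n \<Rightarrow> real^'n \<Rightarrow> real \<Rightarrow> real" where
  "density w u t = indicator {0<..1} t * \<theta> ((1 / t) *\<^sub>R u - w) / t ^ Suc CARD('n)"

text \<open>Substituting \<open>r = 1 / t\<close> gives the integral of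
  \<open>\<theta> (r u - w) * r ^ (d - 1)\<close> over \<open>r \<ge> 1\<close>, the Bogovskii
  kernel without its vector factor \<open>u\<close>. The power d + 1 in \<open>density\<close> is
  the Jacobian of \<open>v = u / t\<close> and one more \<open>1 / t\<close> from the velocity
  \<open>v\<close>.\<close>

definition kernel :: "real^'n \<Rightarrow> real^'n \<Rightarrow> real" where
  "kernel w u = (LINT t|lborel. density w u t)"

lemma density_nonneg: "0 \<le> density w u t"
  unfolding density_def using nonneg by (auto simp: indicator_def)

lemma measurable_density [measurable]:
  "(\<lambda>(p, t). density (fst p) (snd p) t) \<in> borel_measurable (borel \<Otimes>\<^sub>M borel)"
proof -
  have "(\<lambda>(p :: (real^'n) \<times> (real^'n), t :: real). density (fst p) (snd p) t) \<in>
      borel_measurable ((borel \<Otimes>\<^sub>M borel) \<Otimes>\<^sub>M borel)"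
    unfolding density_def by measurable
  then show ?thesis by (simp add: borel_prod)
qed

lemma measurable_kernel [measurable]:
  assumes [measurable]: "f \<in> borel_measurable M" "g \<in> borel_measurable M"
  shows "(\<lambda>x. kernel (f x) (g x)) \<in> borel_measurable M"
proof -
  have "(\<lambda>x. LINT t|lborel. (\<lambda>(p, t). density (fst p) (snd p) t) ((f x, g x), t)) \<in> borel_measurable M"
    by measurable
  then show ?thesis unfolding kernel_def by simp
qed

lemma density_measurable: "density w u \<in> borel_measurable borel"
  unfolding density_def by measurable

text \<open>\<open>M\<close> bounds the support of \<open>\<theta> (v - w)\<close>, and for small
  \<open>t\<close> the point \<open>u / t\<close> lies beyond it. This cut-off at
  \<open>t = norm u / M\<close> produces all negative powers of \<open>norm u\<close> below.\<close>

lemma density_eq_0: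
  assumes M: "norm w + \<rho> \<le> M" "0 < M" and t: "t < norm u / M"
  shows "density w u t = 0"
proof (cases "0 < t")
  case True
  have "M < norm ((1 / t) *\<^sub>R u)" using t True M(2) by (simp add: field_simps)
  then have "\<rho> \<le> norm ((1 / t) *\<^sub>R u - w)"
    using M(1) norm_triangle_ineq2[of "(1 / t) *\<^sub>R u" w] by linarith
  then show ?thesis by (simp add: density_def support)
qed (simp add: density_def)

lemma nn_integral_density_le:
  assumes M: "norm w + \<rho> \<le> M" "0 < M" and u: "u \<noteq> 0"
  shows "(\<integral>\<^sup>+ t. ennreal (density w u t) \<partial>lborel) \<le> ennreal (B * (M / norm u) ^ CARD('n))"
proof -
  let ?c = "norm u / M"
  have c: "0 < ?c" using u M by simp
  have "density w u t \<le> B * (indicator {?c..1} t / t ^ Suc CARD('n))" for t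
  proof (cases "?c \<le> t \<and> t \<le> 1")
    case True
    then show ?thesis using c le[of "(1 / t) *\<^sub>R u - w"]
      by (auto simp: density_def indicator_def intro!: divide_right_mono)
  next
    case False
    then have "density w u t = 0" using density_eq_0[OF M, of t u] by (auto simp: density_def)
    then show ?thesis using False by (auto simp: indicator_def)
  qed
  then have "(\<integral>\<^sup>+ t. ennreal (density w u t) \<partial>lborel) \<le>
      (\<integral>\<^sup>+ t. ennreal B * ennreal (indicator {?c..1} t / t ^ Suc CARD('n)) \<partial>lborel)"
    using B_nonneg c
    by (intro nn_integral_mono) (auto simp: ennreal_mult'[symmetric] intro!: ennreal_leI)
  also have "\<dots> = ennreal B * (\<integral>\<^sup>+ t. ennreal (indicator {?c..1} t / t ^ Suc CARD('n)) \<partial>lborel)"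
    by (rule nn_integral_cmult) measurable
  also have "\<dots> \<le> ennreal B * ennreal (1 / ?c ^ CARD('n))"
    by (intro mult_left_mono nn_integral_inverse_power_le c) auto
  also have "\<dots> = ennreal (B * (M / norm u) ^ CARD('n))"
    using B_nonneg by (simp add: ennreal_mult'[symmetric] power_divide)
  finally show ?thesis .
qed

lemma integrable_density:
  assumes M: "norm w + \<rho> \<le> M" "0 < M" and u: "u \<noteq> 0"
  shows "integrable lborel (density w u)"
proof (rule integrableI_nonneg)
  show "density w u \<in> borel_measurable lborel" using density_measurable by simp
  show "(\<integral>\<^sup>+ t. ennreal (density w u t) \<partial>lborel) < \<infinity>"
    using nn_integral_density_le[OF M u] by (simp add: le_less_trans)
qed (simp add: density_nonneg)

lemma kernel_nonneg: "0 \<le> kernel w u"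
  unfolding kernel_def by (rule Bochner_Integration.integral_nonneg) (rule density_nonneg)

lemma kernel_le:
  assumes M: "norm w + \<rho> \<le> M" "0 < M" and u: "u \<noteq> 0"
  shows "kernel w u \<le> B * (M / norm u) ^ CARD('n)"
proof -
  have "ennreal (kernel w u) = (\<integral>\<^sup>+ t. ennreal (density w u t) \<partial>lborel)"
    unfolding kernel_def
    by (rule nn_integral_eq_integral[symmetric, OF integrable_density[OF M u]]) (simp add: density_nonneg)
  also have "\<dots> \<le> ennreal (B * (M / norm u) ^ CARD('n))" by (rule nn_integral_density_le[OF M u])
  finally show ?thesis using B_nonneg M by (simp add: ennreal_le_iff)
qed

text \<open>The Lipschitz bound of \<open>\<theta>\<close> at \<open>u / t\<close> costs one more
  \<open>1 / t\<close>, hence one more power of \<open>M / norm u\<close> than in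
  \<open>kernel_le\<close>. Taking \<open>u\<close> as the shorter vector lets its cut-off in
  \<open>t\<close> serve for both.\<close>

lemma kernel_lipschitz:
  assumes M: "norm w + \<rho> \<le> M" "0 < M" and u: "u \<noteq> 0" "norm u \<le> norm u'"
  shows "\<bar>kernel w u - kernel w u'\<bar> \<le> L * norm (u - u') * (M / norm u) ^ Suc CARD('n)"
proof -
  let ?c = "norm u / M"
  have c: "0 < ?c" using u M by simp
  have u': "u' \<noteq> 0" using u by auto
  note int = integrable_density[OF M u(1)] integrable_density[OF M u']
  have pw: "\<bar>density w u t - density w u' t\<bar> \<le>
      L * norm (u - u') * (indicator {?c..1} t / t ^ Suc (Suc CARD('n)))" for t
  proof (cases "?c \<le> t \<and> t \<le> 1")
    case True
    have t: "0 < t" using True c by linarith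
    have "\<bar>\<theta> ((1 / t) *\<^sub>R u - w) - \<theta> ((1 / t) *\<^sub>R u' - w)\<bar> \<le> L * (norm (u - u') / t)"
      using lipschitz[of "(1 / t) *\<^sub>R u - w" "(1 / t) *\<^sub>R u' - w"] t
      by (simp add: scaleR_diff_right[symmetric])
    then have "\<bar>\<theta> ((1 / t) *\<^sub>R u - w) - \<theta> ((1 / t) *\<^sub>R u' - w)\<bar> / t ^ Suc CARD('n) \<le>
        L * (norm (u - u') / t) / t ^ Suc CARD('n)"
      using t by (intro divide_right_mono) auto
    then show ?thesis using True t
      by (simp add: density_def indicator_def diff_divide_distrib[symmetric] abs_divide field_simps)
  next
    case False
    have "norm u / M \<le> norm u' / M" using u M by (intro divide_right_mono) auto
    then have "density w u t = 0" "density w u' t = 0"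
      using False density_eq_0[OF M, of t u] density_eq_0[OF M, of t u']
      by (auto simp: density_def)
    then show ?thesis using False by (auto simp: indicator_def)
  qed
  have "ennreal \<bar>kernel w u - kernel w u'\<bar> = ennreal (norm (LINT t|lborel. density w u t - density w u' t))"
    unfolding kernel_def by (simp add: int)
  also have "\<dots> \<le> (\<integral>\<^sup>+ t. ennreal (norm (density w u t - density w u' t)) \<partial>lborel)"
    by (intro integral_norm_bound_ennreal Bochner_Integration.integrable_diff int)
  also have "\<dots> \<le> (\<integral>\<^sup>+ t. ennreal (L * norm (u - u')) *
      ennreal (indicator {?c..1} t / t ^ Suc (Suc CARD('n))) \<partial>lborel)"
    using pw L_nonneg by (intro nn_integral_mono) (auto simp: ennreal_mult'[symmetric] intro!: ennreal_leI)
  also have "\<dots> = ennreal (L * norm (u - u')) * (\<integral>\<^sup>+ t. ennreal (indicator {?c..1} t / t ^ Suc (Suc CARD('n))) \<partial>lborel)"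
    by (rule nn_integral_cmult) measurable
  also have "\<dots> \<le> ennreal (L * norm (u - u')) * ennreal (1 / ?c ^ Suc CARD('n))"
    by (intro mult_left_mono nn_integral_inverse_power_le c) auto
  also have "\<dots> = ennreal (L * norm (u - u') * (M / norm u) ^ Suc CARD('n))"
    using L_nonneg by (simp add: ennreal_mult'[symmetric] power_divide)
  finally show ?thesis using L_nonneg M by (subst (asm) ennreal_le_iff) auto
qed

end

lemma integrable_pairI:
  fixes f :: "_ \<Rightarrow> 'b::{banach, second_countable_topology}"
  assumes N: "sigma_finite_measure N" and f: "f \<in> borel_measurable (M \<Otimes>\<^sub>M N)"
    and fin: "(\<integral>\<^sup>+ x. \<integral>\<^sup>+ y. ennreal (norm (f (x, y))) \<partial>N \<partial>M) < \<infinity>"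
  shows "integrable (M \<Otimes>\<^sub>M N) f"
proof (rule integrableI_bounded[OF f])
  have "(\<lambda>p. ennreal (norm (f p))) \<in> borel_measurable (M \<Otimes>\<^sub>M N)" using f by measurable
  from sigma_finite_measure.nn_integral_fst[OF N this] fin
  show "(\<integral>\<^sup>+ p. ennreal (norm (f p)) \<partial>(M \<Otimes>\<^sub>M N)) < \<infinity>" by simp
qed

section \<open>Hoelder continuity and divergence of the transport field\<close>

context mollifier
begin

text \<open>The vector factor lowers the order of the singularity from d to d - 1.\<close>

lemma kernel_vector_le:
  assumes M: "norm w + \<rho> \<le> M" "0 < M" and u: "norm u \<le> R"
  shows "norm (kernel w u *\<^sub>R u) \<le> B * M ^ CARD('n) * riesz (real CARD('n) - 1) R u"
proof (cases "u = 0")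
  case False
  have "norm (kernel w u *\<^sub>R u) = kernel w u * norm u" by (simp add: kernel_nonneg)
  also have "\<dots> \<le> B * (M / norm u) ^ CARD('n) * norm u"
    by (intro mult_right_mono kernel_le[OF M False]) auto
  also have "\<dots> = B * M ^ CARD('n) * riesz (real CARD('n) - 1) R u"
    using u False by (simp add: riesz_def power_divide powr_diff powr_realpow)
  finally show ?thesis .
qed (use B_nonneg M in \<open>auto intro!: mult_nonneg_nonneg\<close>)

text \<open>If the increment is at most \<open>norm u\<close>, the Lipschitz bound is used and the
  power 3/4 of the increment is traded for that of \<open>norm u\<close>. If it is larger, both
  values are bounded separately and the power 1/4 of \<open>norm u\<close> is traded for that of the
  increment.\<close>

lemma kernel_vector_diff_le:
  assumes M: "norm w + \<rho> \<le> M" "0 < M" and u: "u \<noteq> 0" "norm u \<le> norm u'"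
  defines "d \<equiv> real CARD('n)"
  defines "C \<equiv> L * M ^ Suc CARD('n) + 2 * (B * M ^ CARD('n))"
  shows "norm (kernel w u *\<^sub>R u - kernel w u' *\<^sub>R u') \<le>
    C * norm (u - u') powr (1/4) * norm u powr (- (d - 3/4))"
proof -
  have nu: "0 < norm u" "0 < norm u'" using u by (auto intro: less_le_trans)
  have u': "u' \<noteq> 0" using nu by auto
  have mono: "(M / norm u') ^ CARD('n) \<le> (M / norm u) ^ CARD('n)"
    using u M nu by (intro power_mono divide_left_mono) auto
  have C: "0 \<le> C" using L_nonneg B_nonneg M by (auto simp: C_def)
  consider "norm (u - u') \<le> norm u" "0 < norm (u - u')" | "norm u < norm (u - u')" | "u = u'" by fastforce
  then show ?thesis
  proof cases
    case 1
    have "kernel w u *\<^sub>R u - kernel w u' *\<^sub>R u' = (kernel w u - kernel w u') *\<^sub>R u + kernel w u' *\<^sub>R (u - u')"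
      by (simp add: algebra_simps)
    then have "norm (kernel w u *\<^sub>R u - kernel w u' *\<^sub>R u') \<le>
        \<bar>kernel w u - kernel w u'\<bar> * norm u + kernel w u' * norm (u - u')"
      using norm_triangle_ineq[of "(kernel w u - kernel w u') *\<^sub>R u" "kernel w u' *\<^sub>R (u - u')"]
      by (simp add: kernel_nonneg)
    also have "\<dots> \<le> L * norm (u - u') * (M / norm u) ^ Suc CARD('n) * norm u +
        B * (M / norm u) ^ CARD('n) * norm (u - u')"
      using kernel_lipschitz[OF M u] order_trans[OF kernel_le[OF M u'] mult_left_mono[OF mono B_nonneg]]
      by (intro add_mono mult_right_mono) auto
    also have "\<dots> = (L * M ^ Suc CARD('n) + B * M ^ CARD('n)) * (norm (u - u') * norm u powr (- d))"
      using nu by (simp add: power_divide powr_minus powr_realpow d_def field_simps)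
    also have "\<dots> \<le> C * (norm (u - u') * norm u powr (- d))"
      using B_nonneg M by (intro mult_right_mono) (auto simp: C_def)
    also have "\<dots> \<le> C * (norm (u - u') powr (1/4) * norm u powr (- (d - 3/4)))"
    proof (intro mult_left_mono C)
      have "norm (u - u') = norm (u - u') powr (1/4) * norm (u - u') powr (3/4)"
        using 1 by (simp add: powr_add[symmetric])
      also have "\<dots> \<le> norm (u - u') powr (1/4) * norm u powr (3/4)"
        using 1 by (intro mult_left_mono powr_mono2) auto
      finally have "norm (u - u') * norm u powr (- d) \<le>
          norm (u - u') powr (1/4) * norm u powr (3/4) * norm u powr (- d)"
        by (intro mult_right_mono) auto
      also have "\<dots> = norm (u - u') powr (1/4) * norm u powr (- (d - 3/4))"
        by (simp add: powr_add[symmetric] algebra_simps)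
      finally show "norm (u - u') * norm u powr (- d) \<le> norm (u - u') powr (1/4) * norm u powr (- (d - 3/4))" .
    qed
    finally show ?thesis by (simp add: mult.assoc)
  next
    case 2
    have k: "norm (kernel w v *\<^sub>R v) \<le> B * M ^ CARD('n) * norm v powr (- (d - 1))" if "v \<noteq> 0" for v
      using kernel_vector_le[OF M, of v "norm v"] by (simp add: riesz_def d_def)
    have "norm (kernel w u *\<^sub>R u - kernel w u' *\<^sub>R u') \<le>
        B * M ^ CARD('n) * norm u powr (- (d - 1)) + B * M ^ CARD('n) * norm u' powr (- (d - 1))"
      by (intro order_trans[OF norm_triangle_ineq4] add_mono k u u')
    also have "\<dots> \<le> B * M ^ CARD('n) * norm u powr (- (d - 1)) + B * M ^ CARD('n) * norm u powr (- (d - 1))"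
      using u nu B_nonneg M one_le_card_finite[where 'a='n]
      by (intro add_left_mono mult_left_mono powr_mono2') (auto simp: d_def Suc_le_eq)
    also have "\<dots> \<le> C * norm u powr (- (d - 1))"
      using L_nonneg M by (simp add: C_def distrib_right)
    also have "\<dots> \<le> C * (norm (u - u') powr (1/4) * norm u powr (- (d - 3/4)))"
    proof (intro mult_left_mono C)
      have "norm u powr (- (d - 1)) = norm u powr (1/4) * norm u powr (- (d - 3/4))"
        by (simp add: powr_add[symmetric])
      also have "\<dots> \<le> norm (u - u') powr (1/4) * norm u powr (- (d - 3/4))"
        using 2 by (intro mult_right_mono powr_mono2) auto
      finally show "norm u powr (- (d - 1)) \<le> norm (u - u') powr (1/4) * norm u powr (- (d - 3/4))" .
    qed
    finally show ?thesis by (simp add: mult.assoc)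
  qed simp
qed

text \<open>The symmetric form: which of the two vectors is shorter varies under the integral, so
  both singularities are added.\<close>

lemma kernel_vector_holder:
  assumes M: "norm w + \<rho> \<le> M" "0 < M" and u: "u \<noteq> 0" "u' \<noteq> 0" "norm u \<le> R" "norm u' \<le> R"
  shows "norm (kernel w u *\<^sub>R u - kernel w u' *\<^sub>R u') \<le>
    (L * M ^ Suc CARD('n) + 2 * (B * M ^ CARD('n))) * norm (u - u') powr (1/4) *
    (riesz (real CARD('n) - 3/4) R u + riesz (real CARD('n) - 3/4) R u')"
    (is "?l \<le> ?C * _ * _")
proof -
  have C: "0 \<le> ?C * norm (u - u') powr (1/4)" using L_nonneg B_nonneg M by auto
  have r: "riesz (real CARD('n) - 3/4) R u = norm u powr (- (real CARD('n) - 3/4))"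
    "riesz (real CARD('n) - 3/4) R u' = norm u' powr (- (real CARD('n) - 3/4))"
    using u by (auto simp: riesz_def)
  show ?thesis
  proof (cases "norm u \<le> norm u'")
    case True
    have "?l \<le> ?C * norm (u - u') powr (1/4) * riesz (real CARD('n) - 3/4) R u"
      unfolding r by (rule kernel_vector_diff_le[OF M u(1) True])
    also have "\<dots> \<le> ?C * norm (u - u') powr (1/4) *
        (riesz (real CARD('n) - 3/4) R u + riesz (real CARD('n) - 3/4) R u')"
      using C by (intro mult_left_mono) auto
    finally show ?thesis .
  next
    case False
    then have "?l \<le> ?C * norm (u - u') powr (1/4) * riesz (real CARD('n) - 3/4) R u'"
      unfolding r using kernel_vector_diff_le[OF M u(2), of u] by (simp add: norm_minus_commute)
    also have "\<dots> \<le> ?C * norm (u - u') powr (1/4) *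
        (riesz (real CARD('n) - 3/4) R u + riesz (real CARD('n) - 3/4) R u')"
      using C by (intro mult_left_mono) auto
    finally show ?thesis .
  qed
qed

lemma kernel_eq_0:
  assumes "\<And>t v. 0 < t \<Longrightarrow> t \<le> 1 \<Longrightarrow> norm (v - w) < \<rho> \<Longrightarrow> u \<noteq> t *\<^sub>R v"
  shows "kernel w u = 0"
proof -
  have "density w u t = 0" for t
  proof (rule ccontr)
    assume *: "density w u t \<noteq> 0"
    then have t: "0 < t" "t \<le> 1" "norm ((1 / t) *\<^sub>R u - w) < \<rho>"
      using support[of "(1 / t) *\<^sub>R u - w"] by (force simp: density_def indicator_def not_le[symmetric] split: if_splits)+
    then show False using assms[OF t] by simp
  qed
  then show ?thesis by (simp add: kernel_def)
qed

text \<open>The field \<open>kernel w u *\<^sub>R u\<close> carries the unit mass of \<open>\<theta> (v - w)\<close> to the origin along segments.\<close>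

lemma kernel_gradient:
  assumes M: "norm w + \<rho> \<le> M" "0 < M" and \<phi>: "C1 \<phi> D\<phi>"
  shows "(LINT u|lborel. (kernel w u *\<^sub>R u) \<bullet> D\<phi> (y + u)) =
    (LINT v|lborel. \<theta> (v - w) * \<phi> (y + v)) - \<phi> y"
proof -
  note [measurable] = C1_measurable[OF \<phi>]
  have "compact (cball y M)" by simp
  then have "bounded (D\<phi> ` cball y M)" "bounded (\<phi> ` cball y M)"
    using C1_continuous[OF \<phi>]
    by (auto intro!: compact_imp_bounded compact_continuous_image intro: continuous_on_subset)
  then obtain P Q where P: "\<And>x. x \<in> cball y M \<Longrightarrow> norm (D\<phi> x) \<le> P"
    and Q: "\<And>x. x \<in> cball y M \<Longrightarrow> norm (\<phi> x) \<le> Q" unfolding bounded_iff by blast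
  have "norm (D\<phi> y) \<le> P" using M by (intro P) simp
  then have P0: "0 \<le> P" using norm_ge_zero order_trans by blast
  have inM: "norm v \<le> M" if "\<theta> (v - w) \<noteq> 0" for v
  proof -
    have "norm (v - w) < \<rho>" using support[of "v - w"] that by (metis not_le)
    then show ?thesis using norm_triangle_sub[of v w] M by linarith
  qed
  \<comment> \<open>\<open>J\<close> and \<open>F\<close> are one integrand in the variables
    \<open>v\<close> and \<open>u = t *\<^sub>R v\<close>, without and with the singularity.\<close>
  define J where "J = (\<lambda>(v, t). indicator {0<..1::real} t * (\<theta> (v - w) * (v \<bullet> D\<phi> (y + t *\<^sub>R v))))"
  define F where "F = (\<lambda>(u, t). density w u t * (u \<bullet> D\<phi> (y + u)))"
  have [measurable]: "(\<lambda>(u, t). density w u t) \<in> borel_measurable (borel \<Otimes>\<^sub>M borel)"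
    unfolding density_def by measurable
  have mJ [measurable]: "J \<in> borel_measurable (lborel \<Otimes>\<^sub>M lborel)" unfolding J_def by measurable
  have mF [measurable]: "F \<in> borel_measurable (lborel \<Otimes>\<^sub>M lborel)" unfolding F_def by measurable
  have Jbound: "\<bar>J (v, t)\<bar> \<le> M * P * \<theta> (v - w) * indicator {0<..1} t" for v t
  proof (cases "\<theta> (v - w) = 0 \<or> t \<notin> {0<..1}")
    case False
    then have v: "norm v \<le> M" and t: "0 < t" "t \<le> 1" using inM[of v] by auto
    have "norm (t *\<^sub>R v) \<le> M" using v t mult_left_le_one_le[of "norm v" t] by simp
    then have "norm (D\<phi> (y + t *\<^sub>R v)) \<le> P" by (intro P) (simp add: dist_norm)
    then have "\<bar>v \<bullet> D\<phi> (y + t *\<^sub>R v)\<bar> \<le> M * P"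
      using v M by (intro order_trans[OF Cauchy_Schwarz_ineq2] mult_mono) auto
    then have "\<theta> (v - w) * \<bar>v \<bullet> D\<phi> (y + t *\<^sub>R v)\<bar> \<le> \<theta> (v - w) * (M * P)"
      by (intro mult_left_mono nonneg)
    then show ?thesis using t nonneg[of "v - w"]
      by (simp add: J_def abs_mult mult.commute)
  qed (auto simp: J_def)
  \<comment> \<open>Absolute integrability is checked for \<open>J\<close>, where the integrand is
    bounded by a multiple of the mollifier, and carried over to \<open>F\<close> by scaling at each
    fixed \<open>t\<close>.\<close>
  have "(\<integral>\<^sup>+ v. \<integral>\<^sup>+ t. ennreal (norm (J (v, t))) \<partial>lborel \<partial>lborel) \<le>
      (\<integral>\<^sup>+ v. \<integral>\<^sup>+ t. ennreal (M * P) * ennreal (\<theta> (v - w)) * indicator {0<..1::real} t \<partial>lborel \<partial>lborel)"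
    using Jbound M P0 nonneg
    by (intro nn_integral_mono)
      (auto simp: ennreal_mult'[symmetric] ennreal_indicator[symmetric] intro!: ennreal_leI)
  also have "\<dots> = ennreal (M * P)"
    by (simp add: nn_integral_cmult nn_integral)
  finally have nnJ: "(\<integral>\<^sup>+ v. \<integral>\<^sup>+ t. ennreal (norm (J (v, t))) \<partial>lborel \<partial>lborel) < \<infinity>"
    by (simp add: le_less_trans)
  then have intJ: "integrable (lborel \<Otimes>\<^sub>M lborel) J"
    by (intro integrable_pairI mJ) (auto simp: sigma_finite_lborel)
  have scale: "t ^ CARD('n) * F (t *\<^sub>R v, t) = J (v, t)" if "0 < t" for t v
    using that by (simp add: F_def J_def density_def field_simps)
  have FJ: "(LINT u|lborel. F (u, t)) = (LINT v|lborel. J (v, t))" for t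
  proof (cases "0 < t")
    case True
    have "(LINT u|lborel. F (u, t)) = (LINT v|lborel. t ^ CARD('n) * F (t *\<^sub>R v, t))"
      using lborel_scale[OF _ True, of "\<lambda>u. F (u, t)"] by simp
    then show ?thesis by (simp add: scale True)
  qed (simp add: F_def J_def density_def)
  have nnFJ: "(\<integral>\<^sup>+ u. ennreal (norm (F (u, t))) \<partial>lborel) = (\<integral>\<^sup>+ v. ennreal (norm (J (v, t))) \<partial>lborel)" for t
  proof (cases "0 < t")
    case True
    have "(\<integral>\<^sup>+ u. ennreal (norm (F (u, t))) \<partial>lborel) =
        (\<integral>\<^sup>+ v. ennreal (t ^ CARD('n)) * ennreal (norm (F (t *\<^sub>R v, t))) \<partial>lborel)"
      using lborel_scale_nn[OF _ True, of "\<lambda>u. ennreal (norm (F (u, t)))"] by simp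
    also have "\<dots> = (\<integral>\<^sup>+ v. ennreal (norm (J (v, t))) \<partial>lborel)"
      using True by (simp add: ennreal_mult'[symmetric] scale[symmetric] abs_mult)
    finally show ?thesis .
  qed (simp add: F_def J_def density_def)
  have "(\<integral>\<^sup>+ u. \<integral>\<^sup>+ t. ennreal (norm (F (u, t))) \<partial>lborel \<partial>lborel) =
      (\<integral>\<^sup>+ t. \<integral>\<^sup>+ u. ennreal (norm (F (u, t))) \<partial>lborel \<partial>lborel)"
    by (rule lborel_pair.Fubini'[symmetric]) measurable
  also have "\<dots> = (\<integral>\<^sup>+ v. \<integral>\<^sup>+ t. ennreal (norm (J (v, t))) \<partial>lborel \<partial>lborel)"
    unfolding nnFJ by (rule lborel_pair.Fubini') measurable
  finally have intF: "integrable (lborel \<Otimes>\<^sub>M lborel) F"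
    using nnJ by (intro integrable_pairI mF) (auto simp: sigma_finite_lborel)
  have "(LINT u|lborel. (kernel w u *\<^sub>R u) \<bullet> D\<phi> (y + u)) = (LINT u|lborel. LINT t|lborel. F (u, t))"
    by (simp add: F_def kernel_def)
  also have "\<dots> = (LINT t|lborel. LINT u|lborel. F (u, t))"
    using intF by (intro lborel_pair.Fubini_integral[symmetric]) (simp add: case_prod_beta')
  also have "\<dots> = (LINT v|lborel. LINT t|lborel. J (v, t))"
    unfolding FJ using intJ by (intro lborel_pair.Fubini_integral) (simp add: case_prod_beta')
  \<comment> \<open>Along a segment the integrand is the derivative of
    \<open>\<phi> (y + t *\<^sub>R v)\<close> in \<open>t\<close>.\<close>
  also have "\<dots> = (LINT v|lborel. \<theta> (v - w) * (\<phi> (y + v) - \<phi> y))"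
  proof (rule Bochner_Integration.integral_cong[OF refl])
    fix v
    have "(LINT t|lborel. indicator {0..1::real} t *\<^sub>R (v \<bullet> D\<phi> (y + t *\<^sub>R v))) =
        \<phi> (y + 1 *\<^sub>R v) - \<phi> (y + 0 *\<^sub>R v)"
    proof (rule integral_FTC_Icc)
      fix t :: real
      have "((\<lambda>t. y + t *\<^sub>R v) has_derivative (\<lambda>h. h *\<^sub>R v)) (at t within {0..1})"
        by (auto intro!: derivative_eq_intros)
      moreover have "(\<phi> has_derivative (\<lambda>h. h \<bullet> D\<phi> (y + t *\<^sub>R v))) (at (y + t *\<^sub>R v) within (\<lambda>t. y + t *\<^sub>R v) ` {0..1})"
        using \<phi> unfolding C1_def gderiv_def by (blast intro: has_derivative_at_withinI)
      ultimately show "((\<lambda>t. \<phi> (y + t *\<^sub>R v)) has_vector_derivative v \<bullet> D\<phi> (y + t *\<^sub>R v)) (at t within {0..1})"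
        unfolding has_vector_derivative_def by (auto dest: has_derivative_in_compose)
      show "continuous_on {0..1} (\<lambda>t. v \<bullet> D\<phi> (y + t *\<^sub>R v))"
        by (intro continuous_intros continuous_on_compose2[OF C1_continuous(2)[OF \<phi>]]) auto
    qed simp
    \<comment> \<open>\<open>density\<close> excludes \<open>t = 0\<close>, the fundamental theorem
      of calculus includes it.\<close>
    also have "(LINT t|lborel. indicator {0..1::real} t *\<^sub>R (v \<bullet> D\<phi> (y + t *\<^sub>R v))) =
        (LINT t|lborel. indicator {0<..1::real} t *\<^sub>R (v \<bullet> D\<phi> (y + t *\<^sub>R v)))"
      using AE_lborel_singleton[of "0::real"]
      by (intro integral_cong_AE) (auto elim!: AE_mp simp: indicator_def)
    finally show "(LINT t|lborel. J (v, t)) = \<theta> (v - w) * (\<phi> (y + v) - \<phi> y)"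
      by (simp add: J_def mult.left_commute[of "indicator _ _"])
  qed
  also have "\<dots> = (LINT v|lborel. \<theta> (v - w) * \<phi> (y + v)) - \<phi> y"
  proof -
    have "integrable lborel (\<lambda>v. \<theta> (v - w) * \<phi> (y + v))"
    proof (rule Bochner_Integration.integrable_bound)
      show "integrable lborel (\<lambda>v. Q * \<theta> (v - w))" using integrable_translate by simp
      have "\<bar>\<theta> (v - w) * \<phi> (y + v)\<bar> \<le> \<bar>Q * \<theta> (v - w)\<bar>" for v
      proof (cases "\<theta> (v - w) = 0")
        case False
        then have "\<bar>\<phi> (y + v)\<bar> \<le> \<bar>Q\<bar>" using inM[of v] Q[of "y + v"] by (simp add: dist_norm)
        then have "\<theta> (v - w) * \<bar>\<phi> (y + v)\<bar> \<le> \<theta> (v - w) * \<bar>Q\<bar>" by (intro mult_left_mono nonneg)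
        then show ?thesis using nonneg[of "v - w"] by (simp add: abs_mult mult.commute)
      qed simp
      then show "AE v in lborel. norm (\<theta> (v - w) * \<phi> (y + v)) \<le> norm (Q * \<theta> (v - w))" by simp
    qed measurable
    then show ?thesis
      by (simp add: right_diff_distrib integrable_translate integral_translate)
  qed
  finally show ?thesis .
qed

end

lemma ennreal_power2_sum_le: "(a + b :: ennreal)\<^sup>2 \<le> 2 * (a\<^sup>2 + b\<^sup>2)"
proof (cases "a = \<infinity> \<or> b = \<infinity>")
  case True
  then show ?thesis by (auto simp: power2_eq_square ennreal_mult_top ennreal_top_mult)
next
  case False
  then obtain x y where xy: "0 \<le> x" "a = ennreal x" "0 \<le> y" "b = ennreal y"
    by (metis ennreal_cases infinity_ennreal_def)
  have "(x + y)\<^sup>2 \<le> 2 * (x\<^sup>2 + y\<^sup>2)" using sum_squares_bound[of x y] by (simp add: power2_sum)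
  then have "ennreal ((x + y)\<^sup>2) \<le> ennreal (2 * (x\<^sup>2 + y\<^sup>2))" by (rule ennreal_leI)
  then show ?thesis using xy by (simp add: ennreal_power[symmetric] ennreal_mult)
qed

section \<open>Fields with prescribed normal trace\<close>

text \<open>\<open>w y\<close> leads from \<open>y\<close> to the centre of the ball that
  \<open>y\<close> sees, and \<open>visible\<close> keeps the segments into this ball inside
  \<open>G\<close>, except for \<open>y\<close> itself. \<open>\<sigma>\<close> is a finite Borel
  measure on the whole space, so that Fubini with Lebesgue measure is available.\<close>

locale surface_lift = mollifier \<theta> \<rho> B L for \<theta> :: "real^'n::finite \<Rightarrow> real" and \<rho> B L +
  fixes \<sigma> :: "(real^'n) measure" and G S :: "(real^'n) set" and w :: "real^'n \<Rightarrow> real^'n" and M R A :: real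
  assumes dim: "2 \<le> CARD('n)"
    and regular: "upper_regular \<sigma> A (real CARD('n) - 1)" and finite_\<sigma>: "finite_measure \<sigma>"
    and G: "open G" "bounded G" and S: "S \<subseteq> closure G" "S \<inter> G = {}" "AE y in \<sigma>. y \<in> S"
    and w [measurable]: "w \<in> borel_measurable borel" and M: "norm (w y) + \<rho> \<le> M" "0 < M"
    and R: "0 < R" "x \<in> G \<Longrightarrow> y \<in> S \<Longrightarrow> norm (x - y) \<le> R"
    and visible: "y \<in> S \<Longrightarrow> norm (v - w y) < \<rho> \<Longrightarrow> 0 < t \<Longrightarrow> t \<le> 1 \<Longrightarrow> y + t *\<^sub>R v \<in> G"
begin

lemma sets_\<sigma> [measurable_cong]: "sets \<sigma> = sets borel"
  using regular by (simp add: upper_regular_def)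

sublocale \<sigma>: finite_measure \<sigma> by (rule finite_\<sigma>)

sublocale P: pair_sigma_finite lborel \<sigma> ..

definition K :: "real^'n \<Rightarrow> real^'n \<Rightarrow> real^'n" where
  "K y x = kernel (w y) (x - y) *\<^sub>R (x - y)"

text \<open>The minus sign: \<open>K y\<close> carries mass from \<open>y\<close> into the domain,
  whereas a positive outward trace is an outflow.\<close>

definition lift :: "(real^'n \<Rightarrow> real) \<Rightarrow> real^'n \<Rightarrow> real^'n" where
  "lift g x = - (LINT y|\<sigma>. g y *\<^sub>R K y x)"

text \<open>The divergence of \<open>lift g\<close>, made of the masses in the balls. Its total
  balances the flux, which is why \<open>g\<close> need not have mean zero.\<close>

definition source :: "(real^'n \<Rightarrow> real) \<Rightarrow> real^'n \<Rightarrow> real" where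
  "source g x = (LINT y|\<sigma>. g y * \<theta> (x - y - w y))"

definition potential :: "real \<Rightarrow> (real^'n \<Rightarrow> real) \<Rightarrow> real^'n \<Rightarrow> ennreal" where
  "potential q g x = (\<integral>\<^sup>+ y. ennreal \<bar>g y\<bar> * ennreal (riesz q R (x - y)) \<partial>\<sigma>)"

lemma K_measurable [measurable (raw)]:
  assumes [measurable]: "f \<in> borel_measurable N" "h \<in> borel_measurable N"
  shows "(\<lambda>z. K (f z) (h z)) \<in> borel_measurable N"
  unfolding K_def by measurable

text \<open>The segments stay in \<open>G\<close>. Hence integrals over \<open>G\<close> extend to
  the whole space, where \<open>kernel_gradient\<close> applies.\<close>

lemma K_eq_0: "y \<in> S \<Longrightarrow> x \<notin> G \<Longrightarrow> K y x = 0"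
proof -
  assume yx: "y \<in> S" "x \<notin> G"
  have "kernel (w y) (x - y) = 0"
  proof (rule kernel_eq_0)
    fix t :: real and v :: "real^'n" assume "0 < t" "t \<le> 1" "norm (v - w y) < \<rho>"
    from visible[OF yx(1) this(3,1,2)] yx(2) show "x - y \<noteq> t *\<^sub>R v"
      by (metis add_diff_cancel_left' diff_add_cancel add.commute)
  qed
  then show ?thesis by (simp add: K_def)
qed

lemma K_le:
  assumes "y \<in> S" "x \<in> G"
  shows "norm (K y x) \<le> B * M ^ CARD('n) * riesz (real CARD('n) - 1) R (x - y)"
  unfolding K_def by (rule kernel_vector_le[OF M R(2)[OF assms(2,1)]])

text \<open>At a fixed point of \<open>G\<close> no singularity is met, because \<open>S\<close>
  keeps a distance \<open>e\<close> from it. The potentials serve for bounds up to the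
  boundary.\<close>

lemma integrable_lift:
  assumes g: "in_L2 \<sigma> g" and x: "x \<in> G"
  shows "integrable \<sigma> (\<lambda>y. g y *\<^sub>R K y x)"
proof -
  have [measurable]: "g \<in> borel_measurable borel" using in_L2_measurable[OF g] by simp
  obtain e where e: "0 < e" "ball x e \<subseteq> G" using G(1) x open_contains_ball by blast
  let ?c = "B * M ^ CARD('n) * e powr (- (real CARD('n) - 1))"
  show ?thesis
  proof (rule Bochner_Integration.integrable_bound)
    show "integrable \<sigma> (\<lambda>y. ?c * g y)"
      using in_L2_integrable[OF finite_\<sigma> g] by simp
    show "AE y in \<sigma>. norm (g y *\<^sub>R K y x) \<le> norm (?c * g y)"
      using S(3)
    proof eventually_elim
      case (elim y)
      then have "y \<notin> ball x e" using e S(2) by blast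
      then have "e \<le> norm (x - y)" by (simp add: dist_norm)
      then have "riesz (real CARD('n) - 1) R (x - y) \<le> e powr (- (real CARD('n) - 1))"
        using e(1) dim by (auto simp: riesz_def intro!: powr_mono2')
      then have "norm (K y x) \<le> ?c"
        using K_le[OF elim x] B_nonneg M(2)
        by (elim order_trans) (intro mult_left_mono, auto)
      from mult_left_mono[OF this abs_ge_zero[of "g y"]] show ?case
        using B_nonneg M(2) by (simp add: abs_mult mult_ac)
    qed
  qed measurable
qed

lemma lift_measurable:
  assumes g: "in_L2 \<sigma> g"
  shows "lift g \<in> borel_measurable borel"
proof -
  have [measurable]: "g \<in> borel_measurable borel" using in_L2_measurable[OF g] by simp
  show ?thesis unfolding lift_def by measurable
qed

lemma potential_measurable:
  assumes g: "in_L2 \<sigma> g"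
  shows "potential q g \<in> borel_measurable borel"
proof -
  have [measurable]: "g \<in> borel_measurable borel" using in_L2_measurable[OF g] by simp
  show ?thesis unfolding potential_def by measurable
qed

lemma lift_le_potential:
  assumes g: "in_L2 \<sigma> g" and x: "x \<in> G"
  shows "ennreal (norm (lift g x)) \<le> ennreal (B * M ^ CARD('n)) * potential (real CARD('n) - 1) g x"
proof -
  have [measurable]: "g \<in> borel_measurable borel" using in_L2_measurable[OF g] by simp
  have "ennreal (norm (lift g x)) \<le> (\<integral>\<^sup>+ y. ennreal (norm (g y *\<^sub>R K y x)) \<partial>\<sigma>)"
    unfolding lift_def norm_minus_cancel by (intro integral_norm_bound_ennreal integrable_lift g x)
  also have "\<dots> \<le> (\<integral>\<^sup>+ y. ennreal (B * M ^ CARD('n)) * (ennreal \<bar>g y\<bar> * ennreal (riesz (real CARD('n) - 1) R (x - y))) \<partial>\<sigma>)"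
  proof (rule nn_integral_mono_AE)
    show "AE y in \<sigma>. ennreal (norm (g y *\<^sub>R K y x)) \<le>
        ennreal (B * M ^ CARD('n)) * (ennreal \<bar>g y\<bar> * ennreal (riesz (real CARD('n) - 1) R (x - y)))"
      using S(3)
    proof eventually_elim
      case (elim y)
      have "norm (g y *\<^sub>R K y x) \<le> (B * M ^ CARD('n)) * (\<bar>g y\<bar> * riesz (real CARD('n) - 1) R (x - y))"
        using mult_left_mono[OF K_le[OF elim x] abs_ge_zero[of "g y"]] by (simp add: mult_ac)
      then show ?case
        using B_nonneg M(2) by (simp add: ennreal_mult[symmetric] ennreal_leI)
    qed
  qed
  also have "\<dots> = ennreal (B * M ^ CARD('n)) * potential (real CARD('n) - 1) g x"
    unfolding potential_def by (rule nn_integral_cmult) measurable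
  finally show ?thesis .
qed

lemma lift_holder:
  assumes g: "in_L2 \<sigma> g" and x: "x \<in> G" "x' \<in> G"
  defines "C \<equiv> L * M ^ Suc CARD('n) + 2 * (B * M ^ CARD('n))"
  shows "ennreal (norm (lift g x - lift g x')) \<le> ennreal (C * norm (x - x') powr (1/4)) *
    (potential (real CARD('n) - 3/4) g x + potential (real CARD('n) - 3/4) g x')"
proof -
  have [measurable]: "g \<in> borel_measurable borel" using in_L2_measurable[OF g] by simp
  have C: "0 \<le> C" using L_nonneg B_nonneg M by (auto simp: C_def)
  let ?r = "\<lambda>x y. riesz (real CARD('n) - 3/4) R (x - y)"
  have "ennreal (norm (lift g x - lift g x')) = ennreal (norm (LINT y|\<sigma>. g y *\<^sub>R K y x - g y *\<^sub>R K y x'))"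
    unfolding lift_def using integrable_lift[OF g x(1)] integrable_lift[OF g x(2)]
    by (simp add: norm_minus_commute)
  also have "\<dots> \<le> (\<integral>\<^sup>+ y. ennreal (norm (g y *\<^sub>R K y x - g y *\<^sub>R K y x')) \<partial>\<sigma>)"
    by (intro integral_norm_bound_ennreal Bochner_Integration.integrable_diff integrable_lift g x)
  also have "\<dots> \<le> (\<integral>\<^sup>+ y. ennreal (C * norm (x - x') powr (1/4)) *
      (ennreal \<bar>g y\<bar> * ennreal (?r x y) + ennreal \<bar>g y\<bar> * ennreal (?r x' y)) \<partial>\<sigma>)"
  proof (rule nn_integral_mono_AE)
    show "AE y in \<sigma>. ennreal (norm (g y *\<^sub>R K y x - g y *\<^sub>R K y x')) \<le>
        ennreal (C * norm (x - x') powr (1/4)) *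
        (ennreal \<bar>g y\<bar> * ennreal (?r x y) + ennreal \<bar>g y\<bar> * ennreal (?r x' y))"
      using S(3)
    proof eventually_elim
      case (elim y)
      have ne: "x - y \<noteq> 0" "x' - y \<noteq> 0" using elim x S(2) by auto
      have "norm (K y x - K y x') \<le> C * norm (x - x') powr (1/4) * (?r x y + ?r x' y)"
        using kernel_vector_holder[OF M(1)[of y] M(2) ne R(2)[OF x(1) elim] R(2)[OF x(2) elim]]
        by (simp add: K_def C_def)
      from mult_left_mono[OF this abs_ge_zero[of "g y"]]
      have "\<bar>g y\<bar> * norm (K y x - K y x') \<le>
          (C * norm (x - x') powr (1/4)) * (\<bar>g y\<bar> * ?r x y + \<bar>g y\<bar> * ?r x' y)"
        by (simp add: algebra_simps)
      moreover have "norm (g y *\<^sub>R K y x - g y *\<^sub>R K y x') = \<bar>g y\<bar> * norm (K y x - K y x')"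
        by (simp add: scaleR_diff_right[symmetric])
      ultimately have "norm (g y *\<^sub>R K y x - g y *\<^sub>R K y x') \<le>
          (C * norm (x - x') powr (1/4)) * (\<bar>g y\<bar> * ?r x y + \<bar>g y\<bar> * ?r x' y)" by simp
      then show ?case
        using C by (simp add: ennreal_mult[symmetric] ennreal_plus[symmetric] ennreal_leI del: ennreal_plus)
    qed
  qed
  also have "\<dots> = ennreal (C * norm (x - x') powr (1/4)) *
    (potential (real CARD('n) - 3/4) g x + potential (real CARD('n) - 3/4) g x')"
    unfolding potential_def by (subst nn_integral_cmult; (subst nn_integral_add)?) measurable
  finally show ?thesis .
qed

text \<open>The field is dominated by a potential of order d - 1, its increments by
  \<open>norm (x - x') powr (1/4)\<close> times potentials of order d - 3/4; both orders satisfy 2 q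
  < 2 d - 1 as Schur's test requires. In the seminorm the squared increment takes 1/2 off the weight
  d + 1/4, and the remaining order d - 1/4 is integrable over the volume.\<close>

lemma lift_bounds:
  obtains C where "0 \<le> C"
    "\<And>g. in_L2 \<sigma> g \<Longrightarrow> (\<integral>\<^sup>+ x. ennreal ((norm (lift g x))\<^sup>2) \<partial>vol G) \<le> ennreal C * (\<integral>\<^sup>+ y. ennreal ((g y)\<^sup>2) \<partial>\<sigma>)"
    "\<And>g. in_L2 \<sigma> g \<Longrightarrow> slobodeckij G (1/8) (lift g) \<le> ennreal C * (\<integral>\<^sup>+ y. ennreal ((g y)\<^sup>2) \<partial>\<sigma>)"
proof -
  define d where "d = real CARD('n)"
  have d: "2 \<le> d" using dim by (simp add: d_def)
  have reg: "upper_regular \<sigma> A (d - 1)" using regular by (simp add: d_def)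
  obtain C1 where C1: "0 \<le> C1" "\<And>g :: real^'n \<Rightarrow> real. g \<in> borel_measurable borel \<Longrightarrow>
      (\<integral>\<^sup>+ x. (potential (d - 1) g x)\<^sup>2 \<partial>lborel) \<le> ennreal C1 * (\<integral>\<^sup>+ y. ennreal ((g y)\<^sup>2) \<partial>\<sigma>)"
    unfolding potential_def using riesz_potential_bounded[OF reg finite_\<sigma>, of "d - 1" R] d R(1)
    by (auto simp: d_def)
  obtain C2 where C2: "0 \<le> C2" "\<And>g :: real^'n \<Rightarrow> real. g \<in> borel_measurable borel \<Longrightarrow>
      (\<integral>\<^sup>+ x. (potential (d - 3/4) g x)\<^sup>2 \<partial>lborel) \<le> ennreal C2 * (\<integral>\<^sup>+ y. ennreal ((g y)\<^sup>2) \<partial>\<sigma>)"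
    unfolding potential_def using riesz_potential_bounded[OF reg finite_\<sigma>, of "d - 3/4" R] d R(1)
    by (auto simp: d_def)
  \<comment> \<open>At least the diameter of \<open>G\<close>, so truncating at \<open>R'\<close>
    changes nothing for pairs of points of \<open>G\<close>.\<close>
  obtain R' where R': "0 < R'" "\<And>x y. x \<in> G \<Longrightarrow> y \<in> G \<Longrightarrow> norm (x - y) \<le> R'"
  proof -
    obtain r where r: "\<And>x. x \<in> G \<Longrightarrow> norm x \<le> r" using G(2) by (auto simp: bounded_iff)
    have "norm (x - y) \<le> \<bar>2 * r\<bar> + 1" if "x \<in> G" "y \<in> G" for x y
      using r[OF that(1)] r[OF that(2)] norm_triangle_ineq4[of x y] by linarith
    then show ?thesis by (intro that[of "\<bar>2 * r\<bar> + 1"]) auto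
  qed
  obtain C3 where C3: "0 \<le> C3" "\<And>x :: real^'n. (\<integral>\<^sup>+ y. ennreal (riesz (d - 1/4) R' (x - y)) \<partial>lborel) \<le> ennreal C3"
  proof -
    have "0 \<le> d - 1/4" "d - 1/4 < real DIM(real^'n)" using d by (auto simp: d_def)
    from nn_integral_riesz_bounded[OF upper_regular_lborel this R'(1)] that show ?thesis by blast
  qed
  define c1 where "c1 = B * M ^ CARD('n)"
  define c2 where "c2 = L * M ^ Suc CARD('n) + 2 * (B * M ^ CARD('n))"
  have c: "0 \<le> c1" "0 \<le> c2" using L_nonneg B_nonneg M by (auto simp: c1_def c2_def)
  \<comment> \<open>One summand for the L2 bound, one for the seminorm. The 4 is a 2 from squaring a
    sum times a 2 from two integrals with the same bound.\<close>
  define C where "C = c1\<^sup>2 * C1 + 4 * c2\<^sup>2 * C3 * C2"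
  have C: "0 \<le> C" "c1\<^sup>2 * C1 \<le> C" "4 * c2\<^sup>2 * C3 * C2 \<le> C" using C1 C2 C3 by (auto simp: C_def)
  show ?thesis
  proof (rule that[OF C(1)])
    fix g :: "real^'n \<Rightarrow> real" assume g: "in_L2 \<sigma> g"
    have [measurable]: "g \<in> borel_measurable borel" using in_L2_measurable[OF g] by simp
    note [measurable] = lift_measurable[OF g] potential_measurable[OF g]
    have Gb [measurable]: "G \<in> sets borel" using G by simp
    let ?g2 = "\<integral>\<^sup>+ y. ennreal ((g y)\<^sup>2) \<partial>\<sigma>"
    have "(\<integral>\<^sup>+ x. ennreal ((norm (lift g x))\<^sup>2) \<partial>vol G) \<le>
        (\<integral>\<^sup>+ x. ennreal (c1\<^sup>2) * (potential (d - 1) g x)\<^sup>2 \<partial>lborel)"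
    proof (subst nn_integral_restrict_space)
      show "(\<integral>\<^sup>+ x. ennreal ((norm (lift g x))\<^sup>2) * indicator G x \<partial>lborel) \<le>
          (\<integral>\<^sup>+ x. ennreal (c1\<^sup>2) * (potential (d - 1) g x)\<^sup>2 \<partial>lborel)"
      proof (rule nn_integral_mono)
        fix x
        show "ennreal ((norm (lift g x))\<^sup>2) * indicator G x \<le> ennreal (c1\<^sup>2) * (potential (d - 1) g x)\<^sup>2"
        proof (cases "x \<in> G")
          case True
          have "(ennreal (norm (lift g x)))\<^sup>2 \<le> (ennreal c1 * potential (d - 1) g x)\<^sup>2"
            using lift_le_potential[OF g True] by (intro power_mono) (auto simp: c1_def d_def)
          then show ?thesis using True c by (simp add: ennreal_power power_mult_distrib)
        qed simp
      qed
    qed simp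
    also have "\<dots> = ennreal (c1\<^sup>2) * (\<integral>\<^sup>+ x. (potential (d - 1) g x)\<^sup>2 \<partial>lborel)"
      by (rule nn_integral_cmult) measurable
    also have "\<dots> \<le> ennreal (c1\<^sup>2) * (ennreal C1 * ?g2)" by (intro mult_left_mono C1) auto
    also have "\<dots> = ennreal (c1\<^sup>2 * C1) * ?g2" using C1 by (simp add: ennreal_mult mult.assoc)
    also have "\<dots> \<le> ennreal C * ?g2" using C by (intro mult_right_mono ennreal_leI) auto
    finally show "(\<integral>\<^sup>+ x. ennreal ((norm (lift g x))\<^sup>2) \<partial>vol G) \<le> ennreal C * ?g2" .
    define T where "T = potential (d - 3/4) g"
    have [measurable]: "T \<in> borel_measurable borel" unfolding T_def by measurable
    define r where "r = (\<lambda>x y :: real^'n. riesz (d - 1/4) R' (x - y))"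
    have [measurable]: "(\<lambda>(x, y). r x y) \<in> borel_measurable (borel \<Otimes>\<^sub>M borel)"
      unfolding r_def by measurable
    have pw: "ennreal ((norm (lift g x - lift g y))\<^sup>2 / norm (x - y) powr (d + 2 * (1/8))) \<le>
        ennreal (2 * c2\<^sup>2) * (ennreal (r x y) * (T x)\<^sup>2 + ennreal (r x y) * (T y)\<^sup>2)"
      if xy: "x \<in> G" "y \<in> G" for x y
    proof (cases "x = y")
      case False
      have "ennreal ((norm (lift g x - lift g y))\<^sup>2) = (ennreal (norm (lift g x - lift g y)))\<^sup>2"
        by (simp add: ennreal_power)
      also have "\<dots> \<le> (ennreal (c2 * norm (x - y) powr (1/4)) * (T x + T y))\<^sup>2"
        using lift_holder[OF g xy] by (intro power_mono) (auto simp: c2_def d_def T_def)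
      also have "\<dots> = ennreal (c2\<^sup>2 * norm (x - y) powr (1/2)) * (T x + T y)\<^sup>2"
      proof -
        have "(norm (x - y) powr (1/4))\<^sup>2 = norm (x - y) powr (1/2)"
          by (simp add: power2_eq_square powr_add[symmetric])
        then show ?thesis using c by (simp add: power_mult_distrib ennreal_power)
      qed
      finally have 1: "ennreal ((norm (lift g x - lift g y))\<^sup>2) \<le>
          ennreal (c2\<^sup>2 * norm (x - y) powr (1/2)) * (T x + T y)\<^sup>2" .
      have "ennreal ((norm (lift g x - lift g y))\<^sup>2 / norm (x - y) powr (d + 2 * (1/8))) =
          ennreal (norm (x - y) powr (- (d + 1/4))) * ennreal ((norm (lift g x - lift g y))\<^sup>2)"
      proof -
        have "z / norm (x - y) powr (d + 2 * (1/8)) = norm (x - y) powr (- (d + 1/4)) * z" for z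
          unfolding powr_minus_divide by simp
        then show ?thesis by (simp add: ennreal_mult)
      qed
      also have "\<dots> \<le> ennreal (norm (x - y) powr (- (d + 1/4))) *
          (ennreal (c2\<^sup>2 * norm (x - y) powr (1/2)) * (T x + T y)\<^sup>2)"
        by (intro mult_left_mono 1) auto
      also have "\<dots> = ennreal (c2\<^sup>2 * (norm (x - y) powr (- (d + 1/4)) * norm (x - y) powr (1/2))) * (T x + T y)\<^sup>2"
      proof -
        have "ennreal a * (ennreal (e * b) * X) = ennreal (e * (a * b)) * X" if "0 \<le> a" "0 \<le> b" "0 \<le> e" for a b e X
          using that by (simp add: ennreal_mult mult.assoc mult.left_commute)
        then show ?thesis by simp
      qed
      also have "norm (x - y) powr (- (d + 1/4)) * norm (x - y) powr (1/2) = r x y"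
        using R'(2)[OF xy] by (simp add: r_def riesz_def powr_add[symmetric])
      also have "ennreal (c2\<^sup>2 * r x y) * (T x + T y)\<^sup>2 \<le> ennreal (c2\<^sup>2 * r x y) * (2 * ((T x)\<^sup>2 + (T y)\<^sup>2))"
        by (intro mult_left_mono ennreal_power2_sum_le) auto
      also have "\<dots> = ennreal (2 * c2\<^sup>2) * (ennreal (r x y) * (T x)\<^sup>2 + ennreal (r x y) * (T y)\<^sup>2)"
        by (simp add: ennreal_mult r_def distrib_left mult_ac)
      finally show ?thesis .
    qed simp
    have I1: "(\<integral>\<^sup>+ x. \<integral>\<^sup>+ y. ennreal (r x y) * (T x)\<^sup>2 \<partial>lborel \<partial>lborel) \<le> ennreal (C3 * C2) * ?g2"
    proof -
      have "(\<integral>\<^sup>+ x. \<integral>\<^sup>+ y. ennreal (r x y) * (T x)\<^sup>2 \<partial>lborel \<partial>lborel) =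
          (\<integral>\<^sup>+ x. (\<integral>\<^sup>+ y. ennreal (r x y) \<partial>lborel) * (T x)\<^sup>2 \<partial>lborel)"
        by (intro nn_integral_cong nn_integral_multc) measurable
      also have "\<dots> \<le> (\<integral>\<^sup>+ x. ennreal C3 * (T x)\<^sup>2 \<partial>lborel)"
        unfolding r_def by (intro nn_integral_mono mult_right_mono C3) auto
      also have "\<dots> = ennreal C3 * (\<integral>\<^sup>+ x. (T x)\<^sup>2 \<partial>lborel)" by (rule nn_integral_cmult) measurable
      also have "\<dots> \<le> ennreal C3 * (ennreal C2 * ?g2)"
        unfolding T_def by (intro mult_left_mono C2) auto
      finally show ?thesis using C2 C3 by (simp add: ennreal_mult mult.assoc)
    qed
    \<comment> \<open>By symmetry of \<open>r\<close> this is the previous integral with the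
      variables exchanged.\<close>
    have "(\<integral>\<^sup>+ x. \<integral>\<^sup>+ y. ennreal (r x y) * (T y)\<^sup>2 \<partial>lborel \<partial>lborel) =
        (\<integral>\<^sup>+ y. \<integral>\<^sup>+ x. ennreal (r x y) * (T y)\<^sup>2 \<partial>lborel \<partial>lborel)"
      by (rule lborel_pair.Fubini'[symmetric]) measurable
    also have "\<dots> = (\<integral>\<^sup>+ x. \<integral>\<^sup>+ y. ennreal (r x y) * (T x)\<^sup>2 \<partial>lborel \<partial>lborel)"
    proof -
      have "r x y = r y x" for x y unfolding r_def by (rule riesz_commute)
      then show ?thesis by presburger
    qed
    finally have I2: "(\<integral>\<^sup>+ x. \<integral>\<^sup>+ y. ennreal (r x y) * (T y)\<^sup>2 \<partial>lborel \<partial>lborel) \<le> ennreal (C3 * C2) * ?g2"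
      using I1 by simp
    have "slobodeckij G (1/8) (lift g) = (\<integral>\<^sup>+ x. (\<integral>\<^sup>+ y.
        ennreal ((norm (lift g x - lift g y))\<^sup>2 / norm (x - y) powr (d + 2 * (1/8))) * indicator G y \<partial>lborel) * indicator G x \<partial>lborel)"
      unfolding slobodeckij_def d_def by (subst nn_integral_restrict_space; simp)+
    also have "\<dots> \<le> (\<integral>\<^sup>+ x. \<integral>\<^sup>+ y.
        ennreal (2 * c2\<^sup>2) * (ennreal (r x y) * (T x)\<^sup>2 + ennreal (r x y) * (T y)\<^sup>2) \<partial>lborel \<partial>lborel)"
    proof (rule nn_integral_mono)
      fix x
      show "(\<integral>\<^sup>+ y. ennreal ((norm (lift g x - lift g y))\<^sup>2 / norm (x - y) powr (d + 2 * (1/8))) * indicator G y \<partial>lborel) * indicator G x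
        \<le> (\<integral>\<^sup>+ y. ennreal (2 * c2\<^sup>2) * (ennreal (r x y) * (T x)\<^sup>2 + ennreal (r x y) * (T y)\<^sup>2) \<partial>lborel)"
      proof (cases "x \<in> G")
        case True
        then show ?thesis using pw[OF True] by (auto intro!: nn_integral_mono simp: indicator_def)
      qed simp
    qed
    also have "\<dots> = ennreal (2 * c2\<^sup>2) * ((\<integral>\<^sup>+ x. \<integral>\<^sup>+ y. ennreal (r x y) * (T x)\<^sup>2 \<partial>lborel \<partial>lborel) +
        (\<integral>\<^sup>+ x. \<integral>\<^sup>+ y. ennreal (r x y) * (T y)\<^sup>2 \<partial>lborel \<partial>lborel))"
      by (simp add: nn_integral_cmult nn_integral_add)
    also have "\<dots> \<le> ennreal (2 * c2\<^sup>2) * (ennreal (C3 * C2) * ?g2 + ennreal (C3 * C2) * ?g2)"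
      by (intro mult_left_mono add_mono I1 I2) auto
    also have "\<dots> = ennreal (4 * c2\<^sup>2 * C3 * C2) * ?g2"
    proof -
      have "4 * c2\<^sup>2 * C3 * C2 = (2 * c2\<^sup>2) * (C3 * C2 + C3 * C2)" by simp
      then have "ennreal (4 * c2\<^sup>2 * C3 * C2) = ennreal (2 * c2\<^sup>2) * ennreal (C3 * C2 + C3 * C2)"
        using C2(1) C3(1) by (simp only: ennreal_mult mult_nonneg_nonneg add_nonneg_nonneg zero_le_power2 zero_le_numeral)
      also have "ennreal (C3 * C2 + C3 * C2) = ennreal (C3 * C2) + ennreal (C3 * C2)"
        using C2(1) C3(1) by (intro ennreal_plus) auto
      finally show ?thesis by (simp only: distrib_right mult.assoc)
    qed
    also have "\<dots> \<le> ennreal C * ?g2" using C by (intro mult_right_mono ennreal_leI) auto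
    finally show "slobodeckij G (1/8) (lift g) \<le> ennreal C * ?g2" .
  qed
qed

end

section \<open>Divergence and boundary values of the lifted field\<close>

context surface_lift
begin

text \<open>Superposition of \<open>kernel_gradient\<close>. The test function is not assumed to
  vanish on \<open>S\<close>: the term with \<open>g\<close> is the normal trace, and it drops out
  for tests supported in \<open>G\<close>, so one identity yields both the divergence and the
  boundary values.\<close>

lemma lift_gradient:
  assumes g: "in_L2 \<sigma> g" and \<phi>: "C1 \<phi> D\<phi>"
  shows "(LINT x|vol G. lift g x \<bullet> D\<phi> x) =
    (LINT y|\<sigma>. g y * \<phi> y) - (LINT x|vol G. source g x * \<phi> x)"
proof -
  have [measurable]: "g \<in> borel_measurable borel" using in_L2_measurable[OF g] by simp
  note [measurable] = C1_measurable[OF \<phi>]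
  have Gb [measurable]: "G \<in> sets borel" using G by simp
  have "compact (closure G)" using G by simp
  then have "bounded (D\<phi> ` closure G)" "bounded (\<phi> ` closure G)"
    using C1_continuous[OF \<phi>]
    by (auto intro!: compact_imp_bounded compact_continuous_image intro: continuous_on_subset)
  then obtain P Q where P: "\<And>x. x \<in> closure G \<Longrightarrow> norm (D\<phi> x) \<le> P"
    and Q: "\<And>x. x \<in> closure G \<Longrightarrow> norm (\<phi> x) \<le> Q" unfolding bounded_iff by blast
  have gint: "integrable \<sigma> g" by (rule in_L2_integrable[OF finite_\<sigma> g])
  then have gfin: "(\<integral>\<^sup>+ y. ennreal \<bar>g y\<bar> \<partial>\<sigma>) < \<infinity>" by (simp add: integrable_iff_bounded)
  define d where "d = real CARD('n)"
  have d: "0 \<le> d - 1" "d - 1 < real DIM(real^'n)" using dim by (auto simp: d_def)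
  obtain C where C: "0 \<le> C" "\<And>x :: real^'n. (\<integral>\<^sup>+ y. ennreal (riesz (d - 1) R (x - y)) \<partial>lborel) \<le> ennreal C"
    using nn_integral_riesz_bounded[OF upper_regular_lborel d R(1)] by blast
  define c where "c = B * M ^ CARD('n) * \<bar>P\<bar>"
  have c: "0 \<le> c" using B_nonneg M by (simp add: c_def)
  define H where "H = (\<lambda>(x, y). indicator G x * (g y * (K y x \<bullet> D\<phi> x)))"
  have mH [measurable]: "H \<in> borel_measurable (lborel \<Otimes>\<^sub>M \<sigma>)" unfolding H_def by measurable
  have H_le: "\<bar>H (x, y)\<bar> \<le> \<bar>g y\<bar> * (c * riesz (d - 1) R (x - y))" if "y \<in> S" for x y
  proof (cases "x \<in> G")
    case True
    have "\<bar>K y x \<bullet> D\<phi> x\<bar> \<le> norm (K y x) * norm (D\<phi> x)" by (rule Cauchy_Schwarz_ineq2)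
    also have "\<dots> \<le> (B * M ^ CARD('n) * riesz (d - 1) R (x - y)) * \<bar>P\<bar>"
    proof (rule mult_mono)
      show "norm (K y x) \<le> B * M ^ CARD('n) * riesz (d - 1) R (x - y)"
        unfolding d_def by (rule K_le[OF that True])
      have "x \<in> closure G" using True closure_subset by blast
      from P[OF this] show "norm (D\<phi> x) \<le> \<bar>P\<bar>" by linarith
    qed (use B_nonneg M in auto)
    finally have "\<bar>g y\<bar> * \<bar>K y x \<bullet> D\<phi> x\<bar> \<le> \<bar>g y\<bar> * ((B * M ^ CARD('n) * riesz (d - 1) R (x - y)) * \<bar>P\<bar>)"
      by (intro mult_left_mono) auto
    then show ?thesis using True by (simp add: H_def abs_mult c_def mult_ac)
  next
    case False
    then show ?thesis using c by (simp add: H_def)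
  qed
  have "(\<integral>\<^sup>+ x. \<integral>\<^sup>+ y. ennreal (norm (H (x, y))) \<partial>\<sigma> \<partial>lborel) =
      (\<integral>\<^sup>+ y. \<integral>\<^sup>+ x. ennreal (norm (H (x, y))) \<partial>lborel \<partial>\<sigma>)"
    by (rule P.Fubini'[symmetric]) measurable
  \<comment> \<open>With the order exchanged, the kernel is first integrated over the volume, where
    order d - 1 is harmless uniformly in \<open>y\<close>; the L1 norm of \<open>g\<close>
    remains.\<close>
  also have "\<dots> \<le> (\<integral>\<^sup>+ y. ennreal \<bar>g y\<bar> * ennreal (c * C) \<partial>\<sigma>)"
  proof (rule nn_integral_mono_AE)
    show "AE y in \<sigma>. (\<integral>\<^sup>+ x. ennreal (norm (H (x, y))) \<partial>lborel) \<le> ennreal \<bar>g y\<bar> * ennreal (c * C)"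
      using S(3)
    proof eventually_elim
      case (elim y)
      have "(\<integral>\<^sup>+ x. ennreal (norm (H (x, y))) \<partial>lborel) \<le>
          (\<integral>\<^sup>+ x. ennreal (\<bar>g y\<bar> * c) * ennreal (riesz (d - 1) R (y - x)) \<partial>lborel)"
        using H_le[OF elim] c
        by (intro nn_integral_mono)
          (auto simp: ennreal_mult[symmetric] riesz_commute[of _ _ y] mult.assoc intro!: ennreal_leI)
      also have "\<dots> = ennreal (\<bar>g y\<bar> * c) * (\<integral>\<^sup>+ x. ennreal (riesz (d - 1) R (y - x)) \<partial>lborel)"
        by (rule nn_integral_cmult) measurable
      also have "\<dots> \<le> ennreal (\<bar>g y\<bar> * c) * ennreal C" by (intro mult_left_mono C) auto
      also have "\<dots> = ennreal \<bar>g y\<bar> * ennreal (c * C)" using c C by (simp add: ennreal_mult mult.assoc)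
      finally show ?case .
    qed
  qed
  also have "\<dots> = (\<integral>\<^sup>+ y. ennreal \<bar>g y\<bar> \<partial>\<sigma>) * ennreal (c * C)"
    by (rule nn_integral_multc) measurable
  also have "\<dots> < \<infinity>" using gfin by (simp add: ennreal_mult_less_top)
  finally have intH: "integrable (lborel \<Otimes>\<^sub>M \<sigma>) H"
    by (intro integrable_pairI \<sigma>.sigma_finite_measure_axioms mH)
  define m where "m = (\<lambda>y. LINT x|lborel. \<theta> (x - y - w y) * \<phi> x)"
  have m [measurable]: "m \<in> borel_measurable borel" unfolding m_def by measurable
  \<comment> \<open>Visibility at \<open>t = 1\<close>: the mass arrives inside \<open>G\<close>, so
    cutting \<open>J\<close> off to \<open>G\<close> loses nothing.\<close>
  have \<theta>G: "x \<in> G" if "y \<in> S" "\<theta> (x - y - w y) \<noteq> 0" for x y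
  proof -
    have "norm (x - y - w y) < \<rho>" using support[of "x - y - w y"] that(2) not_le by blast
    from visible[OF that(1) this, of 1] show ?thesis by simp
  qed
  have th1: "(\<integral>\<^sup>+ x. ennreal (\<theta> (x - y - w y)) \<partial>lborel) = 1" for y
    using nn_integral[of "y + w y"] by (simp add: algebra_simps)
  have inner: "(LINT x|lborel. H (x, y)) = g y * (m y - \<phi> y)" if y: "y \<in> S" for y
  proof -
    have "(LINT x|lborel. H (x, y)) = (LINT x|lborel. g y * (K y x \<bullet> D\<phi> x))"
      using K_eq_0[OF y] by (intro Bochner_Integration.integral_cong) (auto simp: H_def indicator_def)
    also have "\<dots> = g y * (LINT x|lborel. K y x \<bullet> D\<phi> x)" by simp
    also have "(LINT x|lborel. K y x \<bullet> D\<phi> x) = (LINT u|lborel. (kernel (w y) u *\<^sub>R u) \<bullet> D\<phi> (y + u))"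
      by (subst lborel_translate[where a=y]) (auto simp: K_def)
    also have "\<dots> = (LINT v|lborel. \<theta> (v - w y) * \<phi> (y + v)) - \<phi> y"
      by (rule kernel_gradient[OF M \<phi>])
    also have "(LINT v|lborel. \<theta> (v - w y) * \<phi> (y + v)) = m y"
      unfolding m_def by (subst (2) lborel_translate[where a=y]) auto
    finally show ?thesis .
  qed
  define J where "J = (\<lambda>(x, y). indicator G x * (g y * (\<theta> (x - y - w y) * \<phi> x)))"
  have mJ [measurable]: "J \<in> borel_measurable (lborel \<Otimes>\<^sub>M \<sigma>)" unfolding J_def by measurable
  have \<phi>G: "\<bar>\<phi> x\<bar> \<le> \<bar>Q\<bar>" if "x \<in> closure G" for x using Q[OF that] by simp
  have "(\<integral>\<^sup>+ x. \<integral>\<^sup>+ y. ennreal (norm (J (x, y))) \<partial>\<sigma> \<partial>lborel) =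
      (\<integral>\<^sup>+ y. \<integral>\<^sup>+ x. ennreal (norm (J (x, y))) \<partial>lborel \<partial>\<sigma>)"
    by (rule P.Fubini'[symmetric]) measurable
  also have "\<dots> \<le> (\<integral>\<^sup>+ y. \<integral>\<^sup>+ x. ennreal (\<bar>g y\<bar> * \<bar>Q\<bar>) * ennreal (\<theta> (x - y - w y)) \<partial>lborel \<partial>\<sigma>)"
  proof (intro nn_integral_mono)
    fix x y
    have "norm (J (x, y)) \<le> \<bar>g y\<bar> * \<bar>Q\<bar> * \<theta> (x - y - w y)"
    proof (cases "x \<in> G")
      case True
      then have "\<bar>\<phi> x\<bar> \<le> \<bar>Q\<bar>" using \<phi>G closure_subset by blast
      then have "\<bar>g y\<bar> * \<theta> (x - y - w y) * \<bar>\<phi> x\<bar> \<le> \<bar>g y\<bar> * \<theta> (x - y - w y) * \<bar>Q\<bar>"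
        by (intro mult_left_mono mult_nonneg_nonneg nonneg) auto
      then show ?thesis using True by (simp add: J_def abs_mult nonneg mult_ac)
    qed (simp add: J_def nonneg)
    then show "ennreal (norm (J (x, y))) \<le> ennreal (\<bar>g y\<bar> * \<bar>Q\<bar>) * ennreal (\<theta> (x - y - w y))"
      by (simp add: ennreal_mult[symmetric] nonneg ennreal_leI)
  qed
  also have "\<dots> = (\<integral>\<^sup>+ y. ennreal (\<bar>g y\<bar> * \<bar>Q\<bar>) \<partial>\<sigma>)"
    by (simp add: nn_integral_cmult th1)
  also have "\<dots> = (\<integral>\<^sup>+ y. ennreal \<bar>g y\<bar> \<partial>\<sigma>) * ennreal \<bar>Q\<bar>"
    by (simp add: ennreal_mult nn_integral_multc)
  also have "\<dots> < \<infinity>" using gfin by (simp add: ennreal_mult_less_top)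
  finally have intJ: "integrable (lborel \<Otimes>\<^sub>M \<sigma>) J"
    by (intro integrable_pairI \<sigma>.sigma_finite_measure_axioms mJ)
  have innerJ: "(LINT x|lborel. J (x, y)) = g y * m y" if y: "y \<in> S" for y
  proof -
    have "(LINT x|lborel. J (x, y)) = (LINT x|lborel. g y * (\<theta> (x - y - w y) * \<phi> x))"
      using \<theta>G[OF y] by (intro Bochner_Integration.integral_cong) (auto simp: J_def indicator_def)
    then show ?thesis by (simp add: m_def)
  qed
  have AES: "AE y in \<sigma>. (LINT x|lborel. H (x, y)) = g y * (m y - \<phi> y)"
    "AE y in \<sigma>. (LINT x|lborel. J (x, y)) = g y * m y"
    using S(3) inner innerJ by (auto elim!: AE_mp)
  have int_g\<phi>: "integrable \<sigma> (\<lambda>y. g y * \<phi> y)"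
  proof (rule Bochner_Integration.integrable_bound)
    show "integrable \<sigma> (\<lambda>y. \<bar>Q\<bar> * g y)" using gint by simp
    show "AE y in \<sigma>. norm (g y * \<phi> y) \<le> norm (\<bar>Q\<bar> * g y)"
      using S(3)
    proof eventually_elim
      case (elim y)
      then have "\<bar>\<phi> y\<bar> \<le> \<bar>Q\<bar>" using \<phi>G S(1) by blast
      from mult_left_mono[OF this, of "\<bar>g y\<bar>"] show ?case by (simp add: abs_mult mult.commute)
    qed
  qed measurable
  have int_gm: "integrable \<sigma> (\<lambda>y. g y * m y)"
  proof -
    have "integrable \<sigma> (\<lambda>y. LINT x|lborel. J (x, y))"
      using P.integrable_snd[of "\<lambda>x y. J (x, y)"] intJ by (simp add: case_prod_beta')
    then show ?thesis
      by (rule integrable_cong_AE_imp[OF _ _ AES(2)]) measurable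
  qed
  have "(LINT x|vol G. lift g x \<bullet> D\<phi> x) = - (LINT x|lborel. LINT y|\<sigma>. H (x, y))"
  proof -
    have "indicator G x *\<^sub>R (lift g x \<bullet> D\<phi> x) = - (LINT y|\<sigma>. H (x, y))" for x
    proof (cases "x \<in> G")
      case True
      have "lift g x \<bullet> D\<phi> x = - (LINT y|\<sigma>. (g y *\<^sub>R K y x) \<bullet> D\<phi> x)"
        unfolding lift_def inner_minus_left
        by (simp only: integral_inner_left[OF integrable_lift[OF g True]])
      then show ?thesis using True by (simp add: H_def)
    qed (simp add: H_def)
    then show ?thesis by (subst integral_restrict_space) auto
  qed
  also have "(LINT x|lborel. LINT y|\<sigma>. H (x, y)) = (LINT y|\<sigma>. LINT x|lborel. H (x, y))"
    using intH by (intro P.Fubini_integral[symmetric]) (simp add: case_prod_beta')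
  also have "\<dots> = (LINT y|\<sigma>. g y * m y - g y * \<phi> y)"
    using AES(1) by (intro integral_cong_AE) (measurable, auto elim!: AE_mp simp: right_diff_distrib)
  also have "\<dots> = (LINT y|\<sigma>. g y * m y) - (LINT y|\<sigma>. g y * \<phi> y)"
    by (rule Bochner_Integration.integral_diff[OF int_gm int_g\<phi>])
  also have "(LINT y|\<sigma>. g y * m y) = (LINT y|\<sigma>. LINT x|lborel. J (x, y))"
    using AES(2) by (intro integral_cong_AE) (measurable, auto elim: AE_mp)
  also have "\<dots> = (LINT x|lborel. LINT y|\<sigma>. J (x, y))"
    using intJ by (intro P.Fubini_integral) (simp add: case_prod_beta')
  also have "\<dots> = (LINT x|vol G. source g x * \<phi> x)"
  proof -
    have "(LINT y|\<sigma>. J (x, y)) = indicator G x *\<^sub>R (source g x * \<phi> x)" for x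
      by (cases "x \<in> G") (simp_all add: J_def source_def mult.assoc[symmetric])
    then show ?thesis by (subst integral_restrict_space) auto
  qed
  finally show ?thesis by simp
qed

text \<open>No singularity here: \<open>\<theta>\<close> is at most \<open>B\<close>, and
  Cauchy-Schwarz against the constant 1 on a finite measure suffices.\<close>

lemma source_bound:
  obtains C where "0 \<le> C"
    "\<And>g. in_L2 \<sigma> g \<Longrightarrow> (\<integral>\<^sup>+ x. ennreal ((source g x)\<^sup>2) \<partial>vol G) \<le> ennreal C * (\<integral>\<^sup>+ y. ennreal ((g y)\<^sup>2) \<partial>\<sigma>)"
proof -
  have fin: "emeasure lborel G < \<infinity>" by (rule emeasure_bounded_finite[OF G(2)])
  define C where "C = B\<^sup>2 * measure \<sigma> UNIV * measure lborel G"
  have sp: "space \<sigma> = UNIV" using sets_eq_imp_space_eq[OF sets_\<sigma>] by simp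
  show ?thesis
  proof
    show "0 \<le> C" by (simp add: C_def)
    fix g :: "real^'n \<Rightarrow> real" assume g: "in_L2 \<sigma> g"
    have [measurable]: "g \<in> borel_measurable borel" using in_L2_measurable[OF g] by simp
    let ?I = "\<integral>\<^sup>+ y. ennreal \<bar>g y\<bar> \<partial>\<sigma>" and ?g2 = "\<integral>\<^sup>+ y. ennreal ((g y)\<^sup>2) \<partial>\<sigma>"
    have "?I\<^sup>2 = (\<integral>\<^sup>+ y. 1 * ennreal \<bar>g y\<bar> \<partial>\<sigma>)\<^sup>2" by simp
    also have "\<dots> \<le> (\<integral>\<^sup>+ y. 1\<^sup>2 \<partial>\<sigma>) * (\<integral>\<^sup>+ y. (ennreal \<bar>g y\<bar>)\<^sup>2 \<partial>\<sigma>)"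
      by (rule Cauchy_Schwarz_nn_integral) measurable
    also have "\<dots> = ennreal (measure \<sigma> UNIV) * ?g2"
      by (simp add: ennreal_power sp \<sigma>.emeasure_eq_measure)
    finally have I: "?I\<^sup>2 \<le> ennreal (measure \<sigma> UNIV) * ?g2" .
    have "ennreal \<bar>source g x\<bar> \<le> ennreal B * ?I" for x
    proof -
      have int: "integrable \<sigma> (\<lambda>y. g y * \<theta> (x - y - w y))"
      proof (rule Bochner_Integration.integrable_bound)
        show "integrable \<sigma> (\<lambda>y. B * g y)" using in_L2_integrable[OF finite_\<sigma> g] by simp
        have "\<bar>g y * \<theta> (x - y - w y)\<bar> \<le> \<bar>B * g y\<bar>" for y
          using mult_left_mono[OF le[of "x - y - w y"], of "\<bar>g y\<bar>"] nonneg[of "x - y - w y"] B_nonneg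
          by (simp add: abs_mult mult.commute)
        then show "AE y in \<sigma>. norm (g y * \<theta> (x - y - w y)) \<le> norm (B * g y)" by simp
      qed measurable
      have "ennreal \<bar>source g x\<bar> \<le> (\<integral>\<^sup>+ y. ennreal \<bar>g y * \<theta> (x - y - w y)\<bar> \<partial>\<sigma>)"
        unfolding source_def using integral_norm_bound_ennreal[OF int] by simp
      also have "\<dots> \<le> (\<integral>\<^sup>+ y. ennreal B * ennreal \<bar>g y\<bar> \<partial>\<sigma>)"
      proof (rule nn_integral_mono)
        fix y
        have "\<bar>g y * \<theta> (x - y - w y)\<bar> \<le> B * \<bar>g y\<bar>"
          using mult_left_mono[OF le[of "x - y - w y"], of "\<bar>g y\<bar>"] nonneg[of "x - y - w y"]
          by (simp add: abs_mult mult.commute)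
        then show "ennreal \<bar>g y * \<theta> (x - y - w y)\<bar> \<le> ennreal B * ennreal \<bar>g y\<bar>"
          using B_nonneg by (simp add: ennreal_mult[symmetric] ennreal_leI)
      qed
      also have "\<dots> = ennreal B * ?I" by (rule nn_integral_cmult) measurable
      finally show ?thesis .
    qed
    then have "(ennreal \<bar>source g x\<bar>)\<^sup>2 \<le> (ennreal B * ?I)\<^sup>2" for x by (intro power_mono) auto
    then have pw: "ennreal ((source g x)\<^sup>2) \<le> ennreal (B\<^sup>2) * ?I\<^sup>2" for x
      using B_nonneg by (simp add: ennreal_power power_mult_distrib)
    have "(\<integral>\<^sup>+ x. ennreal ((source g x)\<^sup>2) \<partial>vol G) \<le> (\<integral>\<^sup>+ x. ennreal (B\<^sup>2) * ?I\<^sup>2 \<partial>vol G)"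
      by (intro nn_integral_mono pw)
    also have "\<dots> = ennreal (B\<^sup>2) * ?I\<^sup>2 * emeasure lborel G"
      using G by (simp add: space_restrict_space emeasure_restrict_space)
    also have "\<dots> \<le> ennreal (B\<^sup>2) * (ennreal (measure \<sigma> UNIV) * ?g2) * emeasure lborel G"
      by (intro mult_right_mono mult_left_mono I) auto
    also have "\<dots> = ennreal C * ?g2"
      using fin by (simp add: C_def ennreal_mult emeasure_eq_ennreal_measure less_top mult_ac)
    finally show "(\<integral>\<^sup>+ x. ennreal ((source g x)\<^sup>2) \<partial>vol G) \<le> ennreal C * ?g2" .
  qed
qed

lemma weak_div_lift:
  assumes g: "in_L2 \<sigma> g" and L2: "in_L2 (vol G) (lift g)" "in_L2 (vol G) (source g)"
  shows "weak_div G (lift g) (source g)"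
  unfolding weak_div_def
proof (intro conjI L2 allI impI)
  fix \<phi> D\<phi> assume \<phi>: "C1_compact G \<phi> D\<phi>"
  have "\<phi> y = 0" if "y \<in> S" for y
  proof (rule ccontr)
    assume "\<phi> y \<noteq> 0"
    then have "y \<in> closure {x. \<phi> x \<noteq> 0}" by (intro subsetD[OF closure_subset]) simp
    then show False using \<phi> that S(2) by (auto simp: C1_compact_def)
  qed
  then have "(LINT y|\<sigma>. g y * \<phi> y) = 0"
    using S(3) by (intro integral_eq_zero_AE) (auto elim!: AE_mp)
  then show "(LINT x|vol G. lift g x \<bullet> D\<phi> x) = - (LINT x|vol G. source g x * \<phi> x)"
    using lift_gradient[OF g, of \<phi> D\<phi>] \<phi> by (simp add: C1_compact_def)
qed

lemma source_measurable: "in_L2 \<sigma> g \<Longrightarrow> source g \<in> borel_measurable borel"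
proof -
  assume g: "in_L2 \<sigma> g"
  then have [measurable]: "g \<in> borel_measurable borel" using in_L2_measurable[OF g] by simp
  show ?thesis unfolding source_def by measurable
qed

lemma L2_from_nn_integral:
  fixes f :: "'b \<Rightarrow> 'c::euclidean_space"
  assumes f: "f \<in> borel_measurable N" and g: "in_L2 \<sigma> g" and C: "0 \<le> C"
    and le: "(\<integral>\<^sup>+ x. ennreal ((norm (f x))\<^sup>2) \<partial>N) \<le> ennreal C * (\<integral>\<^sup>+ y. ennreal ((g y)\<^sup>2) \<partial>\<sigma>)"
  shows "in_L2 N f" "(L2_norm N f)\<^sup>2 \<le> C * (L2_norm \<sigma> g)\<^sup>2"
proof -
  have g2: "(\<integral>\<^sup>+ y. ennreal ((g y)\<^sup>2) \<partial>\<sigma>) = ennreal ((L2_norm \<sigma> g)\<^sup>2)"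
    using g by (subst nn_integral_eq_integral) (auto simp: L2_norm_power2 in_L2_def)
  have le': "(\<integral>\<^sup>+ x. ennreal ((norm (f x))\<^sup>2) \<partial>N) \<le> ennreal (C * (L2_norm \<sigma> g)\<^sup>2)"
    using le C unfolding g2 by (simp add: ennreal_mult)
  have int: "integrable N (\<lambda>x. (norm (f x))\<^sup>2)"
    using f le_less_trans[OF le' ennreal_less_top] by (intro integrableI_nonneg) auto
  then show "in_L2 N f" using f by (simp add: in_L2_def)
  have "ennreal ((L2_norm N f)\<^sup>2) \<le> ennreal (C * (L2_norm \<sigma> g)\<^sup>2)"
    using le' unfolding L2_norm_power2[of N f] by (subst nn_integral_eq_integral[symmetric, OF int]) auto
  then show "(L2_norm N f)\<^sup>2 \<le> C * (L2_norm \<sigma> g)\<^sup>2" using C by (simp add: ennreal_le_iff)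
qed

lemma lift_exists:
  obtains C where "0 \<le> C"
    "\<And>g. in_L2 \<sigma> g \<Longrightarrow> \<exists>\<psi> f. \<psi> \<in> Hs G (1/8) \<and> weak_div G \<psi> f \<and>
      (\<forall>\<phi> D\<phi>. C1 \<phi> D\<phi> \<longrightarrow> green G \<psi> \<phi> D\<phi> = (LINT y|\<sigma>. g y * \<phi> y)) \<and>
      Hs_norm G (1/8) \<psi> + L2_norm (vol G) f \<le> C * L2_norm \<sigma> g"
proof -
  from lift_bounds obtain c1 where c1: "0 \<le> c1"
    "\<And>g. in_L2 \<sigma> g \<Longrightarrow> (\<integral>\<^sup>+ x. ennreal ((norm (lift g x))\<^sup>2) \<partial>vol G) \<le> ennreal c1 * (\<integral>\<^sup>+ y. ennreal ((g y)\<^sup>2) \<partial>\<sigma>)"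
    "\<And>g. in_L2 \<sigma> g \<Longrightarrow> slobodeckij G (1/8) (lift g) \<le> ennreal c1 * (\<integral>\<^sup>+ y. ennreal ((g y)\<^sup>2) \<partial>\<sigma>)"
    by blast
  from source_bound obtain c2 where c2: "0 \<le> c2"
    "\<And>g. in_L2 \<sigma> g \<Longrightarrow> (\<integral>\<^sup>+ x. ennreal ((source g x)\<^sup>2) \<partial>vol G) \<le> ennreal c2 * (\<integral>\<^sup>+ y. ennreal ((g y)\<^sup>2) \<partial>\<sigma>)"
    by blast
  \<comment> \<open>The integer part of 1/8 is 0, so \<open>Hs\<close> and \<open>Hs_norm\<close>
    reduce to the L2 part and one Slobodeckij term.\<close>
  have fr: "frac (1/8 :: real) = 1/8" "nat \<lfloor>1/8 :: real\<rfloor> = 0" by (auto simp: frac_def)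
  show ?thesis
  proof (rule that[of "sqrt (2 * c1) + sqrt c2"])
    show "0 \<le> sqrt (2 * c1) + sqrt c2" using c1 c2 by simp
    fix g :: "real^'n \<Rightarrow> real" assume g: "in_L2 \<sigma> g"
    have g2: "(\<integral>\<^sup>+ y. ennreal ((g y)\<^sup>2) \<partial>\<sigma>) = ennreal ((L2_norm \<sigma> g)\<^sup>2)"
      using g by (subst nn_integral_eq_integral) (auto simp: L2_norm_power2 in_L2_def)
    have m: "lift g \<in> borel_measurable (vol G)" "source g \<in> borel_measurable (vol G)"
      using lift_measurable[OF g] source_measurable[OF g] by (auto intro!: measurable_restrict_space1)
    note l = L2_from_nn_integral[OF m(1) g c1(1) c1(2)[OF g]]
    have s: "in_L2 (vol G) (source g)" "(L2_norm (vol G) (source g))\<^sup>2 \<le> c2 * (L2_norm \<sigma> g)\<^sup>2"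
      using L2_from_nn_integral[OF m(2) g c2(1)] c2(2)[OF g] by auto
    have sl: "slobodeckij G (1/8) (lift g) \<le> ennreal (c1 * (L2_norm \<sigma> g)\<^sup>2)"
      using c1(3)[OF g] c1(1) by (simp add: g2 ennreal_mult)
    have wd: "weak_div G (lift g) (source g)" by (rule weak_div_lift[OF g l(1) s(1)])
    have gr: "green G (lift g) \<phi> D\<phi> = (LINT y|\<sigma>. g y * \<phi> y)" if \<phi>: "C1 \<phi> D\<phi>" for \<phi> D\<phi>
      using green_eq[OF G wd \<phi>] lift_gradient[OF g \<phi>] by simp
    have Hs: "lift g \<in> Hs G (1/8)"
      using l(1) le_less_trans[OF sl ennreal_less_top] by (simp add: Hs_def fr)
    have "enn2real (slobodeckij G (1/8) (lift g)) \<le> c1 * (L2_norm \<sigma> g)\<^sup>2"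
      using sl c1(1) by (intro enn2real_leI) auto
    then have "(L2_norm (vol G) (lift g))\<^sup>2 + enn2real (slobodeckij G (1/8) (lift g)) \<le> (2 * c1) * (L2_norm \<sigma> g)\<^sup>2"
      using l(2) by simp
    then have "Hs_norm G (1/8) (lift g) \<le> sqrt ((2 * c1) * (L2_norm \<sigma> g)\<^sup>2)"
      unfolding Hs_norm_def fr by (intro real_sqrt_le_mono) simp
    also have "\<dots> = sqrt (2 * c1) * L2_norm \<sigma> g"
      unfolding real_sqrt_mult by (simp add: L2_norm_nonneg)
    finally have h: "Hs_norm G (1/8) (lift g) \<le> sqrt (2 * c1) * L2_norm \<sigma> g" .
    have "L2_norm (vol G) (source g) \<le> sqrt (c2 * (L2_norm \<sigma> g)\<^sup>2)"
      by (intro real_le_rsqrt s(2))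
    also have "\<dots> = sqrt c2 * L2_norm \<sigma> g"
      unfolding real_sqrt_mult by (simp add: L2_norm_nonneg)
    finally have "Hs_norm G (1/8) (lift g) + L2_norm (vol G) (source g) \<le> (sqrt (2 * c1) + sqrt c2) * L2_norm \<sigma> g"
      using h by (simp add: distrib_right)
    then show "\<exists>\<psi> f. \<psi> \<in> Hs G (1/8) \<and> weak_div G \<psi> f \<and>
      (\<forall>\<phi> D\<phi>. C1 \<phi> D\<phi> \<longrightarrow> green G \<psi> \<phi> D\<phi> = (LINT y|\<sigma>. g y * \<phi> y)) \<and>
      Hs_norm G (1/8) \<psi> + L2_norm (vol G) f \<le> (sqrt (2 * c1) + sqrt c2) * L2_norm \<sigma> g"
      using wd gr Hs by (intro exI[of _ "lift g"] exI[of _ "source g"] conjI allI impI)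
  qed
qed

end

text \<open>The tent \<open>max 0 (\<rho> - norm v)\<close> divided by its integral; the norm being
  1-Lipschitz gives the constant \<open>L\<close>.\<close>

lemma mollifier_exists:
  assumes \<rho>: "0 < \<rho>"
  obtains \<theta> :: "real^'n::finite \<Rightarrow> real" and B L where "mollifier \<theta> \<rho> B L"
proof -
  define h where "h = (\<lambda>v :: real^'n. max 0 (\<rho> - norm v))"
  have cont: "continuous_on UNIV h" unfolding h_def by (intro continuous_intros)
  have [measurable]: "h \<in> borel_measurable borel" using cont by (rule borel_measurable_continuous_onI)
  have h0: "0 \<le> h v" "h v \<le> \<rho>" for v using \<rho> by (auto simp: h_def)
  have int: "integrable lborel h"
  proof (rule Bochner_Integration.integrable_bound)
    show "integrable lborel (\<lambda>v :: real^'n. indicator (cball 0 \<rho>) v * \<rho>)"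
      using emeasure_bounded_finite[of "cball (0 :: real^'n) \<rho>"]
      by (intro integrable_mult_left integrable_real_indicator) auto
    show "AE v in lborel. norm (h v) \<le> norm (indicator (cball 0 \<rho>) v * \<rho>)"
      using \<rho> by (auto simp: h_def indicator_def)
  qed simp
  define I where "I = (LINT v|lborel. h v)"
  \<comment> \<open>A vanishing integral would make the tent zero almost everywhere and hence the
    open ball null.\<close>
  have "I \<noteq> 0"
  proof
    assume "I = 0"
    then have "AE v in lborel. h v = 0"
      using int h0 by (simp add: I_def integral_nonneg_eq_0_iff_AE)
    then have "AE v in lborel. v \<notin> ball (0 :: real^'n) \<rho>"
      by eventually_elim (auto simp: h_def max_def split: if_splits)
    then have "ball (0 :: real^'n) \<rho> \<in> null_sets lborel"
      by (subst AE_iff_null_sets) auto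
    then have "negligible (ball (0 :: real^'n) \<rho>)"
      by (simp add: negligible_iff_null_sets null_sets_completionI)
    then show False using \<rho> open_not_negligible[of "ball (0 :: real^'n) \<rho>"] by simp
  qed
  moreover have "0 \<le> I" unfolding I_def using h0 by (intro Bochner_Integration.integral_nonneg) auto
  ultimately have I: "0 < I" by simp
  have "mollifier (\<lambda>v. h v / I) \<rho> (\<rho> / I) (1 / I)"
  proof
    fix u v
    show "\<bar>h u / I - h v / I\<bar> \<le> 1 / I * norm (u - v)"
    proof -
      have "\<bar>h u - h v\<bar> \<le> norm (u - v)"
        using norm_triangle_ineq3[of u v] unfolding h_def by linarith
      then show ?thesis using I by (simp add: diff_divide_distrib[symmetric] abs_divide divide_right_mono)
    qed
    show "\<rho> \<le> norm v \<Longrightarrow> h v / I = 0" by (simp add: h_def)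
  qed (use \<rho> I h0 int in \<open>auto simp: divide_right_mono I_def[symmetric]\<close>)
  then show ?thesis by (rule that)
qed

section \<open>Boundaries of polyhedral domains\<close>

lemma closed_prism:
  "closed {x. 0 \<le> a \<bullet> x - b \<and> a \<bullet> x - b \<le> 1/2 \<and> x - (a \<bullet> x - b) *\<^sub>R a \<in> cball c r}"
  unfolding mem_cball by (intro closed_Collect_conj closed_Collect_le continuous_intros)

text \<open>About \<open>1 / (2 * r)\<close> balls of radius \<open>2 * r\<close>, with centres at
  spacing \<open>r\<close> along the direction \<open>a\<close>, cover the prism of height 1/2. Each
  has volume at most \<open>(4 * r) ^ d\<close>, so the total is of order
  \<open>r ^ (d - 1)\<close>. The crude covering avoids rotating the hyperplane into a coordinate
  plane.\<close>

lemma prism_volume_le: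
  fixes a c :: "real^'n::finite"
  assumes a: "norm a = 1" and r: "0 < r" "r \<le> 1"
  shows "emeasure lborel {x. 0 \<le> a \<bullet> x - b \<and> a \<bullet> x - b \<le> 1/2 \<and> x - (a \<bullet> x - b) *\<^sub>R a \<in> cball c r}
    \<le> ennreal (2 * 4 ^ CARD('n) * r powr (real CARD('n) - 1))"
proof -
  define S where "S = {x. 0 \<le> a \<bullet> x - b \<and> a \<bullet> x - b \<le> 1/2 \<and> x - (a \<bullet> x - b) *\<^sub>R a \<in> cball c r}"
  define N where "N = nat \<lfloor>1 / (2 * r)\<rfloor>"
  define D where "D = (\<lambda>j. cball (c + (real j * r) *\<^sub>R a) (2 * r))"
  have "S \<subseteq> (\<Union>j\<in>{..N}. D j)"
  proof
    fix x assume x: "x \<in> S"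
    define s where "s = a \<bullet> x - b"
    have s: "0 \<le> s" "s \<le> 1/2" "norm (c - (x - s *\<^sub>R a)) \<le> r" using x by (auto simp: S_def s_def dist_norm)
    define j where "j = nat \<lfloor>s / r\<rfloor>"
    have "0 \<le> s / r" using s r by simp
    then have "real j \<le> s / r" "s / r < real j + 1" unfolding j_def by linarith+
    then have j: "real j * r \<le> s" "s < real j * r + r" using r by (auto simp: field_simps)
    have "s / r \<le> 1 / (2 * r)" using s r by (simp add: field_simps)
    then have "j \<le> N" unfolding j_def N_def by (intro nat_mono floor_mono)
    have "norm (c + (real j * r) *\<^sub>R a - x) = norm ((c - (x - s *\<^sub>R a)) - (s - real j * r) *\<^sub>R a)"
      by (simp add: algebra_simps)
    also have "\<dots> \<le> norm (c - (x - s *\<^sub>R a)) + norm ((s - real j * r) *\<^sub>R a)" by (rule norm_triangle_ineq4)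
    also have "\<dots> \<le> 2 * r" using s(3) j a by simp
    finally show "x \<in> (\<Union>j\<in>{..N}. D j)" using \<open>j \<le> N\<close> by (auto simp: D_def dist_norm)
  qed
  then have "emeasure lborel S \<le> emeasure lborel (\<Union>j\<in>{..N}. D j)"
    by (intro emeasure_mono) (auto simp: D_def)
  also have "\<dots> \<le> (\<Sum>j\<in>{..N}. emeasure lborel (D j))"
    by (intro emeasure_subadditive_finite) (auto simp: D_def)
  also have "\<dots> \<le> (\<Sum>j\<in>{..N}. ennreal (4 ^ CARD('n) * r ^ CARD('n)))"
  proof (rule sum_mono)
    fix j
    have "emeasure lborel (D j) \<le> ennreal (2 ^ DIM(real^'n) * (2 * r) powr real DIM(real^'n))"
      using upper_regular_lborel[where 'a="real^'n"] r unfolding upper_regular_def D_def by simp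
    also have "2 ^ DIM(real^'n) * (2 * r) powr real DIM(real^'n) = 4 ^ CARD('n) * r ^ CARD('n)"
    proof -
      have "4 ^ CARD('n) = 2 ^ CARD('n) * (2 :: real) ^ CARD('n)" by (subst power_mult_distrib[symmetric]) simp
      then show ?thesis using r by (simp add: powr_realpow power_mult_distrib)
    qed
    finally show "emeasure lborel (D j) \<le> ennreal (4 ^ CARD('n) * r ^ CARD('n))" .
  qed
  also have "\<dots> = ennreal (real (N + 1) * (4 ^ CARD('n) * r ^ CARD('n)))"
    using r by (simp add: ennreal_mult ennreal_of_nat_eq_real_of_nat[symmetric])
  also have "\<dots> \<le> ennreal (2 * 4 ^ CARD('n) * r powr (real CARD('n) - 1))"
  proof (rule ennreal_leI)
    have "0 \<le> 1 / (2 * r)" using r by simp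
    then have "real N \<le> 1 / (2 * r)" unfolding N_def by linarith
    \<comment> \<open>The additional ball is absorbed because \<open>r \<le> 1\<close>.\<close>
    moreover have "1 / (2 * r) + 1 \<le> 2 / r" using r by (simp add: field_simps)
    ultimately have "real (N + 1) \<le> 2 / r" by simp
    then have "real (N + 1) * (4 ^ CARD('n) * r ^ CARD('n)) \<le> 2 / r * (4 ^ CARD('n) * r ^ CARD('n))"
      using r by (intro mult_right_mono) auto
    also have "\<dots> = 2 * 4 ^ CARD('n) * r powr (real CARD('n) - 1)"
      using r by (simp add: powr_diff powr_realpow)
    finally show "real (N + 1) * (4 ^ CARD('n) * r ^ CARD('n)) \<le> 2 * 4 ^ CARD('n) * r powr (real CARD('n) - 1)" .
  qed
  finally show ?thesis unfolding S_def .
qed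

text \<open>\<open>flat_area\<close> sums over uncountably many hyperplanes. The prism that any
  other hyperplane erects over a part of this one lies in a set
  \<open>{x. u \<bullet> x = \<beta>}\<close> of volume 0, so only the representations
  \<open>(a, b)\<close> and \<open>(- a, - b)\<close> contribute.\<close>

lemma flat_area_hyperplane_le:
  fixes a c :: "real^'n::finite"
  assumes a: "norm a = 1" and r: "0 < r" "r \<le> 1"
  shows "emeasure flat_area ({x. a \<bullet> x = b} \<inter> cball c r) \<le> ennreal (4 * 4 ^ CARD('n) * r powr (real CARD('n) - 1))"
proof -
  define A where "A = {x. a \<bullet> x = b} \<inter> cball c r"
  have Ab: "A \<in> sets borel"
    unfolding A_def by (intro sets.Int borel_closed closed_hyperplane closed_cball)
  define V where "V = (\<lambda>(a' :: real^'n, b' :: real). emeasure lborel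
    {x. 0 \<le> a' \<bullet> x - b' \<and> a' \<bullet> x - b' \<le> 1/2 \<and> x - (a' \<bullet> x - b') *\<^sub>R a' \<in> A})"
  have V_le: "V p \<le> ennreal (2 * 4 ^ CARD('n) * r powr (real CARD('n) - 1))" if "norm (fst p) = 1" for p
  proof -
    obtain a' b' where p: "p = (a', b')" by (cases p)
    have "V p \<le> emeasure lborel {x. 0 \<le> a' \<bullet> x - b' \<and> a' \<bullet> x - b' \<le> 1/2 \<and> x - (a' \<bullet> x - b') *\<^sub>R a' \<in> cball c r}"
      unfolding V_def p split_conv
      by (intro emeasure_mono) (auto simp: A_def borel_closed[OF closed_prism])
    also have "\<dots> \<le> ennreal (2 * 4 ^ CARD('n) * r powr (real CARD('n) - 1))"
      using that by (intro prism_volume_le r) (simp add: p)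
    finally show ?thesis .
  qed
  have V0: "V p = 0" if p: "norm (fst p) = 1" "p \<notin> {(a, b), (- a, - b)}" for p
  proof -
    obtain a' b' where p': "p = (a', b')" by (cases p)
    \<comment> \<open>The foot of \<open>x\<close> satisfies the equation with \<open>a\<close> and
      \<open>b\<close>; written in terms of \<open>x\<close> it reads
      \<open>u \<bullet> x = \<beta>\<close>, where \<open>u\<close> is the part of \<open>a\<close>
      orthogonal to \<open>a'\<close>.\<close>
    define u where "u = a - (a \<bullet> a') *\<^sub>R a'"
    define \<beta> where "\<beta> = b - b' * (a \<bullet> a')"
    let ?S = "{x. 0 \<le> a' \<bullet> x - b' \<and> a' \<bullet> x - b' \<le> 1/2 \<and> x - (a' \<bullet> x - b') *\<^sub>R a' \<in> A}"
    have "?S \<subseteq> {x. u \<bullet> x = \<beta>}"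
      by (auto simp: A_def u_def \<beta>_def inner_diff_right inner_diff_left algebra_simps)
    \<comment> \<open>\<open>u = 0\<close> means parallel hyperplanes, and
      \<open>\<beta> = 0\<close> in addition means that they coincide. For \<open>u = 0\<close> and
      \<open>\<beta> \<noteq> 0\<close> the solution set is empty, a case that
      \<open>negligible_hyperplane\<close> includes.\<close>
    moreover have "u \<noteq> 0 \<or> \<beta> \<noteq> 0"
    proof (rule ccontr)
      assume "\<not> (u \<noteq> 0 \<or> \<beta> \<noteq> 0)"
      then have *: "a = (a \<bullet> a') *\<^sub>R a'" "b = b' * (a \<bullet> a')" by (auto simp: u_def \<beta>_def)
      have "\<bar>a \<bullet> a'\<bar> = 1" using arg_cong[OF *(1), of norm] a p(1) by (simp add: p')
      then have "a \<bullet> a' = 1 \<or> a \<bullet> a' = -1" by linarith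
      then have "p = (a, b) \<or> p = (- a, - b)" using * by (auto simp: p')
      then show False using p(2) by auto
    qed
    then have "negligible {x. u \<bullet> x = \<beta>}" by (rule negligible_hyperplane)
    then have "{x. u \<bullet> x = \<beta>} \<in> null_sets lborel"
      using negligible_iff_null_sets closed_hyperplane[of u \<beta>]
      by (metis borel_closed null_sets_completion_iff sets_lborel)
    ultimately show ?thesis unfolding V_def p' split_conv
      by (metis (no_types, lifting) emeasure_eq_0 null_setsD1 null_setsD2)
  qed
  have ne: "(a, b) \<noteq> (- a, - b)"
  proof
    assume "(a, b) = (- a, - b)"
    then have "a = - a" by (simp only: prod.inject)
    from arg_cong[OF this, of "\<lambda>z. z \<bullet> a"] have "a \<bullet> a = - (a \<bullet> a)"
      by (simp only: inner_minus_left)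
    then have "a \<bullet> a = 0" by linarith
    then show False using a by simp
  qed
  have "emeasure flat_area A = (\<integral>\<^sup>+ p. V p \<partial>count_space {(a, b). norm a = 1})"
    unfolding emeasure_flat_area[OF Ab] V_def ..
  also have "\<dots> = (\<Sum>p\<in>{(a, b), (- a, - b)}. V p)"
  proof (rule nn_integral_count_space')
    show "V p = 0" if "p \<in> {(a, b). norm a = 1}" "p \<notin> {(a, b), (- a, - b)}" for p
      using that by (intro V0) auto
    show "{(a, b), (- a, - b)} \<subseteq> {(a, b). norm a = 1}" using a by auto
  qed simp
  also have "\<dots> = V (a, b) + V (- a, - b)" using ne by simp
  also have "\<dots> \<le> ennreal (2 * 4 ^ CARD('n) * r powr (real CARD('n) - 1)) + ennreal (2 * 4 ^ CARD('n) * r powr (real CARD('n) - 1))"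
    using a by (intro add_mono V_le) auto
  also have "\<dots> = ennreal (4 * 4 ^ CARD('n) * r powr (real CARD('n) - 1))" using r by (simp add: ennreal_plus[symmetric] del: ennreal_plus)
  finally show ?thesis unfolding A_def .
qed

text \<open>A point of the polytope at which all of the finitely many inequalities are strict is
  interior. The normals are scaled because \<open>flat_area\<close> indexes hyperplanes by unit
  normals.\<close>

lemma polytope_frontier_hyperplanes:
  fixes P :: "(real^'n::finite) set"
  assumes "polytope P"
  obtains N where "finite N" "\<And>a b. (a, b) \<in> N \<Longrightarrow> norm a = 1" "frontier P \<subseteq> (\<Union>(a, b)\<in>N. {x. a \<bullet> x = b})"
proof -
  from polytope_imp_polyhedron[OF assms] obtain F where F: "finite F" "P = \<Inter>F"
    "\<And>h. h \<in> F \<Longrightarrow> \<exists>a b. a \<noteq> 0 \<and> h = {x. a \<bullet> x \<le> b}" by (auto simp: polyhedron_def)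
  then obtain \<alpha> \<beta> where \<alpha>: "\<And>h. h \<in> F \<Longrightarrow> \<alpha> h \<noteq> 0 \<and> h = {x. \<alpha> h \<bullet> x \<le> \<beta> h}" by metis
  define N where "N = (\<lambda>h. (\<alpha> h /\<^sub>R norm (\<alpha> h), \<beta> h / norm (\<alpha> h))) ` F"
  show ?thesis
  proof
    show "finite N" using F(1) by (simp add: N_def)
    show "norm a = 1" if "(a, b) \<in> N" for a b using that \<alpha> by (auto simp: N_def)
    show "frontier P \<subseteq> (\<Union>(a, b)\<in>N. {x. a \<bullet> x = b})"
    proof
      fix x assume x: "x \<in> frontier P"
      have "closed P" using assms polytope_imp_closed by blast
      then have xP: "x \<in> P" "x \<notin> interior P" using x by (auto simp: frontier_def)
      have "\<exists>h\<in>F. x \<notin> interior h"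
      proof (rule ccontr)
        assume "\<not> ?thesis"
        then have "x \<in> (\<Inter>h\<in>F. interior h)" by auto
        moreover have "open (\<Inter>h\<in>F. interior h)" using F(1) by (intro open_INT) auto
        moreover have "(\<Inter>h\<in>F. interior h) \<subseteq> P" unfolding F(2) using interior_subset by blast
        ultimately show False using xP(2) by (meson interior_maximal subsetD)
      qed
      then obtain h where h: "h \<in> F" "x \<notin> interior h" by auto
      have "x \<in> h" using xP(1) h(1) F(2) by auto
      then have "\<alpha> h \<bullet> x \<le> \<beta> h" using \<alpha>[OF h(1)] by auto
      moreover have "\<not> \<alpha> h \<bullet> x < \<beta> h"
        using h \<alpha>[OF h(1)] interior_halfspace_le[of "\<alpha> h" "\<beta> h"] by auto
      ultimately have "\<alpha> h \<bullet> x = \<beta> h" by simp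
      then have "(\<alpha> h /\<^sub>R norm (\<alpha> h)) \<bullet> x = \<beta> h / norm (\<alpha> h)"
        by (simp add: divide_inverse mult.commute)
      then show "x \<in> (\<Union>(a, b)\<in>N. {x. a \<bullet> x = b})" using h(1) by (force simp: N_def)
    qed
  qed
qed

section \<open>Full-dimensional polytopes filling a polyhedral domain\<close>

lemma interior_finite_Union_empty:
  assumes "finite \<P>" "\<And>P. P \<in> \<P> \<Longrightarrow> closed P \<and> interior P = {}"
  shows "interior (\<Union>\<P>) = {}"
  using assms
proof (induction \<P>)
  case (insert P \<P>)
  then have "interior (P \<union> \<Union>\<P>) = interior P" by (intro interior_closed_Un_empty_interior) auto
  then show ?case using insert by simp
qed simp

text \<open>Polytopes without interior can be discarded: what \<open>G\<close> would lose is an open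
  subset of a finite union of closed sets with empty interior. The inclusion
  \<open>interior P \<subseteq> G\<close> comes from \<open>interior (closure G) = G\<close> and
  would fail for a slit domain.\<close>

lemma polyhedral_domain_cover:
  assumes G: "polyhedral_domain (G :: (real^'n::finite) set)"
  obtains \<P> where "finite \<P>" "\<And>P. P \<in> \<P> \<Longrightarrow> polytope P \<and> interior P \<noteq> {} \<and> interior P \<subseteq> G"
    "closure G = \<Union>\<P>"
proof -
  from G obtain \<Q> where \<Q>: "finite \<Q>" "\<And>P. P \<in> \<Q> \<Longrightarrow> polytope P" "closure G = \<Union>\<Q>"
    and G': "open G" "interior (closure G) = G" unfolding polyhedral_domain_def by blast
  define \<P> where "\<P> = {P \<in> \<Q>. interior P \<noteq> {}}"
  have closed: "closed P" if "P \<in> \<Q>" for P using \<Q>(2)[OF that] polytope_imp_closed by blast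
  have 0: "interior (\<Union>(\<Q> - \<P>)) = {}"
    using \<Q>(1) closed by (intro interior_finite_Union_empty) (auto simp: \<P>_def)
  have cl: "closed (\<Union>\<P>)" using \<Q>(1) closed by (intro closed_Union) (auto simp: \<P>_def)
  show ?thesis
  proof
    show "finite \<P>" using \<Q>(1) by (simp add: \<P>_def)
    show "polytope P \<and> interior P \<noteq> {} \<and> interior P \<subseteq> G" if "P \<in> \<P>" for P
    proof -
      have "P \<subseteq> closure G" using that \<Q>(3) by (auto simp: \<P>_def)
      then have "interior P \<subseteq> G" using interior_mono G'(2) by blast
      then show ?thesis using that \<Q>(2) by (auto simp: \<P>_def)
    qed
    have "G - \<Union>\<P> \<subseteq> interior (\<Union>(\<Q> - \<P>))"
    proof (rule interior_maximal)
      show "G - \<Union>\<P> \<subseteq> \<Union>(\<Q> - \<P>)" using \<Q>(3) closure_subset[of G] by blast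
      show "open (G - \<Union>\<P>)" using G'(1) cl by (rule open_Diff)
    qed
    then have "G \<subseteq> \<Union>\<P>" using 0 by blast
    then have "closure G \<subseteq> \<Union>\<P>" using cl by (rule closure_minimal)
    then show "closure G = \<Union>\<P>" using \<Q>(3) by (auto simp: \<P>_def)
  qed
qed

lemma polyhedral_domain_bounded: "polyhedral_domain G \<Longrightarrow> bounded G"
proof -
  assume "polyhedral_domain G"
  then obtain \<P> where \<P>: "finite \<P>" "\<And>P. P \<in> \<P> \<Longrightarrow> polytope P" "closure G = \<Union>\<P>"
    unfolding polyhedral_domain_def by blast
  have "bounded (closure G)" unfolding \<P>(3) using \<P>(1,2) by (intro bounded_Union ballI polytope_imp_bounded)
  then show ?thesis using closure_subset bounded_subset by blast
qed

lemma polyhedral_domain_open: "polyhedral_domain G \<Longrightarrow> open G"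
  by (simp add: polyhedral_domain_def)

text \<open>A boundary point lies in some polytope of the cover, but not in its interior, which is
  part of the open set \<open>G\<close>.\<close>

lemma polyhedral_frontier_hyperplanes:
  assumes G: "polyhedral_domain (G :: (real^'n::finite) set)"
  obtains N where "finite N" "\<And>a b. (a, b) \<in> N \<Longrightarrow> norm a = 1" "frontier G \<subseteq> (\<Union>(a, b)\<in>N. {x. a \<bullet> x = b})"
proof -
  from polyhedral_domain_cover[OF G] obtain \<P> where \<P>: "finite \<P>"
    "\<And>P. P \<in> \<P> \<Longrightarrow> polytope P \<and> interior P \<noteq> {} \<and> interior P \<subseteq> G" "closure G = \<Union>\<P>" by blast
  have "\<exists>N. finite N \<and> (\<forall>(a, b)\<in>N. norm a = 1) \<and> frontier P \<subseteq> (\<Union>(a, b)\<in>N. {x. a \<bullet> x = b})" if "P \<in> \<P>" for P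
    using polytope_frontier_hyperplanes[of P] \<P>(2)[OF that] by (metis (mono_tags, lifting) case_prodI2)
  then obtain N where N: "\<And>P. P \<in> \<P> \<Longrightarrow> finite (N P) \<and> (\<forall>(a, b)\<in>N P. norm a = 1) \<and>
    frontier P \<subseteq> (\<Union>(a, b)\<in>N P. {x. a \<bullet> x = b})" by metis
  show ?thesis
  proof
    show "finite (\<Union>P\<in>\<P>. N P)" using \<P>(1) N by auto
    show "norm a = 1" if "(a, b) \<in> (\<Union>P\<in>\<P>. N P)" for a b using that N by fastforce
    show "frontier G \<subseteq> (\<Union>(a, b)\<in>(\<Union>P\<in>\<P>. N P). {x. a \<bullet> x = b})"
    proof
      fix x assume x: "x \<in> frontier G"
      then obtain P where P: "P \<in> \<P>" "x \<in> P" using \<P>(3) by (auto simp: frontier_def)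
      have "x \<notin> G" using x polyhedral_domain_open[OF G] by (simp add: frontier_def interior_open)
      then have "x \<notin> interior P" using \<P>(2)[OF P(1)] by auto
      then have "x \<in> frontier P" using P(2) closure_subset by (auto simp: frontier_def)
      then show "x \<in> (\<Union>(a, b)\<in>(\<Union>P\<in>\<P>. N P). {x. a \<bullet> x = b})" using N[OF P(1)] P(1) by blast
    qed
  qed
qed

section \<open>Area of polyhedral surfaces\<close>

lemma flat_area_bounded_hyperplane:
  fixes a :: "real^'n::finite"
  assumes a: "norm a = 1" and S: "bounded S" "S \<in> sets borel"
  shows "emeasure flat_area ({x. a \<bullet> x = b} \<inter> S) < \<infinity>"
proof -
  have "compact (closure S)" using S by simp
  then obtain k where k: "finite k" "closure S \<subseteq> (\<Union>x\<in>k. ball x 1)"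
    using compact_eq_totally_bounded zero_less_one by metis
  have b: "{x. a \<bullet> x = b} \<inter> cball c 1 \<in> sets borel" for c
    by (intro sets.Int borel_closed closed_hyperplane closed_cball)
  have "{x. a \<bullet> x = b} \<inter> S \<subseteq> (\<Union>x\<in>k. {x. a \<bullet> x = b} \<inter> cball x 1)"
  proof
    fix x assume x: "x \<in> {x. a \<bullet> x = b} \<inter> S"
    then have "x \<in> closure S" using closure_subset by auto
    then obtain c where "c \<in> k" "x \<in> ball c 1" using k(2) by blast
    then show "x \<in> (\<Union>x\<in>k. {x. a \<bullet> x = b} \<inter> cball x 1)"
      using x by (auto intro!: bexI[of _ c])
  qed
  then have "emeasure flat_area ({x. a \<bullet> x = b} \<inter> S) \<le> emeasure flat_area (\<Union>x\<in>k. {x. a \<bullet> x = b} \<inter> cball x 1)"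
    using b by (intro emeasure_mono sets.finite_UN k(1)) simp_all
  also have "\<dots> \<le> (\<Sum>x\<in>k. emeasure flat_area ({x. a \<bullet> x = b} \<inter> cball x 1))"
    using b k(1) by (intro emeasure_subadditive_finite) auto
  also have "\<dots> \<le> (\<Sum>x\<in>k. ennreal (4 * 4 ^ CARD('n) * 1 powr (real CARD('n) - 1)))"
    by (intro sum_mono flat_area_hyperplane_le a) auto
  also have "\<dots> < \<infinity>" using k(1) by (simp add: ennreal_mult_less_top ennreal_of_nat_eq_real_of_nat)
  finally show ?thesis .
qed

text \<open>\<open>surf S\<close> lives on \<open>S\<close> only and \<open>flat_area\<close> is not
  sigma-finite. The image under the identity is a Borel measure on the whole space, finite if
  \<open>S\<close> has finite area.\<close>

definition surface :: "(real^'n::finite) set \<Rightarrow> (real^'n) measure" where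
  "surface S = distr (surf S) borel (\<lambda>x. x)"

lemma id_measurable_surf: "(\<lambda>x. x) \<in> measurable (surf S) borel"
  by (intro measurable_restrict_space1) (simp add: measurable_def)

lemma emeasure_surface:
  "S \<in> sets borel \<Longrightarrow> A \<in> sets borel \<Longrightarrow> emeasure (surface S) A = emeasure flat_area (A \<inter> S)"
  unfolding surface_def
  by (subst emeasure_distr[OF id_measurable_surf]) (auto simp: space_restrict_space emeasure_restrict_space Int_commute)

lemma polyhedral_surface_regular:
  assumes G: "polyhedral_domain (G :: (real^'n::finite) set)" and dim: "2 \<le> CARD('n)"
  shows "emeasure flat_area (frontier G) < \<infinity>"
    and "\<exists>A. upper_regular (surface (frontier G)) A (real CARD('n) - 1)"
proof -
  let ?S = "frontier G"
  obtain N where N: "finite N" "\<And>a b. (a, b) \<in> N \<Longrightarrow> norm a = 1" "?S \<subseteq> (\<Union>(a, b)\<in>N. {x. a \<bullet> x = b})"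
    using polyhedral_frontier_hyperplanes[OF G] by blast
  have N3: "?S \<subseteq> (\<Union>p\<in>N. {x. fst p \<bullet> x = snd p})" using N(3) by (simp add: case_prod_beta')
  have Sb: "?S \<in> sets borel" "bounded ?S"
    using compact_frontier_bounded[OF polyhedral_domain_bounded[OF G]] compact_imp_bounded by auto
  have le: "emeasure flat_area (T \<inter> ?S) \<le> (\<Sum>(a, b)\<in>N. emeasure flat_area ({x. a \<bullet> x = b} \<inter> (T \<inter> ?S)))"
    if T: "T \<in> sets borel" for T
  proof -
    have m: "{x. a \<bullet> x = b} \<inter> (T \<inter> ?S) \<in> sets flat_area" for a b
      using T Sb by (simp add: borel_closed closed_hyperplane sets.Int)
    have "T \<inter> ?S \<subseteq> (\<Union>p\<in>N. {x. fst p \<bullet> x = snd p} \<inter> (T \<inter> ?S))"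
      using N3 by blast
    then have "emeasure flat_area (T \<inter> ?S) \<le> emeasure flat_area (\<Union>p\<in>N. {x. fst p \<bullet> x = snd p} \<inter> (T \<inter> ?S))"
      by (intro emeasure_mono sets.finite_UN N(1) m)
    also have "\<dots> \<le> (\<Sum>p\<in>N. emeasure flat_area ({x. fst p \<bullet> x = snd p} \<inter> (T \<inter> ?S)))"
      using m N(1) by (intro emeasure_subadditive_finite image_subsetI)
    finally show ?thesis by (simp add: case_prod_beta')
  qed
  show fin: "emeasure flat_area ?S < \<infinity>"
  proof -
    have fp: "emeasure flat_area ({x. fst p \<bullet> x = snd p} \<inter> ?S) < \<infinity>" if "p \<in> N" for p
      using flat_area_bounded_hyperplane[OF N(2)[of "fst p" "snd p"] Sb(2,1)] that by simp
    have "emeasure flat_area (UNIV \<inter> ?S) \<le> (\<Sum>(a, b)\<in>N. emeasure flat_area ({x. a \<bullet> x = b} \<inter> (UNIV \<inter> ?S)))"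
      by (rule le) simp
    also have "\<dots> < \<infinity>"
      using N(1) fp by (simp add: case_prod_beta' less_top[symmetric])
    finally show ?thesis by simp
  qed
  \<comment> \<open>The first summand serves radii up to 1. The second serves larger ones, where
    \<open>r powr (d - 1) \<ge> 1\<close> and the total area is a sufficient bound.\<close>
  define A where "A = real (card N) * (4 * 4 ^ CARD('n)) + measure flat_area ?S"
  have "upper_regular (surface ?S) A (real CARD('n) - 1)"
    unfolding upper_regular_def
  proof (intro conjI allI impI)
    show "sets (surface ?S) = sets borel" by (simp add: surface_def)
    show "0 \<le> A" by (simp add: A_def)
    fix x and r :: real assume r: "0 < r"
    let ?p = "r powr (real CARD('n) - 1)"
    show "emeasure (surface ?S) (cball x r) \<le> ennreal (A * ?p)"
    proof (cases "r \<le> 1")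
      case True
      have "emeasure flat_area (cball x r \<inter> ?S) \<le> (\<Sum>(a, b)\<in>N. emeasure flat_area ({x. a \<bullet> x = b} \<inter> (cball x r \<inter> ?S)))"
        by (rule le) simp
      also have "\<dots> \<le> (\<Sum>(a, b)\<in>N. ennreal (4 * 4 ^ CARD('n) * ?p))"
      proof (rule sum_mono, clarify)
        fix a b assume ab: "(a, b) \<in> N"
        have "emeasure flat_area ({x. a \<bullet> x = b} \<inter> (cball x r \<inter> ?S)) \<le> emeasure flat_area ({x. a \<bullet> x = b} \<inter> cball x r)"
          by (intro emeasure_mono) (auto simp: borel_closed closed_hyperplane sets.Int)
        also have "\<dots> \<le> ennreal (4 * 4 ^ CARD('n) * ?p)"
          by (rule flat_area_hyperplane_le[OF N(2)[OF ab] r True])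
        finally show "emeasure flat_area ({x. a \<bullet> x = b} \<inter> (cball x r \<inter> ?S)) \<le> ennreal (4 * 4 ^ CARD('n) * ?p)" .
      qed
      also have "\<dots> = ennreal (real (card N) * (4 * 4 ^ CARD('n) * ?p))"
        by (simp add: case_prod_beta' ennreal_mult ennreal_of_nat_eq_real_of_nat[symmetric])
      also have "\<dots> \<le> ennreal (A * ?p)"
        by (intro ennreal_leI) (simp add: A_def distrib_right)
      finally show ?thesis using Sb by (simp add: emeasure_surface)
    next
      case False
      have "emeasure flat_area (cball x r \<inter> ?S) \<le> emeasure flat_area ?S"
        using Sb by (intro emeasure_mono) auto
      also have "\<dots> = ennreal (measure flat_area ?S)"
        using fin by (simp add: emeasure_eq_ennreal_measure less_top)
      also have "\<dots> \<le> ennreal (A * ?p)"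
      proof (rule ennreal_leI)
        have "1 \<le> ?p" using False dim by (intro ge_one_powr_ge_zero) auto
        then have "measure flat_area ?S * 1 \<le> A * ?p" by (intro mult_mono) (auto simp: A_def)
        then show "measure flat_area ?S \<le> A * ?p" by simp
      qed
      finally show ?thesis using Sb by (simp add: emeasure_surface)
    qed
  qed
  then show "\<exists>A. upper_regular (surface ?S) A (real CARD('n) - 1)" by blast
qed

text \<open>Deciding by the first set that contains \<open>y\<close>, in some order, gives a Borel
  function. Measurability matters since the centre of the ball is a parameter under the surface
  integral; the value 0 is the fallback outside all sets.\<close>

lemma measurable_selection_finite:
  fixes ctr :: "'a::euclidean_space set \<Rightarrow> 'a"
  assumes "finite \<P>" "\<And>P. P \<in> \<P> \<Longrightarrow> closed P"
  shows "\<exists>c. c \<in> borel_measurable borel \<and> (\<forall>y. c y \<in> insert 0 (ctr ` \<P>)) \<and>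
    (\<forall>y\<in>\<Union>\<P>. \<exists>P\<in>\<P>. y \<in> P \<and> c y = ctr P)"
  using assms
proof (induction \<P>)
  case empty
  show ?case by (intro exI[of _ "\<lambda>_. 0"]) auto
next
  case (insert P \<P>)
  then obtain c where c: "c \<in> borel_measurable borel" "\<And>y. c y \<in> insert 0 (ctr ` \<P>)"
    "\<And>y. y \<in> \<Union>\<P> \<Longrightarrow> \<exists>P\<in>\<P>. y \<in> P \<and> c y = ctr P" by (metis insertCI)
  have [measurable]: "P \<in> sets borel" using insert by auto
  note [measurable] = c(1)
  have "(\<lambda>y. if y \<in> P then ctr P else c y) \<in> borel_measurable borel" by measurable
  then show ?case
    using c(2,3) by (intro exI[of _ "\<lambda>y. if y \<in> P then ctr P else c y"]) auto
qed

lemma polyhedral_visibility: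
  assumes G: "polyhedral_domain (G :: (real^'n::finite) set)"
  obtains c \<rho> K where "0 < \<rho>" "c \<in> borel_measurable borel" "\<And>y. norm (c y) \<le> K"
    "\<And>y z t. y \<in> frontier G \<Longrightarrow> norm (z - c y) < \<rho> \<Longrightarrow> 0 < t \<Longrightarrow> t \<le> 1 \<Longrightarrow> y + t *\<^sub>R (z - y) \<in> G"
proof -
  from polyhedral_domain_cover[OF G] obtain \<P> where \<P>: "finite \<P>"
    "\<And>P. P \<in> \<P> \<Longrightarrow> polytope P \<and> interior P \<noteq> {} \<and> interior P \<subseteq> G" "closure G = \<Union>\<P>" by blast
  have "\<exists>p r. 0 < r \<and> ball p r \<subseteq> interior P" if P: "P \<in> \<P>" for P
  proof -
    obtain p where "p \<in> interior P" using \<P>(2)[OF P] by auto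
    then show ?thesis using open_contains_ball open_interior by blast
  qed
  then obtain ctr r where cr: "\<And>P. P \<in> \<P> \<Longrightarrow> 0 < r P \<and> ball (ctr P) (r P) \<subseteq> interior P" by metis
  obtain c where c: "c \<in> borel_measurable borel" "\<And>y. c y \<in> insert 0 (ctr ` \<P>)"
    "\<And>y. y \<in> \<Union>\<P> \<Longrightarrow> \<exists>P\<in>\<P>. y \<in> P \<and> c y = ctr P"
    using measurable_selection_finite[OF \<P>(1), of ctr] \<P>(2) polytope_imp_closed by metis
  \<comment> \<open>The smallest of finitely many radii; \<open>insert 1\<close> keeps the minimum
    defined without an argument that \<open>\<P>\<close> is nonempty.\<close>
  define \<rho> where "\<rho> = Min (insert 1 (r ` \<P>))"
  have \<rho>: "0 < \<rho>" "\<And>P. P \<in> \<P> \<Longrightarrow> \<rho> \<le> r P" using \<P>(1) cr by (auto simp: \<rho>_def)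
  have "bounded (insert 0 (ctr ` \<P>))" using \<P>(1) by (intro finite_imp_bounded) auto
  then obtain K where K: "\<And>y. norm (c y) \<le> K" using c(2) unfolding bounded_iff by blast
  show ?thesis
  proof (rule that[OF \<rho>(1) c(1) K])
    fix y z :: "real^'n" and t :: real
    assume y: "y \<in> frontier G" and z: "norm (z - c y) < \<rho>" and t: "0 < t" "t \<le> 1"
    have "y \<in> \<Union>\<P>" using y \<P>(3) by (auto simp: frontier_def)
    then obtain P where P: "P \<in> \<P>" "y \<in> P" "c y = ctr P" using c(3) by blast
    have "z \<in> ball (ctr P) (r P)" using z \<rho>(2)[OF P(1)] P(3) by (simp add: dist_norm norm_minus_commute)
    then have "z \<in> interior P" using cr[OF P(1)] by blast
    moreover have "convex P" using \<P>(2)[OF P(1)] polytope_imp_convex by blast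
    \<comment> \<open>The segment from a point of a convex set to an interior point is interior
      except for its start, which \<open>t > 0\<close> excludes.\<close>
    ultimately have "y - t *\<^sub>R (y - z) \<in> interior P"
      using P(2) t by (intro mem_interior_convex_shrink) auto
    then have "y + t *\<^sub>R (z - y) \<in> interior P" by (simp add: algebra_simps)
    then show "y + t *\<^sub>R (z - y) \<in> G" using \<P>(2)[OF P(1)] by blast
  qed
qed

text \<open>Members of \<open>in_L2 (surf S)\<close> are arbitrary off \<open>S\<close>. The
  indicator makes them Borel on the whole space and changes no integral over the surface.\<close>

lemma L2_surface:
  assumes S: "S \<in> sets borel" and g: "in_L2 (surf S) g"
  shows "in_L2 (surface S) (\<lambda>x. indicator S x *\<^sub>R g x)"
    and "L2_norm (surface S) (\<lambda>x. indicator S x *\<^sub>R g x) = L2_norm (surf S) g"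
    and "\<phi> \<in> borel_measurable borel \<Longrightarrow>
      (LINT x|surface S. (indicator S x *\<^sub>R g x) \<bullet> \<phi> x) = L2_inner (surf S) g \<phi>"
proof -
  let ?g = "\<lambda>x. indicator S x *\<^sub>R g x"
  have m [measurable]: "?g \<in> borel_measurable borel"
    using in_L2_measurable[OF g] S by (subst (asm) borel_measurable_restrict_space_iff) (auto simp: measurable_def)
  have sp: "x \<in> space (surf S) \<Longrightarrow> indicator S x = (1 :: real)" for x by (simp add: space_restrict_space)
  have int: "(LINT x|surface S. h x) = (LINT x|surf S. h x)"
    if "h \<in> borel_measurable borel" for h :: "_ \<Rightarrow> real"
    unfolding surface_def by (rule integral_distr[OF id_measurable_surf that])
  have "integrable (surf S) (\<lambda>x. (norm (?g x))\<^sup>2)"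
    using g by (subst Bochner_Integration.integrable_cong[OF refl, of _ _ "\<lambda>x. (norm (g x))\<^sup>2"])
      (auto simp: in_L2_def sp)
  moreover have n: "(\<lambda>x. (norm (?g x))\<^sup>2) \<in> borel_measurable borel"
    by (rule measurable_compose[OF m, where g="\<lambda>z. (norm z)\<^sup>2"]) measurable
  ultimately have "integrable (surface S) (\<lambda>x. (norm (?g x))\<^sup>2)"
    unfolding surface_def by (simp only: integrable_distr_eq[OF id_measurable_surf n])
  moreover have "?g \<in> borel_measurable (surface S)" using m unfolding surface_def by simp
  ultimately show "in_L2 (surface S) ?g" unfolding in_L2_def by blast
  show "L2_norm (surface S) ?g = L2_norm (surf S) g"
    unfolding L2_norm_def int[OF n] by (auto intro!: Bochner_Integration.integral_cong simp: sp)
  show "(LINT x|surface S. ?g x \<bullet> \<phi> x) = L2_inner (surf S) g \<phi>" if [measurable]: "\<phi> \<in> borel_measurable borel"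
    unfolding L2_inner_def int[OF borel_measurable_inner[OF m that]]
    by (auto intro!: Bochner_Integration.integral_cong simp: sp)
qed

text \<open>\<open>C\<close> is fixed before \<open>g\<close> and depends on \<open>G\<close> alone,
  hence neither on \<open>h\<close> nor on \<open>H\<close>. No compatibility condition is imposed
  on \<open>g\<close>.\<close>

theorem polyhedral_lift:
  assumes G: "polyhedral_domain (G :: (real^'n::finite) set)" and dim: "2 \<le> CARD('n)"
  obtains C where "0 \<le> C"
    "\<And>g. in_L2 (surf (frontier G)) g \<Longrightarrow> \<exists>\<psi> f. \<psi> \<in> Hs G (1/8) \<and> weak_div G \<psi> f \<and>
      has_normal_trace G \<psi> g \<and> Hs_norm G (1/8) \<psi> + L2_norm (vol G) f \<le> C * L2_norm (surf (frontier G)) g"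
proof -
  let ?S = "frontier G"
  have Gb: "open G" "bounded G" using G by (auto intro: polyhedral_domain_open polyhedral_domain_bounded)
  have Sb: "?S \<in> sets borel" by auto
  note fin = polyhedral_surface_regular(1)[OF G dim]
  obtain A where A: "upper_regular (surface ?S) A (real CARD('n) - 1)"
    using polyhedral_surface_regular(2)[OF G dim] by blast
  obtain c \<rho> K where c: "0 < \<rho>" "c \<in> borel_measurable borel" "\<And>y. norm (c y) \<le> K"
    "\<And>y z t. y \<in> ?S \<Longrightarrow> norm (z - c y) < \<rho> \<Longrightarrow> 0 < t \<Longrightarrow> t \<le> 1 \<Longrightarrow> y + t *\<^sub>R (z - y) \<in> G"
    by (rule polyhedral_visibility[OF G]) (rule that)
  obtain \<theta> :: "real^'n \<Rightarrow> real" and B L where \<theta>: "mollifier \<theta> \<rho> B L" using mollifier_exists[OF c(1)] by blast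
  interpret mollifier \<theta> \<rho> B L by (rule \<theta>)
  obtain R where R: "0 < R" "\<And>x. x \<in> closure G \<Longrightarrow> norm x \<le> R"
    using bounded_closure[OF Gb(2)] unfolding bounded_pos by blast
  define w where "w = (\<lambda>y. if y \<in> ?S then c y - y else 0)"
  have K0: "0 \<le> K" using c(3) norm_ge_zero order_trans by blast
  have SG: "?S \<subseteq> closure G" by (auto simp: frontier_def)
  \<comment> \<open>\<open>norm (c y) \<le> K\<close> and \<open>norm y \<le> R\<close> bound the
    displacement by \<open>K + R\<close>, and two points of the closure are at most
    \<open>2 * R\<close> apart.\<close>
  interpret surface_lift \<theta> \<rho> B L "surface ?S" G ?S w "K + R + \<rho>" "2 * R" A
  proof (intro surface_lift.intro surface_lift_axioms.intro \<theta>)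
    show "2 \<le> CARD('n)" "upper_regular (surface ?S) A (real CARD('n) - 1)" by fact+
    show "finite_measure (surface ?S)"
      using fin Sb by (intro finite_measureI, subst emeasure_surface) (auto simp: surface_def)
    show "open G" "bounded G" "?S \<subseteq> closure G" by fact+
    show "?S \<inter> G = {}" using Gb(1) by (auto simp: frontier_def interior_open)
    show "AE y in surface ?S. y \<in> ?S"
      unfolding surface_def by (subst AE_distr_iff[OF id_measurable_surf]) (auto intro!: AE_I2 simp: space_restrict_space)
    have [measurable]: "c \<in> borel_measurable borel" by fact
    show "w \<in> borel_measurable borel" unfolding w_def using Sb by measurable
    show "norm (w y) + \<rho> \<le> K + R + \<rho>" for y
    proof (cases "y \<in> ?S")
      case True
      then have "norm y \<le> R" using R(2) SG by blast
      then show ?thesis using c(3)[of y] norm_triangle_ineq4[of "c y" y] True by (simp add: w_def)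
    qed (use K0 R in \<open>simp add: w_def\<close>)
    show "0 < K + R + \<rho>" "0 < 2 * R" using K0 R(1) c(1) by auto
    show "norm (x - y) \<le> 2 * R" if "x \<in> G" "y \<in> ?S" for x y
    proof -
      have "norm x \<le> R" "norm y \<le> R" using that R(2) SG closure_subset by blast+
      then show ?thesis using norm_triangle_ineq4[of x y] by linarith
    qed
    show "y + t *\<^sub>R v \<in> G" if "y \<in> ?S" "norm (v - w y) < \<rho>" "0 < t" "t \<le> 1" for y v t
      using c(4)[OF that(1) _ that(3,4), of "v + y"] that(1,2) by (simp add: w_def algebra_simps)
  qed
  from lift_exists obtain C where C: "0 \<le> C"
    "\<And>g. in_L2 (surface ?S) g \<Longrightarrow> \<exists>\<psi> f. \<psi> \<in> Hs G (1/8) \<and> weak_div G \<psi> f \<and>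
      (\<forall>\<phi> D\<phi>. C1 \<phi> D\<phi> \<longrightarrow> green G \<psi> \<phi> D\<phi> = (LINT y|surface ?S. g y * \<phi> y)) \<and>
      Hs_norm G (1/8) \<psi> + L2_norm (vol G) f \<le> C * L2_norm (surface ?S) g" by blast
  show ?thesis
  proof (rule that[OF C(1)])
    fix g :: "real^'n \<Rightarrow> real" assume g: "in_L2 (surf ?S) g"
    note s = L2_surface[OF Sb g]
    from C(2)[OF s(1)] obtain \<psi> f where \<psi>: "\<psi> \<in> Hs G (1/8)" "weak_div G \<psi> f"
      "\<And>\<phi> D\<phi>. C1 \<phi> D\<phi> \<Longrightarrow> green G \<psi> \<phi> D\<phi> = (LINT y|surface ?S. (indicator ?S y *\<^sub>R g y) * \<phi> y)"
      "Hs_norm G (1/8) \<psi> + L2_norm (vol G) f \<le> C * L2_norm (surf ?S) g"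
      unfolding s(2) by blast
    have "has_normal_trace G \<psi> g"
      unfolding has_normal_trace_def
    proof (intro conjI allI impI g)
      show "\<psi> \<in> Hdiv G" using \<psi>(2) by (auto simp: Hdiv_def)
      fix \<phi> :: "real^'n \<Rightarrow> real" and D\<phi> assume \<phi>: "C1 \<phi> D\<phi>"
      show "green G \<psi> \<phi> D\<phi> = L2_inner (surf ?S) g \<phi>"
        using \<psi>(3)[OF \<phi>] s(3)[OF C1_measurable(1)[OF \<phi>]] by simp
    qed
    with \<psi> show "\<exists>\<psi> f. \<psi> \<in> Hs G (1/8) \<and> weak_div G \<psi> f \<and>
      has_normal_trace G \<psi> g \<and> Hs_norm G (1/8) \<psi> + L2_norm (vol G) f \<le> C * L2_norm (surf ?S) g" by blast
  qed
qed

section \<open>Discrete normal traces\<close>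

text \<open>Gaussian elimination on the index \<open>i\<close> with pivot \<open>p\<close>. It is
  stated for coefficient arrays because the spaces of representatives to which it is applied are
  finite-dimensional only modulo null sets.\<close>

lemma linear_dependence:
  fixes c :: "'j \<Rightarrow> 'i \<Rightarrow> real"
  assumes "finite I" "finite J" "card I < card J"
  shows "\<exists>a. (\<exists>j\<in>J. a j \<noteq> 0) \<and> (\<forall>i\<in>I. (\<Sum>j\<in>J. a j * c j i) = 0)"
  using assms
proof (induction I arbitrary: J c rule: finite_induct)
  case empty
  then have "J \<noteq> {}" by auto
  then show ?case by (intro exI[of _ "\<lambda>_. 1"]) auto
next
  case (insert i I)
  show ?case
  proof (cases "\<forall>j\<in>J. c j i = 0")
    case True
    have "card I < card J" using insert by simp
    from insert.IH[OF insert.prems(1) this, of c] True show ?thesis by auto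
  next
    case False
    then obtain p where p: "p \<in> J" "c p i \<noteq> 0" by auto
    define J' where "J' = J - {p}"
    have J': "finite J'" "p \<notin> J'" "J = insert p J'" using insert.prems(1) p(1) by (auto simp: J'_def)
    then have "card I < card J'" using insert by simp
    from insert.IH[OF J'(1) this, of "\<lambda>j x. c j x - c j i / c p i * c p x"] obtain a where
      a: "\<exists>j\<in>J'. a j \<noteq> 0" "\<And>x. x \<in> I \<Longrightarrow> (\<Sum>j\<in>J'. a j * (c j x - c j i / c p i * c p x)) = 0" by auto
    \<comment> \<open>The coefficient of the pivot that makes the equation of \<open>i\<close>
      hold.\<close>
    define e where "e = - (\<Sum>j\<in>J'. a j * c j i) / c p i"
    have "(\<Sum>j\<in>J. (a(p := e)) j * c j x) = e * c p x + (\<Sum>j\<in>J'. a j * c j x)" for x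
      using J' by (auto intro!: sum.cong)
    moreover have "e * c p x + (\<Sum>j\<in>J'. a j * c j x) = (\<Sum>j\<in>J'. a j * (c j x - c j i / c p i * c p x))" for x
    proof -
      have "(\<Sum>j\<in>J'. a j * (c j i / c p i * c p x)) = (\<Sum>j\<in>J'. a j * c j i) / c p i * c p x"
        unfolding sum_divide_distrib sum_distrib_right by (intro sum.cong) auto
      then show ?thesis by (simp add: e_def right_diff_distrib sum_subtractf)
    qed
    moreover have "(\<Sum>j\<in>J'. a j * (c j i - c j i / c p i * c p i)) = 0" using p(2) by simp
    moreover have "\<exists>j\<in>J. (a(p := e)) j \<noteq> 0" using a(1) J' by auto
    ultimately show ?thesis using a(2) by (intro exI[of _ "a(p := e)"]) auto
  qed
qed

lemma finite_multi_indices: "finite {\<alpha> :: 'n::finite \<Rightarrow> nat. (\<Sum>i\<in>UNIV. \<alpha> i) \<le> r}"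
proof (rule finite_subset)
  show "{\<alpha> :: 'n \<Rightarrow> nat. (\<Sum>i\<in>UNIV. \<alpha> i) \<le> r} \<subseteq> PiE UNIV (\<lambda>_. {..r})"
  proof clarify
    fix \<alpha> :: "'n \<Rightarrow> nat" assume "(\<Sum>i\<in>UNIV. \<alpha> i) \<le> r"
    moreover have "\<alpha> i \<le> (\<Sum>i\<in>UNIV. \<alpha> i)" for i by (intro member_le_sum) auto
    ultimately have "\<alpha> i \<le> r" for i using le_trans by blast
    then show "\<alpha> \<in> PiE UNIV (\<lambda>_. {..r})" by (auto simp: PiE_def extensional_def)
  qed
  show "finite (PiE (UNIV :: 'n set) (\<lambda>_. {..r}))" by (intro finite_PiE) auto
qed

text \<open>Coefficients indexed by element, component and monomial determine a function of the
  space almost everywhere; their number bounds the dimension.\<close>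

lemma pw_poly_finite_dim:
  fixes V :: "(real^'n::finite \<Rightarrow> 'b::euclidean_space) set"
  assumes V: "pw_poly_space M \<T> r V" and T: "finite \<T>" "space M \<subseteq> \<Union>\<T>"
  shows "\<exists>N :: nat. \<forall>(J :: nat set) q. finite J \<and> N < card J \<and> (\<forall>j\<in>J. q j \<in> V) \<longrightarrow>
    (\<exists>a. (\<exists>j\<in>J. a j \<noteq> 0) \<and> (AE x in M. (\<Sum>j\<in>J. a j *\<^sub>R q j x) = 0))"
proof -
  define MI where "MI = {\<alpha> :: 'n \<Rightarrow> nat. (\<Sum>i\<in>UNIV. \<alpha> i) \<le> r}"
  define I where "I = \<T> \<times> (Basis :: 'b set) \<times> MI"
  have I: "finite I" using T by (simp add: I_def MI_def finite_multi_indices)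
  define X where "X = (\<lambda>\<alpha> (x :: real^'n). \<Prod>i\<in>UNIV. (x $ i) ^ \<alpha> i)"
  show ?thesis
  proof (intro exI[of _ "card I"] allI impI)
    fix J :: "nat set" and q assume "finite J \<and> card I < card J \<and> (\<forall>j\<in>J. q j \<in> V)"
    then have J: "finite J" "card I < card J" "\<And>j. j \<in> J \<Longrightarrow> q j \<in> V" by auto
    define Q where "Q = (\<lambda>j E p c. (\<forall>b\<in>Basis. \<forall>x. p x \<bullet> b = (\<Sum>\<alpha>\<in>MI. c b \<alpha> * X \<alpha> x)) \<and>
      (AE x in M. x \<in> E \<longrightarrow> q j x = p x))"
    have "\<exists>p c. Q j E p c"
      if jE: "j \<in> J" "E \<in> \<T>" for j E
    proof -
      obtain p where p: "\<And>b. b \<in> Basis \<Longrightarrow> poly_deg_le r (\<lambda>x. p x \<bullet> b)" "AE x in M. x \<in> E \<longrightarrow> q j x = p x"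
        using V J(3)[OF jE(1)] jE(2) unfolding pw_poly_space_def by meson
      have "\<forall>b\<in>Basis. \<exists>c. \<forall>x. p x \<bullet> b = (\<Sum>\<alpha>\<in>MI. c \<alpha> * X \<alpha> x)"
        using p(1) by (simp add: poly_deg_le_def MI_def X_def)
      from bchoice[OF this] obtain c where "\<forall>b\<in>Basis. \<forall>x. p x \<bullet> b = (\<Sum>\<alpha>\<in>MI. c b \<alpha> * X \<alpha> x)" ..
      then have "Q j E p c" using p(2) by (simp add: Q_def)
      then show ?thesis by blast
    qed
    then obtain p c where Q: "\<And>j E. j \<in> J \<Longrightarrow> E \<in> \<T> \<Longrightarrow> Q j E (p j E) (c j E)" by metis
    have pc: "\<And>j E b x. j \<in> J \<Longrightarrow> E \<in> \<T> \<Longrightarrow> b \<in> Basis \<Longrightarrow> p j E x \<bullet> b = (\<Sum>\<alpha>\<in>MI. c j E b \<alpha> * X \<alpha> x)"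
      "\<And>j E. j \<in> J \<Longrightarrow> E \<in> \<T> \<Longrightarrow> AE x in M. x \<in> E \<longrightarrow> q j x = p j E x"
      using Q by (auto simp: Q_def)
    obtain a where a: "\<exists>j\<in>J. a j \<noteq> 0"
      "\<And>i. i \<in> I \<Longrightarrow> (\<Sum>j\<in>J. a j * (case i of (E, b, \<alpha>) \<Rightarrow> c j E b \<alpha>)) = 0"
      using linear_dependence[OF I J(1,2), of "\<lambda>j (E, b, \<alpha>). c j E b \<alpha>"] by blast
    have zero: "(\<Sum>j\<in>J. a j *\<^sub>R p j E x) = 0" if E: "E \<in> \<T>" for E x
    proof (rule euclidean_eqI)
      fix b :: 'b assume b: "b \<in> Basis"
      have "(\<Sum>j\<in>J. a j *\<^sub>R p j E x) \<bullet> b = (\<Sum>j\<in>J. \<Sum>\<alpha>\<in>MI. a j * (c j E b \<alpha> * X \<alpha> x))"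
        using E b pc(1) by (simp add: inner_sum_left sum_distrib_left)
      also have "\<dots> = (\<Sum>\<alpha>\<in>MI. (\<Sum>j\<in>J. a j * c j E b \<alpha>) * X \<alpha> x)"
        by (subst sum.swap) (simp add: sum_distrib_right mult.assoc)
      also have "\<dots> = 0"
      proof (intro sum.neutral ballI)
        fix \<alpha> assume "\<alpha> \<in> MI"
        then show "(\<Sum>j\<in>J. a j * c j E b \<alpha>) * X \<alpha> x = 0"
          using a(2)[of "(E, b, \<alpha>)"] E b by (simp add: I_def)
      qed
      finally show "(\<Sum>j\<in>J. a j *\<^sub>R p j E x) \<bullet> b = 0 \<bullet> b" by simp
    qed
    have "AE x in M. \<forall>E\<in>\<T>. \<forall>j\<in>J. x \<in> E \<longrightarrow> q j x = p j E x"
      using T(1) J(1) pc(2) by (intro AE_finite_allI) auto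
    then have "AE x in M. (\<Sum>j\<in>J. a j *\<^sub>R q j x) = 0"
      using AE_space
    proof eventually_elim
      case (elim x)
      then obtain E where E: "E \<in> \<T>" "x \<in> E" using T(2) by blast
      then have "(\<Sum>j\<in>J. a j *\<^sub>R q j x) = (\<Sum>j\<in>J. a j *\<^sub>R p j E x)"
        using elim(1) by (intro sum.cong) auto
      then show ?case using zero[OF E(1)] by simp
    qed
    with a(1) show "\<exists>a. (\<exists>j\<in>J. a j \<noteq> 0) \<and> (AE x in M. (\<Sum>j\<in>J. a j *\<^sub>R q j x) = 0)" by blast
  qed
qed

text \<open>A maximal orthonormal family exists by finite dimension, and it yields the projection.\<close>

lemma L2_proj_exists:
  fixes V :: "('a \<Rightarrow> real) set"
  assumes L2: "\<And>v. v \<in> V \<Longrightarrow> in_L2 M v" and zero: "(\<lambda>x. 0) \<in> V"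
    and lin: "\<And>u v a b. u \<in> V \<Longrightarrow> v \<in> V \<Longrightarrow> (\<lambda>x. a * u x + b * v x) \<in> V"
    and dim: "\<And>J v. finite J \<Longrightarrow> N < card J \<Longrightarrow> (\<And>j. j \<in> J \<Longrightarrow> v j \<in> V) \<Longrightarrow>
      \<exists>a. (\<exists>j\<in>(J :: nat set). a j \<noteq> 0) \<and> (AE x in M. (\<Sum>j\<in>J. a j * v j x) = 0)"
    and f: "in_L2 M f"
  shows "L2_proj M V f \<in> V" "v \<in> V \<Longrightarrow> L2_inner M (\<lambda>x. f x - L2_proj M V f x) v = 0"
proof -
  have scale: "L2_inner M (\<lambda>x. c * h x) u = c * L2_inner M h u" for c u and h :: "'a \<Rightarrow> real"
    using L2_inner_scaleR_left[of M c h u] by simp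
  define ON where "ON = (\<lambda>n (e :: nat \<Rightarrow> 'a \<Rightarrow> real). (\<forall>i<n. e i \<in> V) \<and>
    (\<forall>i<n. \<forall>j<n. L2_inner M (e i) (e j) = (if i = j then 1 else 0)))"
  have sumV: "(\<lambda>x. \<Sum>i<n. a i * e i x) \<in> V" if "\<And>i. i < n \<Longrightarrow> e i \<in> V" for n a and e :: "nat \<Rightarrow> 'a \<Rightarrow> real"
    using that
  proof (induction n)
    case (Suc n)
    from lin[where a=1 and b="a n", OF Suc.IH Suc.prems[of n]] Suc.prems show ?case by simp
  qed (simp add: zero)
  have inner_sum: "L2_inner M (\<lambda>x. \<Sum>i<n. a i * e i x) u = (\<Sum>i<n. a i * L2_inner M (e i) u)"
    if "\<And>i. i < n \<Longrightarrow> e i \<in> V" "in_L2 M u" for n a u and e :: "nat \<Rightarrow> 'a \<Rightarrow> real"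
  proof -
    have "L2_inner M (\<lambda>x. \<Sum>i<n. a i * e i x) u = (\<Sum>i<n. L2_inner M (\<lambda>x. a i * e i x) u)"
      using that L2 by (intro L2_inner_sum_left in_L2_mult_real) auto
    then show ?thesis by (simp add: scale)
  qed
  \<comment> \<open>Pairing a linear dependence with \<open>e j\<close> isolates the coefficient
    \<open>a j\<close>.\<close>
  have bound: "n \<le> N" if e: "ON n e" for n e
  proof (rule ccontr)
    assume "\<not> n \<le> N"
    then obtain a where a: "\<exists>j<n. a j \<noteq> 0" "AE x in M. (\<Sum>j<n. a j * e j x) = 0"
      using dim[of "{..<n}" e] e by (auto simp: ON_def)
    then obtain j where j: "j < n" "a j \<noteq> 0" by auto
    have "L2_inner M (\<lambda>x. \<Sum>j<n. a j * e j x) (e j) = 0"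
      unfolding L2_inner_def using a(2) by (intro integral_eq_zero_AE) auto
    moreover have "L2_inner M (\<lambda>x. \<Sum>j<n. a j * e j x) (e j) = (\<Sum>i<n. a i * L2_inner M (e i) (e j))"
      using e L2 j(1) by (intro inner_sum) (auto simp: ON_def)
    moreover have "\<dots> = (\<Sum>i<n. if i = j then a j else 0)"
      using e j(1) by (intro sum.cong) (auto simp: ON_def)
    ultimately show False using j by simp
  qed
  define NS where "NS = {n. \<exists>e. ON n e}"
  have NS: "finite NS" using bound by (intro finite_subset[of NS "{..N}"]) (auto simp: NS_def)
  have "0 \<in> NS" by (simp add: NS_def ON_def)
  then have "Max NS \<in> NS" using NS by (intro Max_in) auto
  then obtain e where e': "ON (Max NS) e" by (auto simp: NS_def)
  define n where "n = Max NS"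
  have e: "ON n e" using e' by (simp add: n_def)
  have max: "m \<le> n" if "ON m e" for m e using that NS unfolding n_def by (intro Max_ge) (auto simp: NS_def)
  have eV: "e i \<in> V" if "i < n" for i using e that by (simp add: ON_def)
  have ee: "L2_inner M (e i) (e j) = (if i = j then 1 else 0)" if "i < n" "j < n" for i j
    using e that by (simp add: ON_def)
  define P where "P = (\<lambda>h x. \<Sum>i<n. L2_inner M h (e i) * e i x)"
  have PV: "P h \<in> V" for h unfolding P_def by (rule sumV) (rule eV)
  have Pe: "L2_inner M (P h) (e j) = L2_inner M h (e j)" if "j < n" for h j
  proof -
    have "L2_inner M (P h) (e j) = (\<Sum>i<n. L2_inner M h (e i) * L2_inner M (e i) (e j))"
      unfolding P_def using that eV L2 by (intro inner_sum) auto
    also have "\<dots> = (\<Sum>i<n. if i = j then L2_inner M h (e j) else 0)"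
      using ee that by (intro sum.cong) auto
    finally show ?thesis using that by simp
  qed
  \<comment> \<open>Otherwise the normalised remainder would extend the family beyond its maximal
    length. The expansion holds almost everywhere only, as \<open>V\<close> consists of
    representatives.\<close>
  have self: "AE x in M. v x = P v x" if v: "v \<in> V" for v
  proof -
    define u where "u = (\<lambda>x. v x - P v x)"
    have u: "u \<in> V" using lin[where a=1 and b="-1", OF v PV[of v]] by (simp add: u_def)
    have ue: "L2_inner M u (e j) = 0" if "j < n" for j
      unfolding u_def using L2_inner_diff_left[OF L2[OF v] L2[OF PV] L2[OF eV[OF that]]] Pe[OF that] by simp
    have "L2_norm M u = 0"
    proof (rule ccontr)
      assume nz: "L2_norm M u \<noteq> 0"
      define k where "k = inverse (L2_norm M u)"
      define e' where "e' = e(n := (\<lambda>x. k * u x))"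
      have kn: "k * k * (L2_norm M u)\<^sup>2 = 1" using nz by (simp add: k_def power2_eq_square field_simps)
      have s: "L2_inner M (\<lambda>x. k * u x) h = k * L2_inner M u h" for h
        by (rule scale)
      have "(\<lambda>x. k * u x) \<in> V" using lin[where a=k and b=0, OF u zero] by simp
      moreover have "L2_inner M (\<lambda>x. k * u x) (\<lambda>x. k * u x) = 1"
        using kn unfolding s by (subst L2_inner_commute) (simp add: s L2_norm_power2_eq_inner mult.assoc)
      moreover have "L2_inner M (\<lambda>x. k * u x) (e i) = 0" "L2_inner M (e i) (\<lambda>x. k * u x) = 0" if "i < n" for i
        using ue[OF that] L2_inner_commute[of M "e i"] by (simp_all add: s)
      ultimately have "ON (Suc n) e'"
        using eV ee by (auto simp: ON_def e'_def less_Suc_eq)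
      from max[OF this] show False by simp
    qed
    then have "AE x in M. u x = 0" using L2_norm_eq_0_iff[OF L2[OF u]] by simp
    then show ?thesis by eventually_elim (simp add: u_def)
  qed
  have orth: "L2_inner M (\<lambda>x. f x - P f x) v = 0" if v: "v \<in> V" for v
  proof -
    let ?h = "\<lambda>x. f x - P f x"
    have h: "in_L2 M ?h" using f L2[OF PV] by (rule in_L2_diff)
    have "L2_inner M ?h v = L2_inner M v ?h" by (rule L2_inner_commute)
    also have "\<dots> = L2_inner M (P v) ?h"
      using self[OF v] L2[OF v] L2[OF PV] h by (intro L2_inner_cong_AE) (auto simp: in_L2_def)
    also have "\<dots> = (\<Sum>i<n. L2_inner M v (e i) * L2_inner M (e i) ?h)"
    proof -
      have Pv: "P v = (\<lambda>x. \<Sum>i<n. L2_inner M v (e i) * e i x)" by (simp add: P_def)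
      show ?thesis unfolding Pv using eV h by (intro inner_sum) auto
    qed
    also have "\<dots> = 0"
    proof (intro sum.neutral ballI)
      fix i assume "i \<in> {..<n}"
      then have i: "i < n" by simp
      have "L2_inner M ?h (e i) = 0"
        using L2_inner_diff_left[OF f L2[OF PV] L2[OF eV[OF i]]] Pe[OF i] by simp
      then show "L2_inner M v (e i) * L2_inner M (e i) ?h = 0" by (simp add: L2_inner_commute[of M "e i"])
    qed
    finally show ?thesis .
  qed
  \<comment> \<open>\<open>L2_proj\<close> is a choice; exhibiting one projection makes its defining
    property available.\<close>
  have "L2_proj M V f \<in> V \<and> (\<forall>v\<in>V. L2_inner M (\<lambda>x. f x - L2_proj M V f x) v = 0)"
    unfolding L2_proj_def by (rule someI[of _ "P f"]) (use PV orth in blast)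
  then show "L2_proj M V f \<in> V" "v \<in> V \<Longrightarrow> L2_inner M (\<lambda>x. f x - L2_proj M V f x) v = 0" by auto
qed

section \<open>Linear relations between normal traces and projection onto them\<close>

lemma has_normal_trace_zero:
  assumes G: "open (G :: (real^'n::finite) set)" "bounded G"
  shows "has_normal_trace G (\<lambda>x. 0) (\<lambda>x. 0)"
proof -
  have wd: "weak_div G (\<lambda>x. 0) (\<lambda>x. 0)" by (simp add: weak_div_def in_L2_zero)
  then show ?thesis
    unfolding has_normal_trace_def
    by (auto simp: Hdiv_def in_L2_zero green_eq[OF G wd] L2_inner_def)
qed

lemma has_normal_trace_sum:
  fixes G :: "(real^'n::finite) set"
  assumes G: "open G" "bounded G" and fin: "emeasure flat_area (frontier G) < \<infinity>"
    and J: "finite J" "\<And>j. j \<in> J \<Longrightarrow> has_normal_trace G (q j) (v j)"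
  shows "has_normal_trace G (\<lambda>x. \<Sum>j\<in>J. a j *\<^sub>R q j x) (\<lambda>x. \<Sum>j\<in>J. a j * v j x)"
  using J
proof (induction J)
  case empty
  show ?case using has_normal_trace_zero[OF G] by simp
next
  case (insert j J)
  have "has_normal_trace G (\<lambda>x. a j *\<^sub>R q j x + 1 *\<^sub>R (\<Sum>j\<in>J. a j *\<^sub>R q j x))
      (\<lambda>x. a j * v j x + 1 * (\<Sum>j\<in>J. a j * v j x))"
    using insert by (intro has_normal_trace_lincomb[OF G fin]) auto
  then show ?case using insert(1,2) by simp
qed

lemma pw_poly_lincomb:
  assumes V: "pw_poly_space M \<T> r V" and fg: "f \<in> V" "g \<in> V"
  shows "(\<lambda>x. a *\<^sub>R f x + b *\<^sub>R g x) \<in> V"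
proof -
  have "\<forall>f\<in>V. \<forall>g\<in>V. \<forall>a b. (\<lambda>x. a *\<^sub>R f x + b *\<^sub>R g x) \<in> V"
    using V unfolding pw_poly_space_def by (elim conjE)
  from bspec[OF bspec[OF this fg(1)] fg(2)] show ?thesis by simp
qed

text \<open>\<open>L2_proj\<close> is meaningful only if a projection exists, hence the finite
  dimension of the trace space is needed: by \<open>normal_trace_unique\<close> a linear dependence
  among fields in \<open>Z\<close> passes to their traces.\<close>

lemma trace_projection:
  fixes G :: "(real^'n::finite) set"
  assumes G: "polyhedral_domain G" and dim: "2 \<le> CARD('n)"
    and T: "fe_partition \<kappa> G \<T>" and Z: "pw_poly_space (vol G) \<T> r Z"
    and f: "in_L2 (surf (frontier G)) f"
  defines "V \<equiv> trace_space G Z"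
  shows "L2_proj (surf (frontier G)) V f \<in> V"
    and "v \<in> V \<Longrightarrow> L2_inner (surf (frontier G)) (\<lambda>x. f x - L2_proj (surf (frontier G)) V f x) v = 0"
proof -
  let ?M = "surf (frontier G)"
  have Gb: "open G" "bounded G" using G by (auto intro: polyhedral_domain_open polyhedral_domain_bounded)
  note fin = polyhedral_surface_regular(1)[OF G dim]
  have fT: "finite \<T>" "space (vol G) \<subseteq> \<Union>\<T>"
    using T closure_subset[of G] by (auto simp: fe_partition_def space_restrict_space)
  obtain N where N: "\<forall>(J :: nat set) q. finite J \<and> N < card J \<and> (\<forall>j\<in>J. q j \<in> Z) \<longrightarrow>
    (\<exists>a. (\<exists>j\<in>J. a j \<noteq> 0) \<and> (AE x in vol G. (\<Sum>j\<in>J. a j *\<^sub>R q j x) = 0))"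
    using pw_poly_finite_dim[OF Z fT] ..
  have L2: "in_L2 ?M v" if "v \<in> V" for v
    using that by (auto simp: V_def trace_space_def has_normal_trace_def)
  have "(\<lambda>x. 0) \<in> Z" using Z by (simp add: pw_poly_space_def)
  then have zero: "(\<lambda>x. 0) \<in> V"
    unfolding V_def trace_space_def using has_normal_trace_zero[OF Gb] by blast
  have lin: "(\<lambda>x. a * u x + b * v x) \<in> V" if uv: "u \<in> V" "v \<in> V" for u v a b
  proof -
    obtain p q where pq: "p \<in> Z" "q \<in> Z" "has_normal_trace G p u" "has_normal_trace G q v"
      using uv by (auto simp: V_def trace_space_def)
    have "(\<lambda>x. a *\<^sub>R p x + b *\<^sub>R q x) \<in> Z" by (rule pw_poly_lincomb[OF Z pq(1,2)])
    with has_normal_trace_lincomb[OF Gb fin pq(3,4)] show ?thesis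
      unfolding V_def trace_space_def by blast
  qed
  have dimV: "\<exists>a. (\<exists>j\<in>J. a j \<noteq> 0) \<and> (AE x in ?M. (\<Sum>j\<in>J. a j * v j x) = 0)"
    if J: "finite J" "N < card J" "\<And>j. j \<in> J \<Longrightarrow> v j \<in> V" for J :: "nat set" and v
  proof -
    have "\<forall>j\<in>J. \<exists>q. q \<in> Z \<and> has_normal_trace G q (v j)"
      using J(3) by (auto simp: V_def trace_space_def)
    from bchoice[OF this] obtain q where q: "\<And>j. j \<in> J \<Longrightarrow> q j \<in> Z" "\<And>j. j \<in> J \<Longrightarrow> has_normal_trace G (q j) (v j)"
      by blast
    from N[rule_format, of J q] J(1,2) q(1) obtain a where a: "\<exists>j\<in>J. a j \<noteq> 0" "AE x in vol G. (\<Sum>j\<in>J. a j *\<^sub>R q j x) = 0"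
      by blast
    have "AE x in ?M. (\<Sum>j\<in>J. a j * v j x) = 0"
      by (rule normal_trace_unique[OF Gb fin has_normal_trace_sum[OF Gb fin J(1) q(2)] has_normal_trace_zero[OF Gb] a(2)])
    with a(1) show ?thesis by blast
  qed
  show "L2_proj ?M V f \<in> V" "v \<in> V \<Longrightarrow> L2_inner ?M (\<lambda>x. f x - L2_proj ?M V f x) v = 0"
    by (rule L2_proj_exists[OF L2 zero lin dimV f]; assumption)+
qed

section \<open>Extension by zero and restriction to parts of the boundary\<close>

lemma integral_vol_subset:
  fixes h :: "real^'n::finite \<Rightarrow> real"
  assumes "open G" "open \<Omega>" "G \<subseteq> \<Omega>"
  shows "(LINT x|vol \<Omega>. indicator G x * h x) = (LINT x|vol G. h x)"
  using assms by (subst (1 2) integral_restrict_space)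
    (auto intro!: Bochner_Integration.integral_cong simp: indicator_def)

lemma in_L2_vol_extend:
  fixes h :: "real^'n::finite \<Rightarrow> 'b::euclidean_space"
  assumes G: "open G" "open \<Omega>" "G \<subseteq> \<Omega>" and h: "in_L2 (vol G) h"
  shows "in_L2 (vol \<Omega>) (\<lambda>x. indicator G x *\<^sub>R h x)"
  unfolding in_L2_def
proof
  have m: "(\<lambda>x. indicator G x *\<^sub>R h x) \<in> borel_measurable borel"
    using in_L2_measurable[OF h] G by (subst (asm) borel_measurable_restrict_space_iff) auto
  then show "(\<lambda>x. indicator G x *\<^sub>R h x) \<in> borel_measurable (vol \<Omega>)"
    by (intro measurable_restrict_space1) simp
  have "integrable lborel (\<lambda>x. indicator G x *\<^sub>R (norm (h x))\<^sup>2)"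
    using h G by (subst (asm) in_L2_def) (simp add: integrable_restrict_space)
  moreover have "indicator G x *\<^sub>R (norm (h x))\<^sup>2 = indicator \<Omega> x *\<^sub>R (norm (indicator G x *\<^sub>R h x))\<^sup>2" for x
    using G(3) by (auto simp: indicator_def)
  ultimately show "integrable (vol \<Omega>) (\<lambda>x. (norm (indicator G x *\<^sub>R h x))\<^sup>2)"
    using G by (subst integrable_restrict_space) auto
qed

text \<open>
  The difference of two fields with the same normal trace, extended by zero, has a weak divergence
  and no normal trace on the outer boundary.
\<close>

lemma restrict_to_same_trace:
  fixes G \<Omega> :: "(real^'n::finite) set"
  assumes G: "open G" "bounded G" and \<Omega>: "open \<Omega>" "bounded \<Omega>" "G \<subseteq> \<Omega>"
    and u: "u \<in> Hdiv \<Omega>" "normal_zero_on \<Omega> S u" and q: "AE x in vol G. q x = u x"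
    and tr: "has_normal_trace G q g" "has_normal_trace G \<psi> g"
  shows "\<psi> \<in> restrict_to G {q \<in> Hdiv \<Omega>. normal_zero_on \<Omega> S q}"
proof -
  have qpsi: "q \<in> Hdiv G" "\<psi> \<in> Hdiv G" using tr by (auto simp: has_normal_trace_def)
  obtain f where f: "weak_div G (\<lambda>x. \<psi> x - q x) f"
    using Hdiv_lincomb[OF G qpsi(2,1), of 1 "-1"] by (auto simp: Hdiv_def)
  then have L2: "in_L2 (vol G) (\<lambda>x. \<psi> x - q x)" "in_L2 (vol G) f" by (auto simp: weak_div_def)
  define d where "d = (\<lambda>x. indicator G x *\<^sub>R (\<psi> x - q x))"
  define fd where "fd = (\<lambda>x. indicator G x *\<^sub>R f x)"
  have L2d: "in_L2 (vol \<Omega>) d" "in_L2 (vol \<Omega>) fd"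
    unfolding d_def fd_def by (intro in_L2_vol_extend G \<Omega> L2)+
  \<comment> \<open>This holds for tests that do not vanish on the boundary of \<open>G\<close>;
    therefore the extension by zero has no jump term.\<close>
  have gr0: "(LINT x|vol G. (\<psi> x - q x) \<bullet> D\<phi> x) + (LINT x|vol G. f x * \<phi> x) = 0"
    if \<phi>: "C1 \<phi> D\<phi>" for \<phi> :: "real^'n \<Rightarrow> real" and D\<phi>
  proof -
    have "green G (\<lambda>x. 1 *\<^sub>R \<psi> x + (-1) *\<^sub>R q x) \<phi> D\<phi> = 1 * green G \<psi> \<phi> D\<phi> + (-1) * green G q \<phi> D\<phi>"
      by (rule green_lincomb[OF G qpsi(2,1) \<phi>])
    also have "\<dots> = 0" using tr \<phi> by (auto simp: has_normal_trace_def)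
    finally have "green G (\<lambda>x. \<psi> x - q x) \<phi> D\<phi> = 0" by simp
    then show ?thesis using green_eq[OF G f \<phi>] by simp
  qed
  have d1: "(LINT x|vol \<Omega>. d x \<bullet> D\<phi> x) = (LINT x|vol G. (\<psi> x - q x) \<bullet> D\<phi> x)"
    and d2: "(LINT x|vol \<Omega>. fd x * \<phi> x) = (LINT x|vol G. f x * \<phi> x)" for \<phi> :: "real^'n \<Rightarrow> real" and D\<phi>
    using integral_vol_subset[OF G(1) \<Omega>(1,3), of "\<lambda>x. (\<psi> x - q x) \<bullet> D\<phi> x"]
      integral_vol_subset[OF G(1) \<Omega>(1,3), of "\<lambda>x. f x * \<phi> x"]
    by (simp_all add: d_def fd_def mult.assoc)
  have wd: "weak_div \<Omega> d fd"
    unfolding weak_div_def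
  proof (intro conjI L2d allI impI)
    fix \<phi> D\<phi> assume "C1_compact \<Omega> \<phi> D\<phi>"
    then have "C1 \<phi> D\<phi>" by (simp add: C1_compact_def)
    from gr0[OF this] show "(LINT x|vol \<Omega>. d x \<bullet> D\<phi> x) = - (LINT x|vol \<Omega>. fd x * \<phi> x)"
      by (simp add: d1 d2)
  qed
  then have dH: "d \<in> Hdiv \<Omega>" by (auto simp: Hdiv_def)
  \<comment> \<open>Equal to \<open>\<psi>\<close> almost everywhere in \<open>G\<close>, since
    \<open>u = q\<close> there, and to \<open>u\<close> in the rest of
    \<open>\<Omega>\<close>.\<close>
  define u' where "u' = (\<lambda>x. 1 *\<^sub>R u x + 1 *\<^sub>R d x)"
  have u'H: "u' \<in> Hdiv \<Omega>" unfolding u'_def by (rule Hdiv_lincomb[OF \<Omega>(1,2) u(1) dH])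
  have "green \<Omega> u' \<phi> D\<phi> = green \<Omega> u \<phi> D\<phi>" if \<phi>: "C1 \<phi> D\<phi>" for \<phi> D\<phi>
    using green_lincomb[OF \<Omega>(1,2) u(1) dH \<phi>, of 1 1] green_eq[OF \<Omega>(1,2) wd \<phi>] gr0[OF \<phi>]
    by (simp add: u'_def d1 d2)
  then have "normal_zero_on \<Omega> S u'" using u(2) u'H by (auto simp: normal_zero_on_def)
  moreover have "AE x in vol G. \<psi> x = u' x"
    using q AE_space by eventually_elim (simp add: u'_def d_def space_restrict_space)
  moreover have "in_L2 (vol G) \<psi>" using qpsi(2) by (auto simp: Hdiv_def weak_div_def)
  ultimately show ?thesis using u'H by (auto simp: restrict_to_def)
qed

lemma in_L2_surf_extend:
  fixes \<mu> :: "real^'n::finite \<Rightarrow> 'b::euclidean_space"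
  assumes A: "A \<in> sets borel" and B: "B \<in> sets borel"
    and \<mu>: "in_L2 (surf A) \<mu>" "\<And>x. x \<notin> A \<Longrightarrow> \<mu> x = 0"
  shows "in_L2 (surf B) \<mu>"
  unfolding in_L2_def
proof
  have ind: "indicator A x *\<^sub>R \<mu> x = \<mu> x" for x using \<mu>(2) by (auto simp: indicator_def)
  have "\<mu> \<in> borel_measurable flat_area"
    using in_L2_measurable[OF \<mu>(1)] A by (subst (asm) borel_measurable_restrict_space_iff) (auto simp: ind)
  then show "\<mu> \<in> borel_measurable (surf B)" by (rule measurable_restrict_space1)
  have "integrable flat_area (\<lambda>x. indicator A x *\<^sub>R (norm (\<mu> x))\<^sup>2)"
    using \<mu>(1) A by (subst (asm) in_L2_def) (simp add: integrable_restrict_space)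
  moreover have "indicator A x *\<^sub>R (norm (\<mu> x))\<^sup>2 = (norm (\<mu> x))\<^sup>2" for x using \<mu>(2) by (auto simp: indicator_def)
  ultimately have "integrable flat_area (\<lambda>x. (norm (\<mu> x))\<^sup>2)" by (simp only:)
  then show "integrable (surf B) (\<lambda>x. (norm (\<mu> x))\<^sup>2)"
    using B integrable_mult_indicator[of B flat_area "\<lambda>x. (norm (\<mu> x))\<^sup>2"] by (simp add: integrable_restrict_space)
qed

lemma L2_inner_surf_Int:
  fixes f g :: "real^'n::finite \<Rightarrow> real"
  assumes "A \<in> sets borel" "B \<in> sets borel" and g: "\<And>x. x \<notin> B \<Longrightarrow> g x = 0"
  shows "L2_inner (surf (A \<inter> B)) f g = L2_inner (surf A) f g"
  unfolding L2_inner_def using assms(1,2)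
  by (subst (1 2) integral_restrict_space) (auto intro!: Bochner_Integration.integral_cong simp: indicator_def g)

lemma L2_norm_surf_mono:
  fixes f :: "real^'n::finite \<Rightarrow> real"
  assumes "A \<in> sets borel" "B \<in> sets borel" "A \<subseteq> B" "in_L2 (surf B) f"
  shows "L2_norm (surf A) f \<le> L2_norm (surf B) f"
proof -
  have int: "integrable flat_area (\<lambda>x. indicator B x *\<^sub>R (f x)\<^sup>2)"
    using assms by (subst (asm) in_L2_def) (simp add: integrable_restrict_space)
  moreover have "integrable flat_area (\<lambda>x. indicator A x *\<^sub>R (f x)\<^sup>2)"
  proof -
    have *: "(\<lambda>x. indicator A x *\<^sub>R (indicator B x *\<^sub>R (f x)\<^sup>2)) = (\<lambda>x. indicator A x *\<^sub>R (f x)\<^sup>2)"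
      using assms(3) by (auto simp: indicator_def fun_eq_iff)
    have "A \<in> sets flat_area" using assms(1) by simp
    from integrable_mult_indicator[OF this int] show ?thesis by (simp only: *)
  qed
  ultimately have "(LINT x|flat_area. indicator A x *\<^sub>R (f x)\<^sup>2) \<le> (LINT x|flat_area. indicator B x *\<^sub>R (f x)\<^sup>2)"
    using assms(3) by (intro integral_mono) (auto simp: indicator_def)
  then show ?thesis
    unfolding L2_norm_def using assms(1,2) by (simp add: integral_restrict_space)
qed

section \<open>The inf-sup bound\<close>

lemma Gamma_all_closed: "closed (Gamma_all \<G>)"
  unfolding Gamma_all_def Gamma_ij_def by (intro closed_UN closed_Int frontier_closed) auto

text \<open>Inclusion in the closure becomes inclusion in the domain because subdomains are open and
  \<open>Omega \<G>\<close> is the interior of its closure.\<close>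

lemma admissible_subdomain:
  assumes "admissible_geometry \<G>" "i < n_sub \<G>"
  shows "polyhedral_domain (Omega_sub \<G> i)" "Omega_sub \<G> i \<subseteq> Omega \<G>"
proof -
  show "polyhedral_domain (Omega_sub \<G> i)" using assms by (auto simp: admissible_geometry_def)
  then have "open (Omega_sub \<G> i)" by (rule polyhedral_domain_open)
  moreover have "Omega_sub \<G> i \<subseteq> closure (Omega \<G>)"
    using assms closure_subset by (fastforce simp: admissible_geometry_def)
  ultimately have "Omega_sub \<G> i \<subseteq> interior (closure (Omega \<G>))" by (intro interior_maximal)
  then show "Omega_sub \<G> i \<subseteq> Omega \<G>" using assms by (auto simp: admissible_geometry_def polyhedral_domain_def)
qed

lemma in_L2_surf_subset:
  fixes h :: "real^'n::finite \<Rightarrow> 'b::euclidean_space"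
  assumes AB: "A \<in> sets borel" "B \<in> sets borel" "A \<subseteq> B" and h: "in_L2 (surf B) h"
  shows "in_L2 (surf A) h"
proof -
  have ind: "indicator A x *\<^sub>R (indicator B x *\<^sub>R y) = indicator A x *\<^sub>R y" for x and y :: "'c::real_vector"
    using AB(3) by (auto simp: indicator_def)
  have mB: "(\<lambda>x. indicator B x *\<^sub>R h x) \<in> borel_measurable flat_area"
    using in_L2_measurable[OF h] AB by (subst (asm) borel_measurable_restrict_space_iff) auto
  have mA: "(indicator A :: _ \<Rightarrow> real) \<in> borel_measurable flat_area" using AB(1) by (intro borel_measurable_indicator) simp
  from borel_measurable_scaleR[OF mA mB] have m: "h \<in> borel_measurable (surf A)"
    unfolding ind using AB by (subst borel_measurable_restrict_space_iff) auto
  have int: "integrable flat_area (\<lambda>x. indicator B x *\<^sub>R (norm (h x))\<^sup>2)"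
    using h AB by (subst (asm) in_L2_def) (simp add: integrable_restrict_space)
  have "A \<in> sets flat_area" using AB(1) by simp
  from integrable_mult_indicator[OF this int] have "integrable (surf A) (\<lambda>x. (norm (h x))\<^sup>2)"
    unfolding ind using AB by (subst integrable_restrict_space) auto
  then show ?thesis using m by (simp add: in_L2_def)
qed

lemma Hdiv_norm_eq:
  assumes "open G" "bounded G" "weak_div G q f"
  shows "L2_norm (vol G) (dvg G q) = L2_norm (vol G) f"
  using dvg_AE_eq[OF assms] weak_div_dvg[of q G] assms(3)
  by (intro L2_norm_cong_AE) (auto simp: weak_div_def Hdiv_def dest: in_L2_measurable)

text \<open>\<open>N\<close> is a norm over the whole boundary although the pairing is over the
  interface; the two fit because the mortar function vanishes elsewhere. A zero field is allowed if
  \<open>N = 0\<close>, since the supremum asks for only one nonzero component.\<close>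

definition has_test_field :: "('n::finite) geometry \<Rightarrow> 'n discretization \<Rightarrow> nat \<Rightarrow> real \<Rightarrow> (real^'n \<Rightarrow> real) \<Rightarrow> bool" where
  "has_test_field \<G> D i c \<mu> \<longleftrightarrow> (let G = Omega_sub \<G> i; g = Q_p \<G> D i \<mu>; N = L2_norm (surf (frontier G)) g in
    in_L2 (surf (frontier G)) g \<and>
    (\<exists>\<zeta>\<in>Z_h D i. L2_inner (surf (Gamma_i \<G> i)) (normal_trace G \<zeta>) \<mu> = N\<^sup>2 \<and>
      Hdiv_norm G \<zeta> \<le> c * N \<and> in_L2 (vol G) \<zeta> \<and> (nonzero (vol G) \<zeta> \<or> N = 0)))"

text \<open>
  The test field on a subdomain: lift the projected mortar function \<open>g\<close> and interpolate. Testing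
  the interpolant with the normal trace of \<open>\<I> \<psi> - q\<close>, where \<open>q\<close> is the discrete field with normal
  trace \<open>g\<close>, shows that \<open>\<I> \<psi>\<close> has normal trace \<open>g\<close> on the interface.
\<close>

lemma subdomain_test_field:
  fixes \<G> :: "('n::finite) geometry"
  assumes dim: "2 \<le> CARD('n)" and geo: "admissible_geometry \<G>" and i: "i < n_sub \<G>"
  shows "\<exists>C\<ge>0. \<forall>\<kappa> r C' D \<I> K \<mu>. admissible_discretization \<G> \<kappa> r C' D \<and> mixed_interpolant \<G> D i (1/8) K \<I> \<and>
      0 \<le> K \<and> in_L2 (surf (Gamma_all \<G>)) \<mu> \<and> (\<forall>x. x \<notin> Gamma_all \<G> \<longrightarrow> \<mu> x = 0) \<longrightarrow>
    has_test_field \<G> D i (K * C) \<mu>"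
proof -
  define G where "G = Omega_sub \<G> i"
  let ?S = "frontier G"
  have poly: "polyhedral_domain G" and sub: "G \<subseteq> Omega \<G>"
    using admissible_subdomain[OF geo i] by (auto simp: G_def)
  have Gb: "open G" "bounded G" using poly by (auto intro: polyhedral_domain_open polyhedral_domain_bounded)
  have Om: "open (Omega \<G>)" "bounded (Omega \<G>)"
    using geo by (auto simp: admissible_geometry_def intro: polyhedral_domain_open polyhedral_domain_bounded)
  note fin = polyhedral_surface_regular(1)[OF poly dim]
  obtain C where C: "0 \<le> C"
    "\<And>g. in_L2 (surf ?S) g \<Longrightarrow> \<exists>\<psi> f. \<psi> \<in> Hs G (1/8) \<and> weak_div G \<psi> f \<and>
      has_normal_trace G \<psi> g \<and> Hs_norm G (1/8) \<psi> + L2_norm (vol G) f \<le> C * L2_norm (surf ?S) g"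
    by (rule polyhedral_lift[OF poly dim]) (rule that)
  show ?thesis
  proof (intro exI[of _ C] conjI C(1) allI impI)
    fix \<kappa> r C' D \<I> K and \<mu> :: "real^'n \<Rightarrow> real"
    assume "admissible_discretization \<G> \<kappa> r C' D \<and> mixed_interpolant \<G> D i (1/8) K \<I> \<and>
      0 \<le> K \<and> in_L2 (surf (Gamma_all \<G>)) \<mu> \<and> (\<forall>x. x \<notin> Gamma_all \<G> \<longrightarrow> \<mu> x = 0)"
    then have D: "admissible_discretization \<G> \<kappa> r C' D" and I: "mixed_interpolant \<G> D i (1/8) K \<I>" and K: "0 \<le> K"
      and \<mu>: "in_L2 (surf (Gamma_all \<G>)) \<mu>" "\<forall>x. x \<notin> Gamma_all \<G> \<longrightarrow> \<mu> x = 0" by auto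
    define Z where "Z = Z_h D i"
    have D': "fe_partition \<kappa> G (mesh D i)" "pw_poly_space (vol G) (mesh D i) r Z"
      "Z \<subseteq> restrict_to G (Z_space \<G>)" "\<And>q. q \<in> Z \<Longrightarrow> \<exists>g. has_normal_trace G q g"
      using D i by (auto simp: admissible_discretization_def Let_def G_def Z_def)
    have tr: "has_normal_trace G q (normal_trace G q)" if "q \<in> Z" for q
      using someI_ex[OF D'(4)[OF that]] by (simp add: normal_trace_def)
    have Sb: "?S \<in> sets borel" and Gab: "Gamma_all \<G> \<in> sets borel"
      using Gamma_all_closed[of \<G>] by auto
    have \<mu>S: "in_L2 (surf ?S) \<mu>" using \<mu> by (intro in_L2_surf_extend[OF Gab Sb]) auto
    define g where "g = Q_p \<G> D i \<mu>"
    have g_proj: "g = L2_proj (surf ?S) (trace_space G Z) \<mu>" by (simp add: g_def Q_p_def G_def Z_def)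
    note proj = trace_projection[OF poly dim D'(1,2) \<mu>S, folded g_proj]
    obtain q where q: "q \<in> Z" "has_normal_trace G q g" using proj(1) by (auto simp: trace_space_def)
    have gL2: "in_L2 (surf ?S) g" using q(2) by (auto simp: has_normal_trace_def)
    obtain \<psi> f where \<psi>: "\<psi> \<in> Hs G (1/8)" "weak_div G \<psi> f" "has_normal_trace G \<psi> g"
      "Hs_norm G (1/8) \<psi> + L2_norm (vol G) f \<le> C * L2_norm (surf ?S) g" using C(2)[OF gL2] by blast
    obtain u where u: "u \<in> Z_space \<G>" "AE x in vol G. q x = u x"
      using q(1) D'(3) by (auto simp: restrict_to_def)
    have \<psi>Z: "\<psi> \<in> restrict_to G (Z_space \<G>)"
      unfolding Z_space_def
      by (rule restrict_to_same_trace[OF Gb Om sub _ _ u(2) q(2) \<psi>(3)])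
        (use u(1) in \<open>auto simp: Z_space_def\<close>)
    define \<zeta> where "\<zeta> = \<I> \<psi>"
    have \<zeta>: "\<zeta> \<in> Z"
      and pair0: "\<And>\<zeta>' c. \<zeta>' \<in> Z \<Longrightarrow> normal_pairing G (\<lambda>x. \<zeta> x - \<psi> x)
          (\<lambda>x. if x \<in> Gamma_i \<G> i then normal_trace G \<zeta>' x else 0) c \<Longrightarrow> c = 0"
      and \<zeta>_norm: "Hdiv_norm G \<zeta> \<le> K * (Hs_norm G (1/8) \<psi> + L2_norm (vol G) (dvg G \<psi>))"
      using I \<psi>(1) \<psi>Z unfolding mixed_interpolant_def Let_def G_def[symmetric] Z_def \<zeta>_def by blast+
    define \<zeta>' where "\<zeta>' = (\<lambda>x. 1 *\<^sub>R \<zeta> x + (-1) *\<^sub>R q x)"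
    have \<zeta>'Z: "\<zeta>' \<in> Z" unfolding \<zeta>'_def by (rule pw_poly_lincomb[OF D'(2) \<zeta> q(1)])
    define s where "s = normal_trace G \<zeta>'"
    have s: "has_normal_trace G \<zeta>' s" unfolding s_def by (rule tr[OF \<zeta>'Z])
    have sL2: "in_L2 (surf ?S) s" using s by (auto simp: has_normal_trace_def)
    define t where "t = normal_trace G \<zeta>"
    have t: "has_normal_trace G \<zeta> t" unfolding t_def by (rule tr[OF \<zeta>])
    have tL2: "in_L2 (surf ?S) t" using t by (auto simp: has_normal_trace_def)
    have ts: "AE x in surf ?S. 1 * t x + (-1) * g x = s x"
      by (rule normal_trace_unique[OF Gb fin _ s])
        (use has_normal_trace_lincomb[OF Gb fin t q(2), of 1 "-1"] in \<open>auto simp: \<zeta>'_def\<close>)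
    have t\<psi>: "has_normal_trace G (\<lambda>x. \<zeta> x - \<psi> x) (\<lambda>x. t x - g x)"
      using has_normal_trace_lincomb[OF Gb fin t \<psi>(3), of 1 "-1"] by simp
    define \<Gamma> where "\<Gamma> = Gamma_i \<G> i"
    have \<Gamma>: "\<Gamma> = ?S \<inter> Gamma_all \<G>" by (simp add: \<Gamma>_def Gamma_i_def G_def)
    have \<Gamma>b: "\<Gamma> \<in> sets borel" using Sb Gab by (simp add: \<Gamma>)
    let ?s\<Gamma> = "\<lambda>x. if x \<in> \<Gamma> then s x else 0"
    \<comment> \<open>The interpolation error has the L2 trace \<open>t - g\<close>, so the first
      alternative of \<open>normal_pairing\<close> applies.\<close>
    have "L2_inner (surf ?S) (\<lambda>x. t x - g x) ?s\<Gamma> = 0"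
    proof (rule pair0[OF \<zeta>'Z], unfold normal_pairing_def, intro disjI1 exI conjI)
      show "has_normal_trace G (\<lambda>x. \<zeta> x - \<psi> x) (\<lambda>x. t x - g x)" by (rule t\<psi>)
    qed (simp only: \<Gamma>_def s_def)
    \<comment> \<open>The error trace \<open>t - g\<close> is itself the test trace
      \<open>s\<close>, so the vanishing pairing is the squared norm of \<open>s\<close> on the
      interface.\<close>
    moreover have "L2_inner (surf ?S) (\<lambda>x. t x - g x) ?s\<Gamma> = L2_inner (surf ?S) s ?s\<Gamma>"
    proof (rule L2_inner_cong_AE)
      show "AE x in surf ?S. t x - g x = s x" using ts by simp
      have [measurable]: "t \<in> borel_measurable (surf ?S)" "g \<in> borel_measurable (surf ?S)" "s \<in> borel_measurable (surf ?S)"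
        using tL2 gL2 sL2 by (auto dest: in_L2_measurable)
      show "(\<lambda>x. t x - g x) \<in> borel_measurable (surf ?S)" "s \<in> borel_measurable (surf ?S)" by measurable
      have m\<Gamma>: "(indicator \<Gamma> :: _ \<Rightarrow> real) \<in> borel_measurable (surf ?S)"
        using \<Gamma>b by (intro measurable_restrict_space1 borel_measurable_indicator) simp
      have "?s\<Gamma> = (\<lambda>x. indicator \<Gamma> x *\<^sub>R s x)" by (auto simp: indicator_def)
      then show "?s\<Gamma> \<in> borel_measurable (surf ?S)"
        using borel_measurable_scaleR[OF m\<Gamma> in_L2_measurable[OF sL2]] by (simp only:)
    qed
    moreover have "L2_inner (surf ?S) s ?s\<Gamma> = (LINT x|flat_area. indicator \<Gamma> x *\<^sub>R (s x)\<^sup>2)"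
      unfolding L2_inner_def using Sb
      by (subst integral_restrict_space)
        (auto intro!: Bochner_Integration.integral_cong simp: indicator_def \<Gamma> power2_eq_square)
    moreover have "\<dots> = (L2_norm (surf \<Gamma>) s)\<^sup>2"
      using \<Gamma>b by (simp add: L2_norm_power2 integral_restrict_space)
    ultimately have s0: "(L2_norm (surf \<Gamma>) s)\<^sup>2 = 0" by simp
    have sub_L2: "in_L2 (surf \<Gamma>) h" if h: "in_L2 (surf ?S) h" for h :: "real^'n \<Rightarrow> real"
      using \<Gamma> by (intro in_L2_surf_subset[OF \<Gamma>b Sb _ h]) auto
    have "AE x in surf \<Gamma>. s x = 0" using s0 L2_norm_eq_0_iff[OF sub_L2[OF sL2]] by simp
    moreover have "AE x in surf \<Gamma>. t x - g x = s x"
      using ts Sb \<Gamma>b by (simp add: AE_restrict_space_iff) (auto elim!: AE_mp simp: \<Gamma>)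
    ultimately have "AE x in surf \<Gamma>. t x = g x" by eventually_elim simp
    then have "L2_inner (surf \<Gamma>) t \<mu> = L2_inner (surf \<Gamma>) g \<mu>"
      using sub_L2[OF tL2] sub_L2[OF gL2] sub_L2[OF \<mu>S] by (intro L2_inner_cong_AE) (auto dest: in_L2_measurable)
    also have "\<dots> = L2_inner (surf ?S) g \<mu>"
      unfolding \<Gamma> using \<mu>(2) by (intro L2_inner_surf_Int Sb Gab) auto
    \<comment> \<open>The projection \<open>g\<close> is an admissible test for its own
      orthogonality relation.\<close>
    also have "\<dots> = (L2_norm (surf ?S) g)\<^sup>2"
      using proj(2)[OF proj(1)] L2_inner_diff_left[OF \<mu>S gL2 gL2]
      by (simp add: L2_norm_power2_eq_inner L2_inner_commute)
    finally have inner: "L2_inner (surf \<Gamma>) t \<mu> = (L2_norm (surf ?S) g)\<^sup>2" .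
    have "Hdiv_norm G \<zeta> \<le> K * (C * L2_norm (surf ?S) g)"
      using \<zeta>_norm \<psi>(4) K unfolding Hdiv_norm_eq[OF Gb \<psi>(2)]
      by (meson mult_left_mono order_trans)
    then have norm: "Hdiv_norm G \<zeta> \<le> K * C * L2_norm (surf ?S) g" by (simp add: mult.assoc)
    have \<zeta>L2: "in_L2 (vol G) \<zeta>" using t by (auto simp: has_normal_trace_def Hdiv_def weak_div_def)
    \<comment> \<open>A zero field has zero trace, while the pairing equals the squared norm of
      \<open>g\<close>.\<close>
    have nz: "L2_norm (surf ?S) g = 0" if "\<not> nonzero (vol G) \<zeta>"
    proof -
      have "AE x in vol G. \<zeta> x = 0" using that by (simp add: nonzero_def)
      then have "AE x in surf ?S. t x = 0" by (rule normal_trace_unique[OF Gb fin t has_normal_trace_zero[OF Gb]])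
      then have "AE x in surf \<Gamma>. t x = 0"
        using Sb \<Gamma>b by (simp add: AE_restrict_space_iff) (auto elim!: AE_mp simp: \<Gamma>)
      then have "L2_inner (surf \<Gamma>) t \<mu> = 0"
        unfolding L2_inner_def by (intro integral_eq_zero_AE) (auto elim!: AE_mp)
      then show ?thesis using inner by simp
    qed
    have "L2_inner (surf (Gamma_i \<G> i)) (normal_trace G \<zeta>) \<mu> = (L2_norm (surf ?S) g)\<^sup>2"
      using inner by (simp only: \<Gamma>_def t_def)
    then show "has_test_field \<G> D i (K * C) \<mu>"
      unfolding has_test_field_def Let_def
      using gL2 \<zeta> norm \<zeta>L2 nz unfolding G_def[symmetric] g_def[symmetric] Z_def by (intro conjI bexI[of _ \<zeta>]) auto
  qed
qed

text \<open>An inequality, so overlaps of the pieces, which only enlarge the right-hand side, need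
  no argument.\<close>

lemma L2_norm_surf_Union_le:
  fixes f :: "real^'n::finite \<Rightarrow> real"
  assumes I: "finite I" "\<And>i. i \<in> I \<Longrightarrow> S i \<in> sets borel" and f: "in_L2 (surf (\<Union>i\<in>I. S i)) f"
  shows "(L2_norm (surf (\<Union>i\<in>I. S i)) f)\<^sup>2 \<le> (\<Sum>i\<in>I. (L2_norm (surf (S i)) f)\<^sup>2)"
proof -
  let ?U = "\<Union>i\<in>I. S i"
  have U: "?U \<in> sets borel" using I by (intro sets.finite_UN) auto
  have intS: "integrable flat_area (\<lambda>x. indicator (S i) x *\<^sub>R (f x)\<^sup>2)" if "i \<in> I" for i
  proof -
    have "in_L2 (surf (S i)) f" using that I U f by (intro in_L2_surf_subset[OF _ U _ f]) auto
    then show ?thesis using I(2)[OF that] by (simp add: in_L2_def integrable_restrict_space)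
  qed
  have "(L2_norm (surf ?U) f)\<^sup>2 = (LINT x|flat_area. indicator ?U x *\<^sub>R (f x)\<^sup>2)"
    using U by (simp add: L2_norm_power2 integral_restrict_space)
  also have "\<dots> \<le> (LINT x|flat_area. (\<Sum>i\<in>I. indicator (S i) x *\<^sub>R (f x)\<^sup>2))"
  proof (rule integral_mono)
    show "integrable flat_area (\<lambda>x. indicator ?U x *\<^sub>R (f x)\<^sup>2)"
      using f U by (simp add: in_L2_def integrable_restrict_space)
    show "integrable flat_area (\<lambda>x. \<Sum>i\<in>I. indicator (S i) x *\<^sub>R (f x)\<^sup>2)"
      by (intro Bochner_Integration.integrable_sum intS)
    fix x
    show "indicator ?U x *\<^sub>R (f x)\<^sup>2 \<le> (\<Sum>i\<in>I. indicator (S i) x *\<^sub>R (f x)\<^sup>2)"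
    proof (cases "x \<in> ?U")
      case True
      then obtain i where i: "i \<in> I" "x \<in> S i" by auto
      have "indicator (S i) x *\<^sub>R (f x)\<^sup>2 \<le> (\<Sum>i\<in>I. indicator (S i) x *\<^sub>R (f x)\<^sup>2)"
        by (rule member_le_sum[OF i(1)]) (auto simp: I)
      then show ?thesis using True i by simp
    qed (simp add: sum_nonneg)
  qed
  also have "\<dots> = (\<Sum>i\<in>I. (LINT x|flat_area. indicator (S i) x *\<^sub>R (f x)\<^sup>2))"
    by (intro Bochner_Integration.integral_sum intS)
  also have "\<dots> = (\<Sum>i\<in>I. (L2_norm (surf (S i)) f)\<^sup>2)"
    using I by (intro sum.cong) (auto simp: L2_norm_power2 integral_restrict_space)
  finally show ?thesis .
qed

theorem lemma3p1:
  fixes \<G> :: "('n::finite) geometry" and \<D> :: "'n discretization set"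
  assumes "CARD('n) = 2 \<or> CARD('n) = 3"
    and "admissible_geometry \<G>"
    and "admissible_family \<G> \<D>"
    and "mortar_condition \<G> \<D>"
  shows "\<exists>\<beta>>0. \<forall>D\<in>\<D>. \<forall>\<mu>\<in>mortar_space \<G> (Lambda_p_ij D).
    ereal (L2_norm (surf (Gamma_all \<G>)) \<mu>) \<le>
      ereal \<beta> * (SUP \<zeta>\<in>{\<zeta>\<in>Zh_sum \<G> D. Zh_nonzero \<G> \<zeta>}.
        ereal ((\<Sum>i<n_sub \<G>.
            L2_inner (surf (Gamma_i \<G> i)) (normal_trace (Omega_sub \<G> i) (\<zeta> i)) \<mu>) / Zh_norm \<G> \<zeta>))"
proof -
  let ?n = "n_sub \<G>" and ?\<Gamma> = "Gamma_all \<G>"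
  let ?S = "\<lambda>i. frontier (Omega_sub \<G> i)"
  have dim: "2 \<le> CARD('n)" using assms(1) by auto
  obtain \<kappa> r C0 where D0: "\<And>D. D \<in> \<D> \<Longrightarrow> admissible_discretization \<G> \<kappa> r C0 D"
    using assms(3) unfolding admissible_family_def by blast
  have "\<exists>C>0. \<forall>D\<in>\<D>. \<forall>i<?n. \<exists>\<I>. mixed_interpolant \<G> D i (1/8) C \<I>"
    using assms(3) by (simp add: admissible_family_def)
  then obtain K where K: "0 < K" "\<And>D i. D \<in> \<D> \<Longrightarrow> i < ?n \<Longrightarrow> \<exists>\<I>. mixed_interpolant \<G> D i (1/8) K \<I>" by blast
  have "\<exists>C\<ge>0. \<forall>D\<in>\<D>. \<forall>\<mu>\<in>mortar_space \<G> (Lambda_p_ij D). has_test_field \<G> D i (K * C) \<mu>" if i: "i < ?n" for i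
  proof -
    from subdomain_test_field[OF dim assms(2) i] obtain C where C: "0 \<le> C"
      "\<And>\<kappa> r C' D \<I> K \<mu>. admissible_discretization \<G> \<kappa> r C' D \<and> mixed_interpolant \<G> D i (1/8) K \<I> \<and>
        0 \<le> K \<and> in_L2 (surf ?\<Gamma>) \<mu> \<and> (\<forall>x. x \<notin> ?\<Gamma> \<longrightarrow> \<mu> x = 0) \<Longrightarrow>
        has_test_field \<G> D i (K * C) \<mu>"
      by (elim exE conjE) presburger
    have "has_test_field \<G> D i (K * C) \<mu>" if D: "D \<in> \<D>" and \<mu>: "\<mu> \<in> mortar_space \<G> (Lambda_p_ij D)" for D \<mu>
    proof -
      obtain \<I> where "mixed_interpolant \<G> D i (1/8) K \<I>" using K(2)[OF D i] by blast
      then show ?thesis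
        using D0[OF D] K(1) \<mu> by (intro C(2)) (auto simp: mortar_space_def)
    qed
    then show ?thesis using C(1) by blast
  qed
  then obtain c where c: "\<And>i. i < ?n \<Longrightarrow> 0 \<le> c i"
    "\<And>i D \<mu>. i < ?n \<Longrightarrow> D \<in> \<D> \<Longrightarrow> \<mu> \<in> mortar_space \<G> (Lambda_p_ij D) \<Longrightarrow> has_test_field \<G> D i (K * c i) \<mu>" by metis
  \<comment> \<open>A sum dominates all the constants and, unlike a maximum, is defined for an empty
    index set too.\<close>
  define cm where "cm = (\<Sum>i<?n. c i)"
  have cm: "c i \<le> cm" if "i < ?n" for i
    unfolding cm_def using that c(1) by (intro member_le_sum) auto
  have cm0: "0 \<le> cm" unfolding cm_def using c(1) by (intro sum_nonneg) auto
  obtain Cm where Cm: "0 < Cm" "\<And>D i j \<mu>. D \<in> \<D> \<Longrightarrow> j < ?n \<Longrightarrow> i < j \<Longrightarrow> \<mu> \<in> mortar_space \<G> (Lambda_p_ij D) \<Longrightarrow>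
      L2_norm (surf (Gamma_ij \<G> i j)) \<mu> \<le>
        Cm * (L2_norm (surf (Gamma_ij \<G> i j)) (Q_p \<G> D i \<mu>) + L2_norm (surf (Gamma_ij \<G> i j)) (Q_p \<G> D j \<mu>))"
    using assms(4) unfolding mortar_condition_def Let_def by blast
  \<comment> \<open>Without subdomains there would be no nonzero tuple, and the supremum would be
    over the empty set.\<close>
  have n0: "0 < ?n"
  proof (rule ccontr)
    assume "\<not> 0 < ?n"
    then have "closure (Omega \<G>) = {}" using assms(2) by (simp add: admissible_geometry_def)
    then show False using assms(2) by (simp add: admissible_geometry_def polyhedral_domain_def)
  qed
  \<comment> \<open>There are at most n^2 interfaces, n the number of subdomains, and on each of
    them the mortar condition gives the bound \<open>2 * Cm * \<rho>\<close>.\<close>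
  define b where "b = 2 * real ?n * Cm"
  have b0: "0 \<le> b" using Cm(1) by (simp add: b_def)
  have Sb: "?S i \<in> sets borel" for i by simp
  have Gijb: "Gamma_ij \<G> i j \<in> sets borel" for i j by (simp add: Gamma_ij_def)
  have Gb: "?\<Gamma> \<in> sets borel" using Gamma_all_closed[of \<G>] by auto
  \<comment> \<open>The \<open>+ 1\<close> keeps the constant positive if
    \<open>b * (K * cm)\<close> is zero; it is harmless because the quotients reached below are
    nonnegative.\<close>
  show ?thesis
  proof (intro exI[of _ "b * (K * cm) + 1"] conjI ballI)
    show "0 < b * (K * cm) + 1" using b0 K(1) cm0 by (intro add_nonneg_pos mult_nonneg_nonneg) auto
    fix D \<mu> assume D: "D \<in> \<D>" and \<mu>: "\<mu> \<in> mortar_space \<G> (Lambda_p_ij D)"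
    have \<mu>L2: "in_L2 (surf ?\<Gamma>) \<mu>" using \<mu> by (simp add: mortar_space_def)
    define V where "V = (\<lambda>\<zeta>. (\<Sum>i<?n. L2_inner (surf (Gamma_i \<G> i)) (normal_trace (Omega_sub \<G> i) (\<zeta> i)) \<mu>) / Zh_norm \<G> \<zeta>)"
    define \<Z> where "\<Z> = {\<zeta>\<in>Zh_sum \<G> D. Zh_nonzero \<G> \<zeta>}"
    define N where "N = (\<lambda>i. L2_norm (surf (?S i)) (Q_p \<G> D i \<mu>))"
    have N0: "0 \<le> N i" for i by (simp add: N_def L2_norm_nonneg)
    have QL2: "in_L2 (surf (?S i)) (Q_p \<G> D i \<mu>)" if "i < ?n" for i
      using c(2)[OF that D \<mu>] by (simp add: has_test_field_def Let_def)
    \<comment> \<open>Chosen so that the pairing of the test tuple is \<open>\<rho>\<^sup>2\<close>,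
      while its norm is at most a multiple of \<open>\<rho>\<close>.\<close>
    define \<rho> where "\<rho> = sqrt (\<Sum>i<?n. (N i)\<^sup>2)"
    have \<rho>0: "0 \<le> \<rho>" by (simp add: \<rho>_def sum_nonneg)
    have \<rho>2: "\<rho>\<^sup>2 = (\<Sum>i<?n. (N i)\<^sup>2)" by (simp add: \<rho>_def sum_nonneg)
    have N_le: "N i \<le> \<rho>" if "i < ?n" for i
      unfolding \<rho>_def using that by (intro real_le_rsqrt member_le_sum) auto
    have \<mu>_le: "L2_norm (surf ?\<Gamma>) \<mu> \<le> b * \<rho>"
    proof -
      define I where "I = (SIGMA j:{..<?n}. {..<j})"
      have I: "finite I" by (simp add: I_def)
      have U: "?\<Gamma> = (\<Union>p\<in>I. Gamma_ij \<G> (snd p) (fst p))" unfolding Gamma_all_def I_def by force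
      have pw: "(L2_norm (surf (Gamma_ij \<G> (snd p) (fst p))) \<mu>)\<^sup>2 \<le> (2 * Cm * \<rho>)\<^sup>2" if p: "p \<in> I" for p
      proof -
        obtain j i where p': "p = (j, i)" by (cases p)
        have ij: "j < ?n" "i < j" "i < ?n" using p by (auto simp: I_def p')
        have "L2_norm (surf (Gamma_ij \<G> i j)) (Q_p \<G> D i \<mu>) \<le> N i"
          unfolding N_def by (intro L2_norm_surf_mono Gijb Sb QL2 ij) (auto simp: Gamma_ij_def)
        moreover have "L2_norm (surf (Gamma_ij \<G> i j)) (Q_p \<G> D j \<mu>) \<le> N j"
          unfolding N_def by (intro L2_norm_surf_mono Gijb Sb QL2 ij) (auto simp: Gamma_ij_def)
        ultimately have "L2_norm (surf (Gamma_ij \<G> i j)) (Q_p \<G> D i \<mu>) + L2_norm (surf (Gamma_ij \<G> i j)) (Q_p \<G> D j \<mu>) \<le> 2 * \<rho>"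
          using N_le[OF ij(1)] N_le[OF ij(3)] by linarith
        then have "Cm * (L2_norm (surf (Gamma_ij \<G> i j)) (Q_p \<G> D i \<mu>) + L2_norm (surf (Gamma_ij \<G> i j)) (Q_p \<G> D j \<mu>)) \<le> Cm * (2 * \<rho>)"
          using Cm(1) by (intro mult_left_mono) auto
        then have "L2_norm (surf (Gamma_ij \<G> i j)) \<mu> \<le> 2 * Cm * \<rho>"
          using Cm(2)[OF D ij(1,2) \<mu>] by simp
        then show ?thesis unfolding p' by (intro power_mono) (auto simp: L2_norm_nonneg)
      qed
      have "(L2_norm (surf ?\<Gamma>) \<mu>)\<^sup>2 \<le> (\<Sum>p\<in>I. (L2_norm (surf (Gamma_ij \<G> (snd p) (fst p))) \<mu>)\<^sup>2)"
        using \<mu>L2 unfolding U by (intro L2_norm_surf_Union_le I Gijb)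
      also have "\<dots> \<le> (\<Sum>p\<in>I. (2 * Cm * \<rho>)\<^sup>2)" by (intro sum_mono pw)
      also have "\<dots> = real (card I) * (2 * Cm * \<rho>)\<^sup>2" by simp
      also have "\<dots> \<le> (real ?n)\<^sup>2 * (2 * Cm * \<rho>)\<^sup>2"
      proof (intro mult_right_mono)
        have "I \<subseteq> {..<?n} \<times> {..<?n}" by (auto simp: I_def)
        then have "card I \<le> card ({..<?n} \<times> {..<?n})" by (intro card_mono) auto
        then have "card I \<le> ?n\<^sup>2" by (simp add: power2_eq_square)
        then show "real (card I) \<le> (real ?n)\<^sup>2" by (metis of_nat_le_iff of_nat_power)
      qed simp
      also have "\<dots> = (b * \<rho>)\<^sup>2" by (simp add: b_def power_mult_distrib)
      finally have "(L2_norm (surf ?\<Gamma>) \<mu>)\<^sup>2 \<le> (b * \<rho>)\<^sup>2" .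
      then show ?thesis by (rule power2_le_imp_le) (rule mult_nonneg_nonneg[OF b0 \<rho>0])
    qed
    have sup: "ereal (V \<zeta>) \<le> (SUP \<zeta>\<in>\<Z>. ereal (V \<zeta>))" if "\<zeta> \<in> \<Z>" for \<zeta>
      using that by (intro SUP_upper)
    have \<beta>0: "0 \<le> b * (K * cm)" using b0 K(1) cm0 by simp
    have "\<exists>\<zeta>\<in>\<Z>. L2_norm (surf ?\<Gamma>) \<mu> \<le> (b * (K * cm) + 1) * V \<zeta>"
    proof (cases "\<rho> = 0")
      case True
      then have "L2_norm (surf ?\<Gamma>) \<mu> = 0" using \<mu>_le L2_norm_nonneg[of "surf ?\<Gamma>" \<mu>] by simp
      then have "AE x in surf ?\<Gamma>. \<mu> x = 0" using L2_norm_eq_0_iff[OF \<mu>L2] by simp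
      then have AEi: "AE x in surf (Gamma_i \<G> i). \<mu> x = 0" for i
        using Gb by (simp add: AE_restrict_space_iff Gamma_i_def) (auto elim!: AE_mp)
      \<comment> \<open>The mortar function vanishes almost everywhere here, but a nonzero tuple is
        still required to keep the supremum from being \<open>- \<infinity>\<close>.\<close>
      have "\<forall>i<?n. \<exists>q. q \<in> Z_h D i \<and> nonzero (vol (Omega_sub \<G> i)) q"
        using D0[OF D] by (auto simp: admissible_discretization_def Let_def)
      then obtain \<zeta> where \<zeta>: "\<And>i. i < ?n \<Longrightarrow> \<zeta> i \<in> Z_h D i \<and> nonzero (vol (Omega_sub \<G> i)) (\<zeta> i)" by metis
      have "\<zeta> \<in> \<Z>" using \<zeta> n0 by (auto simp: \<Z>_def Zh_sum_def Zh_nonzero_def)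
      moreover have "L2_inner (surf (Gamma_i \<G> i)) (normal_trace (Omega_sub \<G> i) (\<zeta> i)) \<mu> = 0" for i
        unfolding L2_inner_def using AEi[of i] by (intro integral_eq_zero_AE) (auto elim!: AE_mp)
      then have "V \<zeta> = 0" by (simp add: V_def)
      ultimately show ?thesis using \<open>L2_norm (surf ?\<Gamma>) \<mu> = 0\<close> by (intro bexI[of _ \<zeta>]) auto
    next
      case False
      then have \<rho>pos: "0 < \<rho>" using \<rho>0 by simp
      have "\<forall>i<?n. \<exists>\<zeta>. \<zeta> \<in> Z_h D i \<and>
          L2_inner (surf (Gamma_i \<G> i)) (normal_trace (Omega_sub \<G> i) \<zeta>) \<mu> = (N i)\<^sup>2 \<and>
          Hdiv_norm (Omega_sub \<G> i) \<zeta> \<le> K * c i * N i \<and> in_L2 (vol (Omega_sub \<G> i)) \<zeta> \<and>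
          (nonzero (vol (Omega_sub \<G> i)) \<zeta> \<or> N i = 0)"
        using c(2)[OF _ D \<mu>] unfolding has_test_field_def Let_def N_def by blast
      then obtain \<zeta> where \<zeta>: "\<And>i. i < ?n \<Longrightarrow> \<zeta> i \<in> Z_h D i"
        "\<And>i. i < ?n \<Longrightarrow> L2_inner (surf (Gamma_i \<G> i)) (normal_trace (Omega_sub \<G> i) (\<zeta> i)) \<mu> = (N i)\<^sup>2"
        "\<And>i. i < ?n \<Longrightarrow> Hdiv_norm (Omega_sub \<G> i) (\<zeta> i) \<le> K * c i * N i"
        "\<And>i. i < ?n \<Longrightarrow> in_L2 (vol (Omega_sub \<G> i)) (\<zeta> i)"
        "\<And>i. i < ?n \<Longrightarrow> nonzero (vol (Omega_sub \<G> i)) (\<zeta> i) \<or> N i = 0" by metis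
      \<comment> \<open>Where \<open>N i\<close> is nonzero so is the test field, which admits the
        tuple to the supremum and makes the denominator positive.\<close>
      have "\<exists>i<?n. N i \<noteq> 0"
      proof (rule ccontr)
        assume "\<not> ?thesis"
        then have "(\<Sum>i<?n. (N i)\<^sup>2) = 0" by simp
        then show False using \<rho>2 \<rho>pos by simp
      qed
      then obtain k where k: "k < ?n" "nonzero (vol (Omega_sub \<G> k)) (\<zeta> k)" using \<zeta>(5) by blast
      have \<zeta>Z: "\<zeta> \<in> \<Z>" using \<zeta>(1) k by (auto simp: \<Z>_def Zh_sum_def Zh_nonzero_def)
      have Zh: "Zh_norm \<G> \<zeta> = sqrt (\<Sum>i<?n. (Hdiv_norm (Omega_sub \<G> i) (\<zeta> i))\<^sup>2)"
        by (simp add: Zh_norm_def Hdiv_norm_def sum.distrib)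
      have "0 < Zh_norm \<G> \<zeta>"
      proof -
        have "L2_norm (vol (Omega_sub \<G> k)) (\<zeta> k) \<noteq> 0"
          using L2_norm_eq_0_iff[OF \<zeta>(4)[OF k(1)]] k(2) by (simp add: nonzero_def)
        then have "0 < (L2_norm (vol (Omega_sub \<G> k)) (\<zeta> k))\<^sup>2" by simp
        also have "\<dots> \<le> (\<Sum>i<?n. (L2_norm (vol (Omega_sub \<G> i)) (\<zeta> i))\<^sup>2)"
          using k(1) by (intro member_le_sum) auto
        finally show ?thesis unfolding Zh_norm_def by (simp add: add_pos_nonneg sum_nonneg)
      qed
      moreover have "Zh_norm \<G> \<zeta> \<le> K * cm * \<rho>"
      proof -
        have "(\<Sum>i<?n. (Hdiv_norm (Omega_sub \<G> i) (\<zeta> i))\<^sup>2) \<le> (\<Sum>i<?n. (K * cm)\<^sup>2 * (N i)\<^sup>2)"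
        proof (rule sum_mono)
          fix i assume "i \<in> {..<?n}"
          then have i: "i < ?n" by simp
          have "K * c i * N i \<le> K * cm * N i"
            using cm[OF i] K(1) N0 by (intro mult_right_mono mult_left_mono) auto
          then have "Hdiv_norm (Omega_sub \<G> i) (\<zeta> i) \<le> K * cm * N i" using \<zeta>(3)[OF i] by linarith
          then have "(Hdiv_norm (Omega_sub \<G> i) (\<zeta> i))\<^sup>2 \<le> (K * cm * N i)\<^sup>2"
            by (intro power_mono) (simp_all add: Hdiv_norm_def)
          then show "(Hdiv_norm (Omega_sub \<G> i) (\<zeta> i))\<^sup>2 \<le> (K * cm)\<^sup>2 * (N i)\<^sup>2"
            by (simp add: power_mult_distrib)
        qed
        also have "\<dots> = (K * cm * \<rho>)\<^sup>2" by (simp add: sum_distrib_left[symmetric] \<rho>2 power_mult_distrib)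
        finally show ?thesis unfolding Zh using K(1) cm0 \<rho>0 by (intro real_le_lsqrt) auto
      qed
      moreover have V\<zeta>: "V \<zeta> = \<rho>\<^sup>2 / Zh_norm \<G> \<zeta>" using \<zeta>(2) by (simp add: V_def \<rho>2)
      \<comment> \<open>The pairing \<open>\<rho>\<^sup>2\<close> divided by a norm of at most
        \<open>K * cm * \<rho>\<close>.\<close>
      ultimately have "\<rho> \<le> K * cm * V \<zeta>"
      proof -
        assume *: "0 < Zh_norm \<G> \<zeta>" "Zh_norm \<G> \<zeta> \<le> K * cm * \<rho>"
        have "\<rho> * Zh_norm \<G> \<zeta> \<le> \<rho> * (K * cm * \<rho>)" using *(2) \<rho>0 by (intro mult_left_mono)
        then show ?thesis using *(1) by (simp add: V\<zeta> field_simps power2_eq_square)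
      qed
      then have "b * \<rho> \<le> b * (K * cm * V \<zeta>)" using b0 by (intro mult_left_mono)
      moreover have "0 \<le> V \<zeta>" using \<open>0 < Zh_norm \<G> \<zeta>\<close> by (simp add: V\<zeta>)
      ultimately have "L2_norm (surf ?\<Gamma>) \<mu> \<le> (b * (K * cm) + 1) * V \<zeta>"
        using \<mu>_le by (simp add: distrib_right mult.assoc)
      then show ?thesis using \<zeta>Z by blast
    qed
    then obtain \<zeta> where \<zeta>: "\<zeta> \<in> \<Z>" "L2_norm (surf ?\<Gamma>) \<mu> \<le> (b * (K * cm) + 1) * V \<zeta>" by blast
    have "ereal (L2_norm (surf ?\<Gamma>) \<mu>) \<le> ereal (b * (K * cm) + 1) * ereal (V \<zeta>)" using \<zeta>(2) by simp
    also have "\<dots> \<le> ereal (b * (K * cm) + 1) * (SUP \<zeta>\<in>\<Z>. ereal (V \<zeta>))"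
      using \<beta>0 by (intro ereal_mult_left_mono sup \<zeta>(1)) simp
    finally show "ereal (L2_norm (surf ?\<Gamma>) \<mu>) \<le> ereal (b * (K * cm) + 1) *
      (SUP \<zeta>\<in>{\<zeta>\<in>Zh_sum \<G> D. Zh_nonzero \<G> \<zeta>}.
        ereal ((\<Sum>i<?n. L2_inner (surf (Gamma_i \<G> i)) (normal_trace (Omega_sub \<G> i) (\<zeta> i)) \<mu>) / Zh_norm \<G> \<zeta>))"
      unfolding V_def \<Z>_def .
  qed
qed

end
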